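(* Let $\widetilde{\mathfrak G}$ be the group defined in the context, with the subgroups $\tilde N_m$, the modules $V_n$, their subspaces $V_n^r$, and the isomorphisms $\alpha\oplus\beta\oplus\gamma:\tilde N_m/\tilde N_{m+1}\to V_m\oplus V_m\oplus V_{m-1}$. Let $\gamma_n(\widetilde{\mathfrak G})$ denote the lower central series of $\widetilde{\mathfrak G}$ (with $\gamma_1(\widetilde{\mathfrak G})=\widetilde{\mathfrak G}$). For all $m\ge1$: 1. $\gamma_{2^m+1}(\widetilde{\mathfrak G})=\tilde N_m$. 2. $\gamma_{2^m+1+r}(\widetilde{\mathfrak G})=\tilde N_{m+1}\,\alpha^{-1}(V_m^r)\,\beta^{-1}(V_m^r)\,\gamma^{-1}(V_{m-1}^r)$ for $r=0,\dots,2^m$. 3. $$\operatorname{rank}(\gamma_n(\widetilde{\mathfrak G})/\gamma_{n+1}(\widetilde{\mathfrak G}))=\begin{cases}4&\text{if }n=1,\\3&\text{if }n=2,\\3&\text{if }n=2^m+1+r\text{ with }0\le r<2^{m-1},\\2&\text{if }n=2^m+1+r\text{ with }2^{m-1}\le r<2^m.\end{cases}$$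
   Context: Let $\Sigma=\mathbb F_2=\{0,1\}$ and let $\Sigma^*$ be the set of finite words over $\Sigma$, viewed as a rooted binary tree. For $x\in\Sigma$ write $\overline x=1-x$. Define tree automorphisms $a,\tilde b,\tilde c,\tilde d$ of $\Sigma^*$ (acting on the left; words too short for a rule to apply are fixed) by $a(x\sigma)=\overline x\sigma$; $\tilde b(0x\sigma)=0\overline x\sigma$, $\tilde b(1\sigma)=1\tilde c(\sigma)$; $\tilde c(0\sigma)=0\sigma$, $\tilde c(1\sigma)=1\tilde d(\sigma)$; $\tilde d(0\sigma)=0\sigma$, $\tilde d(1\sigma)=1\tilde b(\sigma)$. Put $\widetilde{\mathfrak G}=\langle a,\tilde b,\tilde c,\tilde d\rangle$. An automorphism fixing all words of length $m$ is identified with the $2^m$-tuple $(g_\sigma)_{\sigma\in\Sigma^m}$ (lexicographic order) of its actions on the subtrees below the words of length $m$: $g(\sigma\tau)=\sigma g_\sigma(\tau)$. Conventions: $[g,h]=ghg^{-1}h^{-1}$. Let $x=[a,\tilde b]$, $y=[a,\tilde d]$, let $\tilde K$ be the normal closure of $\{x,y\}$ in $\widetilde{\mathfrak G}$, and let $\tilde T$ be the normal closure of $x^2$ in $\widetilde{\mathfrak G}$. One has $\tilde K\times\tilde K\le\tilde K$. For $Q\le\tilde K$ let $Q_m=Q\times\dots\times Q$ ($2^m$ copies), a subgroup of $\widetilde{\mathfrak G}$ acting on each subtree starting on level $m$ by the corresponding factor ($Q_0=Q$). For $m\ge1$ let $\tilde N_m=\tilde K_m\cdot\tilde T_{m-1}$.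 For $n\ge0$ let $V_n=\mathbb F_2[X_1,\dots,X_n]/(X_1^2-1,\dots,X_n^2-1)$ (so $V_0=\mathbb F_2$); the word $\sigma_1\cdots\sigma_n\in\Sigma^n$ corresponds to the monomial $X_1^{\sigma_1}\cdots X_n^{\sigma_n}$. For $0\le r\le 2^n-1$ with binary expansion $r=\sum_{i=1}^n r_i2^{i-1}$, $r_i\in\{0,1\}$, put $v_n^r=(1-X_1)^{r_1}\cdots(1-X_n)^{r_n}$ and let $V_n^r$ be the span of $v_n^r,v_n^{r+1},\dots,v_n^{2^n-1}$; put $V_n^r=0$ for $r\ge2^n$. For $m\ge1$ there is an isomorphism $\alpha\oplus\beta\oplus\gamma:\tilde N_m/\tilde N_{m+1}\to V_m\oplus V_m\oplus V_{m-1}$ in which $\alpha$ sends the class of $(1,\dots,x,\dots,1)\in\tilde K_m$ to the monomial of $V_m$ corresponding to the vertex at which $x$ stands, $\beta$ sends the class of $(1,\dots,y,\dots,1)\in\tilde K_m$ to the corresponding monomial of (the second copy of) $V_m$, and $\gamma$ sends the class of $(1,\dots,x^2,\dots,1)\in\tilde T_{m-1}$ to the corresponding monomial of $V_{m-1}$. For subspaces $V,V'\subseteq V_m$, $W\subseteq V_{m-1}$, $\tilde N_{m+1}\alpha^{-1}(V)\beta^{-1}(V')\gamma^{-1}(W)$ denotes the full preimage of $V\oplus V'\oplus W$ in $\tilde N_m$. The rank of an abelian group $M$ here means $\dim_{\mathbb F_2}(M\otimes\mathbb F_2)$. *)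

theory Defs
  imports
    "HOL-Library.Z2"
    "HOL-Algebra.Bij"
    "HOL-Algebra.QuotRing"
    "HOL-Algebra.Generated_Groups"
    "HOL-Algebra.Free_Abelian_Groups"
begin

section \<open>General group theory\<close>

definition commut :: "('a, 'b) monoid_scheme \<Rightarrow> 'a \<Rightarrow> 'a \<Rightarrow> 'a" where
  "commut G g h = g \<otimes>\<^bsub>G\<^esub> h \<otimes>\<^bsub>G\<^esub> inv\<^bsub>G\<^esub> g \<otimes>\<^bsub>G\<^esub> inv\<^bsub>G\<^esub> h"

definition normal_closure :: "('a, 'b) monoid_scheme \<Rightarrow> 'a set \<Rightarrow> 'a set" where
  "normal_closure G S =
     generate G {g \<otimes>\<^bsub>G\<^esub> s \<otimes>\<^bsub>G\<^esub> inv\<^bsub>G\<^esub> g | g s. g \<in> carrier G \<and> s \<in> S}"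

text \<open>The series is indexed from 1; the value at index 0 is never used.\<close>

fun lower_central :: "('a, 'b) monoid_scheme \<Rightarrow> nat \<Rightarrow> 'a set" where
  "lower_central G 0 = carrier G"
| "lower_central G (Suc 0) = carrier G"
| "lower_central G (Suc (Suc n)) =
     generate G {commut G g h | g h. g \<in> lower_central G (Suc n) \<and> h \<in> carrier G}"

text \<open>\<open>M \<otimes> \<F>\<^sub>2\<close> over the integers: the free abelian group on the pairs \<open>(g, s)\<close>, modulo biadditivity.
  \<open>M\<close> is an abelian group in multiplicative notation.\<close>

definition tensor_F2 :: "('a, 'b) monoid_scheme \<Rightarrow> ('a \<times> bit \<Rightarrow>\<^sub>0 int) set monoid" where
  "tensor_F2 M =
     free_Abelian_group (carrier M \<times> UNIV) Mod
       generate (free_Abelian_group (carrier M \<times> UNIV))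
         ({frag_of (g \<otimes>\<^bsub>M\<^esub> h, s) - frag_of (g, s) - frag_of (h, s) | g h s.
             g \<in> carrier M \<and> h \<in> carrier M} \<union>
          {frag_of (g, s + t) - frag_of (g, s) - frag_of (g, t) | g s t. g \<in> carrier M})"

text \<open>An \<open>\<F>\<^sub>2\<close>-vector space is determined by its additive group, written \<open>A\<close> below, since the only
  scalars are 0 and 1; linear spans are therefore the same as generated subgroups.
  Infinite dimension is represented by 0.\<close>

definition F2_basis :: "('a, 'b) monoid_scheme \<Rightarrow> 'a set \<Rightarrow> bool" where
  "F2_basis A B \<longleftrightarrow> B \<subseteq> carrier A \<and> generate A B = carrier A \<and>
     (\<forall>b\<in>B. b \<notin> generate A (B - {b}))"

definition F2_dim :: "('a, 'b) monoid_scheme \<Rightarrow> nat" where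
  "F2_dim A = card (SOME B. F2_basis A B)"

definition F2_rank :: "('a, 'b) monoid_scheme \<Rightarrow> nat" where
  "F2_rank M = F2_dim (tensor_F2 M)"


section \<open>The group\<close>

type_synonym word = "bit list"

fun act_a :: "word \<Rightarrow> word" where
  "act_a [] = []"
| "act_a (x # s) = (1 - x) # s"

fun act_b :: "word \<Rightarrow> word" and act_c :: "word \<Rightarrow> word" and act_d :: "word \<Rightarrow> word" where
  "act_b [] = []"
| "act_b (u # s) = (if u = 0 then 0 # act_a s else 1 # act_c s)"
| "act_c [] = []"
| "act_c (u # s) = (if u = 0 then 0 # s else 1 # act_d s)"
| "act_d [] = []"
| "act_d (u # s) = (if u = 0 then 0 # s else 1 # act_b s)"

text \<open>Words are acted on from the left: the product in \<^term>\<open>BijGroup UNIV\<close> is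
  \<open>(g \<otimes> h) w = g (h w)\<close>.\<close>

definition tG :: "(word \<Rightarrow> word) monoid" where
  "tG = (BijGroup UNIV)
     \<lparr>carrier := generate (BijGroup UNIV) {act_a, act_b, act_c, act_d}\<rparr>"

definition x_elt :: "word \<Rightarrow> word" where "x_elt = commut tG act_a act_b"

definition y_elt :: "word \<Rightarrow> word" where "y_elt = commut tG act_a act_d"

definition x2_elt :: "word \<Rightarrow> word" where "x2_elt = x_elt \<otimes>\<^bsub>tG\<^esub> x_elt"

definition tK :: "(word \<Rightarrow> word) set" where "tK = normal_closure tG {x_elt, y_elt}"

definition tT :: "(word \<Rightarrow> word) set" where "tT = normal_closure tG {x2_elt}"

text \<open>The transformation fixing the words of length \<open>m\<close> and acting by \<open>q \<sigma>\<close> below the word \<open>\<sigma>\<close>.\<close>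

definition branch :: "nat \<Rightarrow> (word \<Rightarrow> word \<Rightarrow> word) \<Rightarrow> word \<Rightarrow> word" where
  "branch m q w = (if length w < m then w else take m w @ q (take m w) (drop m w))"

text \<open>\<open>(1, \<dots>, g, \<dots>, 1)\<close> with \<open>g\<close> standing at the vertex \<open>\<sigma>\<close>.\<close>

definition at_vertex :: "word \<Rightarrow> (word \<Rightarrow> word) \<Rightarrow> word \<Rightarrow> word" where
  "at_vertex \<sigma> g = branch (length \<sigma>) ((\<lambda>_. id)(\<sigma> := g))"

definition level_power :: "nat \<Rightarrow> (word \<Rightarrow> word) set \<Rightarrow> (word \<Rightarrow> word) set" where
  "level_power m Q = {branch m q | q. \<forall>\<sigma>. length \<sigma> = m \<longrightarrow> q \<sigma> \<in> Q}"

text \<open>Only meaningful for \<open>m \<ge> 1\<close>.\<close>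

definition tN :: "nat \<Rightarrow> (word \<Rightarrow> word) set" where
  "tN m = level_power m tK <#>\<^bsub>tG\<^esub> level_power (m - 1) tT"


section \<open>The modules $V_n$\<close>

type_synonym F2_mpoly = "(nat \<Rightarrow>\<^sub>0 nat) \<Rightarrow>\<^sub>0 bit"

definition X :: "nat \<Rightarrow> F2_mpoly" where
  "X i = Poly_Mapping.single (Poly_Mapping.single i 1) 1"

definition poly_ring :: "nat \<Rightarrow> F2_mpoly ring" where
  "poly_ring n =
     \<lparr>carrier = {p. \<forall>e \<in> Poly_Mapping.keys p. Poly_Mapping.keys e \<subseteq> {1..n}},
      mult = (*), one = 1, ring.zero = 0, ring.add = (+)\<rparr>"

definition V_ideal :: "nat \<Rightarrow> F2_mpoly set" where
  "V_ideal n = Idl\<^bsub>poly_ring n\<^esub> ((\<lambda>i. (X i)\<^sup>2 - 1) ` {1..n})"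

definition V :: "nat \<Rightarrow> F2_mpoly set ring" where
  "V n = poly_ring n Quot V_ideal n"

definition V_class :: "nat \<Rightarrow> F2_mpoly \<Rightarrow> F2_mpoly set" where
  "V_class n p = V_ideal n +>\<^bsub>poly_ring n\<^esub> p"

text \<open>The letter \<open>\<sigma>\<^sub>i\<close> of a word is \<^term>\<open>\<sigma> ! (i - 1)\<close>.\<close>

definition V_monom :: "word \<Rightarrow> F2_mpoly set" where
  "V_monom \<sigma> = V_class (length \<sigma>) (\<Prod>i = 1..length \<sigma>. if \<sigma> ! (i - 1) = 1 then X i else 1)"

definition v :: "nat \<Rightarrow> nat \<Rightarrow> F2_mpoly set" where
  "v n r = V_class n (\<Prod>i = 1..n. (1 - X i) ^ (r div 2 ^ (i - 1) mod 2))"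

text \<open>The set of generators is empty for \<open>r \<ge> 2 ^ n\<close>, and the span is then the zero subspace.\<close>

definition V_sub :: "nat \<Rightarrow> nat \<Rightarrow> F2_mpoly set set" where
  "V_sub n r = generate (add_monoid (V n)) (v n ` {r..<2 ^ n})"


section \<open>The coordinates on the layers\<close>

definition tN_quot :: "nat \<Rightarrow> (word \<Rightarrow> word) set monoid" where
  "tN_quot m = tG\<lparr>carrier := tN m\<rparr> Mod tN (m + 1)"

definition tN_class :: "nat \<Rightarrow> (word \<Rightarrow> word) \<Rightarrow> (word \<Rightarrow> word) set" where
  "tN_class m g = tN (m + 1) #>\<^bsub>tG\<^esub> g"

definition is_coord_iso ::
  "nat \<Rightarrow> ((word \<Rightarrow> word) set \<Rightarrow> F2_mpoly set \<times> F2_mpoly set \<times> F2_mpoly set) \<Rightarrow> bool" where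
  "is_coord_iso m \<phi> \<longleftrightarrow>
     \<phi> \<in> iso (tN_quot m) (add_monoid (V m) \<times>\<times> (add_monoid (V m) \<times>\<times> add_monoid (V (m - 1)))) \<and>
     (\<forall>\<sigma>. length \<sigma> = m \<longrightarrow>
        \<phi> (tN_class m (at_vertex \<sigma> x_elt)) = (V_monom \<sigma>, \<zero>\<^bsub>V m\<^esub>, \<zero>\<^bsub>V (m - 1)\<^esub>)) \<and>
     (\<forall>\<sigma>. length \<sigma> = m \<longrightarrow>
        \<phi> (tN_class m (at_vertex \<sigma> y_elt)) = (\<zero>\<^bsub>V m\<^esub>, V_monom \<sigma>, \<zero>\<^bsub>V (m - 1)\<^esub>)) \<and>
     (\<forall>\<sigma>. length \<sigma> = m - 1 \<longrightarrow>
        \<phi> (tN_class m (at_vertex \<sigma> x2_elt)) = (\<zero>\<^bsub>V m\<^esub>, \<zero>\<^bsub>V m\<^esub>, V_monom \<sigma>))"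

text \<open>For \<open>m \<ge> 1\<close>, the prescribed values are those of the basis of monomials of the target, so that
  an isomorphism as above is unique on \<^term>\<open>carrier (tN_quot m)\<close> and the choice is immaterial.\<close>

definition coord_iso ::
  "nat \<Rightarrow> (word \<Rightarrow> word) set \<Rightarrow> F2_mpoly set \<times> F2_mpoly set \<times> F2_mpoly set" where
  "coord_iso m = (SOME \<phi>. is_coord_iso m \<phi>)"

definition coord_preimage ::
  "nat \<Rightarrow> F2_mpoly set set \<Rightarrow> F2_mpoly set set \<Rightarrow> F2_mpoly set set \<Rightarrow> (word \<Rightarrow> word) set" where
  "coord_preimage m U U' W = {g \<in> tN m. coord_iso m (tN_class m g) \<in> U \<times> U' \<times> W}"

end

theory Submission
  imports Defs
begin

text \<open>Write \<open>(g, h)\<close> for the automorphism that acts by \<open>g\<close> and \<open>h\<close> on the two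
  subtrees, \<open>G\<close> for the group and \<open>\<gamma>\<^sub>n\<close> for its lower central series. The theorem
  rests on a recursion: for \<open>n \<ge> 3\<close>,

    \<open>\<gamma>\<^sub>2\<^sub>n\<^sub>-\<^sub>1 = \<gamma>\<^sub>n \<times> \<gamma>\<^sub>n\<close> and \<open>\<gamma>\<^sub>2\<^sub>n = {(g, h) \<in> \<gamma>\<^sub>n \<times> \<gamma>\<^sub>n. g h \<in> \<gamma>\<^sub>n\<^sub>+\<^sub>1}\<close>

  (lemmas \<open>LC_odd\<close> and \<open>LC_even\<close>). The second equation follows from the first: the commutators of
  \<open>(g, 1)\<close> with \<open>a\<close> are the antidiagonal elements \<open>(g, g\<^sup>-\<^sup>1)\<close>, and
  because the stabilizer of the first level projects onto \<open>G\<close> in each factor, the commutators of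
  \<open>(1, g)\<close> give \<open>1 \<times> [\<gamma>\<^sub>n, G]\<close> (\<open>commg_prs\<close>). For the next
  step from \<open>2n\<close> to \<open>2n + 1\<close>, exponent 2 of the factors gives one inclusion. For the other one,
  the commutators of \<open>(q\<^sup>-\<^sup>1, q)\<close> with \<open>c = (1, d)\<close> and
  \<open>d = (1, b)\<close> put \<open>[q, d]\<close> and \<open>[q, b]\<close> into one factor, but
  \<open>b = (a, c)\<close> only gives \<open>([q\<^sup>-\<^sup>1, a], [q, c])\<close>. The two entries separate
  because modulo \<open>\<gamma>\<^sub>n\<^sub>+\<^sub>2\<close> one of them is trivial: \<open>a\<close> centralises
  \<open>\<gamma>\<^sub>n\<close> for even \<open>n\<close> and \<open>c\<close> does for odd \<open>n\<close>, which is
  itself a consequence of the recursion for smaller indices (\<open>commg_diag\<close>, \<open>LC_odd\<close>). The start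
  \<open>\<gamma>\<^sub>3 = N\<^sub>1\<close>, \<open>\<gamma>\<^sub>4\<close>, \<open>\<gamma>\<^sub>5\<close> is computed
  from the relations \<open>[x, a] = [x, b] = x\<^sup>2\<close>, \<open>[x, c] = (1, y)\<close>,
  \<open>[x, d] = (1, x)\<close>.

  Since \<open>N\<^sub>m\<^sub>+\<^sub>1 = N\<^sub>m \<times> N\<^sub>m\<close>, the recursion takes
  \<open>\<gamma>\<^sub>3 = N\<^sub>1\<close> to \<open>\<gamma>\<^sub>n = N\<^sub>m\<close> for
  \<open>n = 2\<^sup>m + 1\<close>.

  For the ranks, \<open>(g, h) \<mapsto> g h\<close> and \<open>(g, h) \<mapsto> g\<close> identify
  \<open>\<gamma>\<^sub>2\<^sub>n\<^sub>-\<^sub>1 / \<gamma>\<^sub>2\<^sub>n\<close> and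
  \<open>\<gamma>\<^sub>2\<^sub>n / \<gamma>\<^sub>2\<^sub>n\<^sub>+\<^sub>1\<close> with
  \<open>\<gamma>\<^sub>n / \<gamma>\<^sub>n\<^sub>+\<^sub>1\<close>, so that only \<open>n \<le> 4\<close> remains.
  There the independence of the generators is detected by characters: the parity of the number of flips that an automorphism
  performs at a fixed level, applied to the group itself or to a section (\<open>par_kernel\<close>,
  \<open>lpar_kernel\<close>, \<open>tN1_kernel\<close>).

  For the description inside a layer, \<open>V\<^sub>n\<close> is the space of functions on the words of length
  \<open>n\<close>. Split by the first letter, the space \<open>V\<close> of size \<open>n + 1\<close> and index
  \<open>2s\<close> consists of the pairs from \<open>V\<^sub>n\<^sup>s\<close>, and the one of index \<open>2s + 1\<close>
  of those pairs whose sum lies in the next space, of index \<open>s + 1\<close>. This is the recursion above, so it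
  suffices to compare the first layer (\<open>LC_coordinates\<close>). The coordinates \<open>\<alpha>\<close>,
  \<open>\<beta>\<close>, \<open>\<gamma>\<close> themselves are parities of sections; they show that the isomorphism exists,
  and it is unique because its values are prescribed on generators of the layer.\<close>

section \<open>Commutators and central series\<close>

text \<open>The commutator subgroup \<open>[Q, G]\<close>; for \<open>n \<ge> 1\<close> it takes
  \<open>\<gamma>\<^sub>n\<close> to \<open>\<gamma>\<^sub>n\<^sub>+\<^sub>1\<close>.\<close>

definition commg :: "('a, 'b) monoid_scheme \<Rightarrow> 'a set \<Rightarrow> 'a set" where
  "commg G Q = generate G {commut G q g | q g. q \<in> Q \<and> g \<in> carrier G}"

context group
begin

lemma inv_cancel_left: "x \<in> carrier G \<Longrightarrow> y \<in> carrier G \<Longrightarrow> inv x \<otimes> (x \<otimes> y) = y"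
  by (simp flip: m_assoc)

lemma cancel_inv_left: "x \<in> carrier G \<Longrightarrow> y \<in> carrier G \<Longrightarrow> x \<otimes> (inv x \<otimes> y) = y"
  by (simp flip: m_assoc)

text \<open>Rewriting with these rules decides equality of words in a free group.\<close>

lemmas free_reduce = commut_def inv_mult_group m_assoc inv_cancel_left cancel_inv_left

lemma commut_closed [simp, intro]:
  "x \<in> carrier G \<Longrightarrow> g \<in> carrier G \<Longrightarrow> commut G x g \<in> carrier G"
  by (simp add: commut_def)

lemma commut_mult_right:
  "x \<in> carrier G \<Longrightarrow> g \<in> carrier G \<Longrightarrow> h \<in> carrier G \<Longrightarrow>
    commut G x (g \<otimes> h) = commut G x g \<otimes> (g \<otimes> commut G x h \<otimes> inv g)"
  by (simp add: free_reduce)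

lemma commut_inv_right:
  "x \<in> carrier G \<Longrightarrow> g \<in> carrier G \<Longrightarrow> commut G x (inv g) = inv g \<otimes> inv (commut G x g) \<otimes> g"
  by (simp add: free_reduce)

lemma commut_mult_left:
  "x \<in> carrier G \<Longrightarrow> y \<in> carrier G \<Longrightarrow> g \<in> carrier G \<Longrightarrow>
    commut G (x \<otimes> y) g = (x \<otimes> commut G y g \<otimes> inv x) \<otimes> commut G x g"
  by (simp add: free_reduce)

lemma commut_inv_left:
  "x \<in> carrier G \<Longrightarrow> g \<in> carrier G \<Longrightarrow> commut G (inv x) g = inv x \<otimes> inv (commut G x g) \<otimes> x"
  by (simp add: free_reduce)

lemma inv_commut:
  "x \<in> carrier G \<Longrightarrow> g \<in> carrier G \<Longrightarrow> inv (commut G x g) = commut G g x"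
  by (simp add: free_reduce)

lemma conj_commut:
  "x \<in> carrier G \<Longrightarrow> g \<in> carrier G \<Longrightarrow> h \<in> carrier G \<Longrightarrow>
    h \<otimes> commut G x g \<otimes> inv h = commut G (h \<otimes> x \<otimes> inv h) (h \<otimes> g \<otimes> inv h)"
  by (simp add: free_reduce)

lemma normalD:
  assumes "N \<lhd> G"
  shows normal_sub: "subgroup N G" and normal_carrier: "N \<subseteq> carrier G"
    and normal_conj: "\<And>g h. g \<in> carrier G \<Longrightarrow> h \<in> N \<Longrightarrow> g \<otimes> h \<otimes> inv g \<in> N"
    and normal_conj': "\<And>g h. g \<in> carrier G \<Longrightarrow> h \<in> N \<Longrightarrow> inv g \<otimes> h \<otimes> g \<in> N"
    and normal_mult: "\<And>g h. g \<in> N \<Longrightarrow> h \<in> N \<Longrightarrow> g \<otimes> h \<in> N"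
    and normal_m_inv: "\<And>g. g \<in> N \<Longrightarrow> inv g \<in> N"
    and normal_one: "\<one> \<in> N"
    and normal_mem: "\<And>g. g \<in> N \<Longrightarrow> g \<in> carrier G"
  using assms by (auto simp: normal_inv_iff subgroup.m_closed subgroup.m_inv_closed
      subgroup.one_closed subgroup.mem_carrier intro: normal.inv_op_closed1[OF assms])

lemma commut_mem_normal:
  assumes "N \<lhd> G" "x \<in> N" "g \<in> carrier G"
  shows "commut G x g \<in> N"
proof -
  have x: "x \<in> carrier G" using normal_mem[OF assms(1)] assms(2) .
  have "commut G x g = x \<otimes> (g \<otimes> inv x \<otimes> inv g)"
    using x assms(3) by (simp add: free_reduce)
  then show ?thesis
    using assms by (simp add: normalD[OF assms(1)])
qed

text \<open>The elements that commute with \<open>x\<close> modulo \<open>N\<close> form a subgroup, so generators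
  suffice.\<close>

lemma commut_mod_right:
  assumes N: "N \<lhd> G" and x: "x \<in> carrier G" and T: "T \<subseteq> carrier G" "carrier G = generate G T"
    and c: "\<And>t. t \<in> T \<Longrightarrow> commut G x t \<in> N" and g: "g \<in> carrier G"
  shows "commut G x g \<in> N"
proof -
  have "g \<in> generate G T" using T g by simp
  then show ?thesis
  proof (induct g rule: generate.induct)
    case one
    then show ?case using x normal_one[OF N] by (simp add: free_reduce)
  next
    case (incl h)
    then show ?case by (rule c)
  next
    case (inv h)
    have "h \<in> carrier G" using inv T by auto
    then show ?case
      using x c[OF inv] by (simp add: commut_inv_right normalD[OF N])
  next
    case (eng h1 h2)
    have "h1 \<in> carrier G" "h2 \<in> carrier G" using eng T by simp_all
    then show ?case
      using x eng by (simp add: commut_mult_right normalD[OF N])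
  qed
qed

text \<open>This is the preimage of the centre of the quotient by \<open>N\<close>.\<close>

lemma centre_mod_normal:
  assumes N: "N \<lhd> G"
  shows "{x \<in> carrier G. \<forall>g \<in> carrier G. commut G x g \<in> N} \<lhd> G" (is "?Z \<lhd> G")
proof (rule normal_invI)
  show "subgroup ?Z G"
  proof (rule subgroupI)
    have "\<one> \<in> ?Z" using normal_one[OF N] by (simp add: free_reduce)
    then show "?Z \<noteq> {}" by blast
  qed (auto simp: commut_inv_left commut_mult_left normalD[OF N])
next
  fix g x assume g: "g \<in> carrier G" and x: "x \<in> ?Z"
  have "commut G (g \<otimes> x \<otimes> inv g) h \<in> N" if h: "h \<in> carrier G" for h
  proof -
    have "commut G (g \<otimes> x \<otimes> inv g) h = g \<otimes> commut G x (inv g \<otimes> h \<otimes> g) \<otimes> inv g"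
      using g x h by (simp add: free_reduce)
    then show ?thesis using g x h by (simp add: normalD[OF N])
  qed
  then show "g \<otimes> x \<otimes> inv g \<in> ?Z" using g x by simp
qed

lemma commg_normal:
  assumes "Q \<lhd> G"
  shows "commg G Q \<lhd> G"
  unfolding commg_def
proof (rule normal_generateI)
  note Q = normalD[OF assms]
  show "{commut G q g | q g. q \<in> Q \<and> g \<in> carrier G} \<subseteq> carrier G"
    using Q by auto
  fix h g assume "h \<in> {commut G q g | q g. q \<in> Q \<and> g \<in> carrier G}" and g: "g \<in> carrier G"
  then obtain q k where h: "h = commut G q k" "q \<in> Q" "k \<in> carrier G" by blast
  show "g \<otimes> h \<otimes> inv g \<in> {commut G q g | q g. q \<in> Q \<and> g \<in> carrier G}"
    using h g Q by (intro CollectI exI[of _ "g \<otimes> q \<otimes> inv g"] exI[of _ "g \<otimes> k \<otimes> inv g"])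
      (simp add: conj_commut)
qed

lemma commut_in_commg: "q \<in> Q \<Longrightarrow> g \<in> carrier G \<Longrightarrow> commut G q g \<in> commg G Q"
  unfolding commg_def by (auto intro: generate.incl)

lemma commg_least:
  "subgroup M G \<Longrightarrow> (\<And>q g. q \<in> Q \<Longrightarrow> g \<in> carrier G \<Longrightarrow> commut G q g \<in> M) \<Longrightarrow> commg G Q \<subseteq> M"
  unfolding commg_def by (rule generate_subgroup_incl) auto

lemma commg_subset:
  assumes "Q \<lhd> G"
  shows "commg G Q \<subseteq> Q"
  using commut_mem_normal[OF assms] normal_sub[OF assms] by (intro commg_least)

lemma commg_mono: "P \<subseteq> Q \<Longrightarrow> commg G P \<subseteq> commg G Q"
  unfolding commg_def by (rule mono_generate) auto

lemma normal_closure_normal: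
  assumes "S \<subseteq> carrier G"
  shows "normal_closure G S \<lhd> G"
  unfolding normal_closure_def
proof (rule normal_generateI)
  show "{g \<otimes> s \<otimes> inv g | g s. g \<in> carrier G \<and> s \<in> S} \<subseteq> carrier G"
    using assms by auto
  fix h g assume "h \<in> {g \<otimes> s \<otimes> inv g | g s. g \<in> carrier G \<and> s \<in> S}" and g: "g \<in> carrier G"
  then obtain k s where h: "h = k \<otimes> s \<otimes> inv k" "k \<in> carrier G" "s \<in> S" by blast
  have "g \<otimes> h \<otimes> inv g = (g \<otimes> k) \<otimes> s \<otimes> inv (g \<otimes> k)"
    using h g assms by (auto simp: free_reduce)
  then show "g \<otimes> h \<otimes> inv g \<in> {g \<otimes> s \<otimes> inv g | g s. g \<in> carrier G \<and> s \<in> S}"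
    using h g by blast
qed

lemma normal_closure_incl:
  assumes "S \<subseteq> carrier G" "s \<in> S"
  shows "s \<in> normal_closure G S"
proof -
  have "s = \<one> \<otimes> s \<otimes> inv \<one>" using assms by auto
  then show ?thesis
    unfolding normal_closure_def using assms by (blast intro: generate.incl)
qed

lemma normal_closure_least: "N \<lhd> G \<Longrightarrow> S \<subseteq> N \<Longrightarrow> normal_closure G S \<subseteq> N"
  unfolding normal_closure_def
  by (rule generate_subgroup_incl) (auto simp: normalD)

text \<open>The centre modulo \<open>N\<close> is normal, so a normal closure lies in it as soon as its generators do; on the
  other side the generators of the group suffice.\<close>

lemma commg_normal_closure_least:
  assumes N: "N \<lhd> G" and S: "S \<subseteq> carrier G" and T: "T \<subseteq> carrier G" "carrier G = generate G T"
    and c: "\<And>s t. s \<in> S \<Longrightarrow> t \<in> T \<Longrightarrow> commut G s t \<in> N"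
  shows "commg G (normal_closure G S) \<subseteq> N"
proof (rule commg_least[OF normal_sub[OF N]])
  fix q g assume q: "q \<in> normal_closure G S" and g: "g \<in> carrier G"
  have "S \<subseteq> {x \<in> carrier G. \<forall>g \<in> carrier G. commut G x g \<in> N}"
    using commut_mod_right[OF N _ T c] S by auto
  then show "commut G q g \<in> N"
    using normal_closure_least[OF centre_mod_normal[OF N]] q g by blast
qed

text \<open>The identity \<open>[x\<^sup>2, g] = [x, u] u\<^sup>2\<close> for \<open>u = [x, g]\<close> carries the
  exponent 2 from one factor of a central series to the next.\<close>

lemma squares_commg:
  assumes Q: "Q \<lhd> G" and sq: "\<And>q. q \<in> Q \<Longrightarrow> q \<otimes> q \<in> commg G Q" and u: "u \<in> commg G Q"
  shows "u \<otimes> u \<in> commg G (commg G Q)"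
proof -
  define N where "N = commg G Q"
  define M where "M = commg G N"
  have N: "N \<lhd> G" and M: "M \<lhd> G"
    unfolding M_def N_def using commg_normal[OF commg_normal[OF Q]] commg_normal[OF Q] by auto
  have MN: "commut G v g \<in> M" if "v \<in> N" "g \<in> carrier G" for v g
    using that commut_in_commg unfolding M_def by blast
  have "subgroup {u \<in> N. u \<otimes> u \<in> M} G"
  proof (rule subgroupI)
    fix u v assume u: "u \<in> {u \<in> N. u \<otimes> u \<in> M}" and v: "v \<in> {u \<in> N. u \<otimes> u \<in> M}"
    have uv: "u \<in> carrier G" "v \<in> carrier G" using u v normal_mem[OF N] by auto
    \<comment> \<open>squaring is multiplicative up to commutators\<close>
    have "(u \<otimes> v) \<otimes> (u \<otimes> v) = (u \<otimes> commut G v u \<otimes> inv u) \<otimes> ((u \<otimes> u) \<otimes> (v \<otimes> v))"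
      using uv by (simp add: free_reduce)
    then show "u \<otimes> v \<in> {u \<in> N. u \<otimes> u \<in> M}"
      using u v uv MN[of v u] by (simp add: normalD[OF M] normal_mult[OF N])
  next
    fix u assume u: "u \<in> {u \<in> N. u \<otimes> u \<in> M}"
    then have "inv (u \<otimes> u) \<in> M" using normal_m_inv[OF M] by blast
    then show "inv u \<in> {u \<in> N. u \<otimes> u \<in> M}"
      using u normal_mem[OF N] by (simp add: inv_mult_group normal_m_inv[OF N])
  qed (use normal_carrier[OF N] normal_one[OF N] normal_one[OF M] in auto)
  moreover have "commut G x g \<in> {u \<in> N. u \<otimes> u \<in> M}" if x: "x \<in> Q" and g: "g \<in> carrier G" for x g
  proof -
    let ?u = "commut G x g"
    have xG: "x \<in> carrier G" using x normal_mem[OF Q] by blast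
    have uN: "?u \<in> N" unfolding N_def using commut_in_commg[OF x g] .
    have "?u \<otimes> ?u = inv (commut G x ?u) \<otimes> commut G (x \<otimes> x) g"
      using xG g by (simp add: free_reduce)
    moreover have "inv (commut G x ?u) \<in> M"
      using MN[OF uN xG] xG g by (simp add: inv_commut)
    moreover have "commut G (x \<otimes> x) g \<in> M"
      using MN[OF _ g] sq[OF x] unfolding N_def by blast
    ultimately show ?thesis using uN by (simp add: normal_mult[OF M])
  qed
  ultimately have "N \<subseteq> {u \<in> N. u \<otimes> u \<in> M}"
    unfolding N_def[of] by (intro commg_least)
  then show ?thesis using u unfolding M_def N_def by blast
qed

lemma lower_central_Suc:
  "n \<ge> 1 \<Longrightarrow> lower_central G (Suc n) = commg G (lower_central G n)"
  by (cases n) (auto simp: commg_def)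

lemma lower_central_normal: "lower_central G n \<lhd> G"
proof (induct n)
  case (Suc n)
  then show ?case
    by (cases n) (simp_all add: normal_self lower_central_Suc commg_normal del: lower_central.simps(3))
qed (simp add: normal_self)

lemma lower_central_decreasing: "lower_central G (Suc n) \<subseteq> lower_central G n"
  by (cases "n \<ge> 1")
    (auto simp: lower_central_Suc not_le dest!: subsetD[OF commg_subset[OF lower_central_normal]])

lemma lower_central_antimono: "m \<le> n \<Longrightarrow> lower_central G n \<subseteq> lower_central G m"
  by (rule lift_Suc_antimono_le[of "lower_central G"]) (rule lower_central_decreasing)

text \<open>A group generated by involutions has an abelianization of exponent 2, and the exponent is inherited
  by all later factors.\<close>

lemma lower_central_squares:
  assumes T: "T \<subseteq> carrier G" "carrier G = generate G T" "\<And>t. t \<in> T \<Longrightarrow> t \<otimes> t = \<one>"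
    and n: "n \<ge> 1"
  shows "u \<in> lower_central G n \<Longrightarrow> u \<otimes> u \<in> lower_central G (Suc n)"
  using n
proof (induct n arbitrary: u rule: dec_induct)
  case base
  define M where "M = lower_central G 2"
  have M: "M \<lhd> G" unfolding M_def by (rule lower_central_normal)
  have Mc: "commut G u v \<in> M" if "u \<in> carrier G" "v \<in> carrier G" for u v
    unfolding M_def numeral_2_eq_2 using that by (auto intro: generate.incl)
  have "u \<in> generate G T" using base T by simp
  then have "u \<otimes> u \<in> M"
  proof (induct u rule: generate.induct)
    case one
    then show ?case using normal_one[OF M] by simp
  next
    case (incl h)
    then show ?case using T normal_one[OF M] by simp
  next
    case (inv h)
    have "inv h \<otimes> inv h = inv (h \<otimes> h)" using inv T(1) by (auto simp: inv_mult_group)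
    then show ?case using inv T normal_one[OF M] by simp
  next
    case (eng u v)
    have uv: "u \<in> carrier G" "v \<in> carrier G" using eng T by simp_all
    have "(u \<otimes> v) \<otimes> (u \<otimes> v) = (u \<otimes> commut G v u \<otimes> inv u) \<otimes> ((u \<otimes> u) \<otimes> (v \<otimes> v))"
      using uv by (simp add: free_reduce)
    then show ?case
      using eng uv Mc[of v u] by (simp add: normalD[OF M])
  qed
  then show ?case by (simp add: M_def numeral_2_eq_2)
next
  case (step n)
  then have "n \<ge> 1" by simp
  then show ?case
    using squares_commg[OF lower_central_normal[of n], of u] step
    by (simp add: lower_central_Suc del: lower_central.simps)
qed

text \<open>If \<open>s\<close> normalises \<open>M = \<langle>N, S\<rangle>\<close> and
  \<open>s\<^sup>2 \<in> M\<close>, then \<open>\<langle>M, s\<rangle> = M \<union> M s\<close>, and a character that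
  separates the two cosets has kernel \<open>M\<close>.\<close>

lemma kernel_of_character:
  fixes \<chi> :: "'a \<Rightarrow> bit"
  assumes N: "N \<lhd> G" and L: "subgroup L G" and sS: "insert s (N \<union> S) \<subseteq> L" and ss: "s \<otimes> s \<in> N"
    and c: "\<And>t. t \<in> L \<Longrightarrow> commut G s t \<in> N"
    and hom: "\<And>g h. g \<in> L \<Longrightarrow> h \<in> L \<Longrightarrow> \<chi> (g \<otimes> h) = \<chi> g + \<chi> h"
    and \<chi>s: "\<chi> s = 1" and \<chi>0: "\<And>t. t \<in> N \<union> S \<Longrightarrow> \<chi> t = 0"
    and h: "h \<in> generate G (N \<union> insert s S)" and \<chi>h: "\<chi> h = 0"
  shows "h \<in> generate G (N \<union> S)"
proof -
  define M where "M = generate G (N \<union> S)"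
  have LG: "t \<in> L \<Longrightarrow> t \<in> carrier G" for t using subgroup.mem_carrier[OF L] .
  have NS: "N \<union> S \<subseteq> carrier G" and s: "s \<in> carrier G" using sS LG by auto
  have M: "subgroup M G" unfolding M_def using NS by (rule generate_is_subgroup)
  have Msub: "M \<subseteq> L" unfolding M_def using sS by (intro generate_subgroup_incl[OF _ L]) auto
  have MG: "m \<in> M \<Longrightarrow> m \<in> carrier G" for m using subgroup.mem_carrier[OF M] .
  note Mc = subgroup.m_closed[OF M] subgroup.m_inv_closed[OF M] subgroup.one_closed[OF M]
  have NM: "t \<in> N \<union> S \<Longrightarrow> t \<in> M" for t unfolding M_def by (rule generate.incl)
  have conj: "s \<otimes> m \<otimes> inv s \<in> M" if "m \<in> M" for m
  proof -
    have st: "s \<otimes> t \<otimes> inv s \<in> M" if t: "t \<in> N \<union> S" for t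
    proof -
      have "s \<otimes> t \<otimes> inv s = commut G s t \<otimes> t"
        using s t NS by (auto simp: free_reduce)
      then show ?thesis using NM c[of t] t sS Mc by auto
    qed
    from that[unfolded M_def] show ?thesis
    proof (induct m rule: generate.induct)
      case (inv t)
      have t: "t \<in> carrier G" using inv NS by auto
      have "s \<otimes> inv t \<otimes> inv s = inv (s \<otimes> t \<otimes> inv s)"
        using s t by (simp add: free_reduce)
      then show ?case using Mc st[OF inv] by simp
    next
      case (eng u v)
      have uv: "u \<in> carrier G" "v \<in> carrier G" using eng MG M_def by auto
      have "s \<otimes> (u \<otimes> v) \<otimes> inv s = (s \<otimes> u \<otimes> inv s) \<otimes> (s \<otimes> v \<otimes> inv s)"
        using s uv by (simp add: free_reduce)
      then show ?case using Mc eng by simp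
    qed (use s Mc st in auto)
  qed
  have "h \<in> M \<or> h \<otimes> inv s \<in> M"
    using h
  proof (induct h rule: generate.induct)
    case (incl t)
    then show ?case using NM s Mc by auto
  next
    case (inv t)
    have "inv s \<otimes> inv s = inv (s \<otimes> s)" using s by (simp add: inv_mult_group)
    then show ?case using inv NM[of t] NM[of "s \<otimes> s"] ss s Mc by auto
  next
    case (eng u v)
    have "generate G (N \<union> insert s S) \<subseteq> carrier G"
      using NS s by (intro generate_incl) auto
    then have uv: "u \<in> carrier G" "v \<in> carrier G" using eng by auto
    have ssM: "s \<otimes> s \<in> M" using ss NM by simp
    have 1: "u \<otimes> v \<otimes> inv s = u \<otimes> (v \<otimes> inv s)" using uv s by (simp add: m_assoc)
    have 2: "u \<otimes> v \<otimes> inv s = (u \<otimes> inv s) \<otimes> (s \<otimes> v \<otimes> inv s)"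
      using uv s by (simp add: free_reduce)
    have 3: "u \<otimes> v = (u \<otimes> inv s) \<otimes> (s \<otimes> (v \<otimes> inv s) \<otimes> inv s) \<otimes> (s \<otimes> s)"
      using uv s by (simp add: free_reduce)
    show ?case
      using eng(2,4) Mc(1)[of u v] Mc(1)[of u "v \<otimes> inv s"] Mc(1)[of "u \<otimes> inv s"]
        Mc(1)[OF _ ssM] conj 1 2 3 by metis
  qed (use Mc in auto)
  moreover have "h \<otimes> inv s \<notin> M"
  proof
    assume m: "h \<otimes> inv s \<in> M"
    have one: "\<chi> \<one> = 0"
      using hom[of \<one> \<one>] subgroup.one_closed[OF L] by simp
    have M0: "\<chi> m = 0" if "m \<in> M" for m
      using that[unfolded M_def]
    proof (induct m rule: generate.induct)
      case (inv t)
      then have t: "t \<in> carrier G" "t \<in> L" "inv t \<in> L"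
        using NS NM Msub Mc by auto
      then show ?case using hom[of t "inv t"] \<chi>0[OF inv] one by simp
    next
      case (eng u v)
      then show ?case using hom[of u v] Msub by (auto simp: M_def)
    qed (use one \<chi>0 in auto)
    have "generate G (N \<union> insert s S) \<subseteq> L" using sS by (intro generate_subgroup_incl[OF _ L]) auto
    then have hG: "h \<in> carrier G" using h LG by blast
    have "\<chi> ((h \<otimes> inv s) \<otimes> s) = \<chi> (h \<otimes> inv s) + \<chi> s"
      using hom m Msub sS by auto
    then show False using M0[OF m] \<chi>s \<chi>h hG s by (simp add: m_assoc)
  qed
  ultimately show ?thesis by (simp add: M_def)
qed

end

text \<open>Conjugation moves an element that is central modulo \<open>N\<close> only by an element of
  \<open>N\<close>.\<close>

lemma (in group) normal_closure_le_generate: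
  assumes S: "S \<subseteq> carrier G" and N: "N \<lhd> G"
    and c: "\<And>s g. s \<in> S \<Longrightarrow> g \<in> carrier G \<Longrightarrow> commut G s g \<in> N"
  shows "normal_closure G S \<subseteq> generate G (N \<union> S)"
  unfolding normal_closure_def
proof (rule generate_subgroup_incl)
  show "subgroup (generate G (N \<union> S)) G"
    using S normal_carrier[OF N] by (intro generate_is_subgroup) auto
  show "{g \<otimes> s \<otimes> inv g | g s. g \<in> carrier G \<and> s \<in> S} \<subseteq> generate G (N \<union> S)"
  proof clarify
    fix g s assume g: "g \<in> carrier G" and s: "s \<in> S"
    have sG: "s \<in> carrier G" using s S by blast
    have "g \<otimes> s \<otimes> inv g = inv (commut G s g) \<otimes> s"
      using g sG by (simp add: free_reduce)
    moreover have "inv (commut G s g) \<in> N" using c[OF s g] normal_m_inv[OF N] by blast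
    ultimately show "g \<otimes> s \<otimes> inv g \<in> generate G (N \<union> S)"
      using s by (auto intro: generate.eng generate.incl)
  qed
qed

lemma set_mult_memI: "m \<in> M \<Longrightarrow> n \<in> N \<Longrightarrow> m \<otimes>\<^bsub>G\<^esub> n \<in> M <#>\<^bsub>G\<^esub> N"
  unfolding set_mult_def by blast

lemma (in group) set_mult_normal:
  assumes M: "M \<lhd> G" and N: "N \<lhd> G"
  shows "M <#> N \<lhd> G"
proof (rule normal_invI)
  note Mc = normalD[OF M] and Nc = normalD[OF N]
  have mem: "m \<in> carrier G" if "m \<in> M" for m using that Mc(8) by blast
  have nem: "n \<in> carrier G" if "n \<in> N" for n using that Nc(8) by blast
  show "subgroup (M <#> N) G"
  proof (rule subgroupI)
    show "M <#> N \<subseteq> carrier G" using mem nem unfolding set_mult_def by auto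
    show "M <#> N \<noteq> {}" using Mc(7) Nc(7) unfolding set_mult_def by blast
  next
    fix u assume "u \<in> M <#> N"
    then obtain m n where u: "u = m \<otimes> n" "m \<in> M" "n \<in> N" unfolding set_mult_def by blast
    have "inv u = inv m \<otimes> (m \<otimes> inv n \<otimes> inv m)" using u mem nem by (simp add: free_reduce)
    moreover have "inv m \<in> M" "m \<otimes> inv n \<otimes> inv m \<in> N" using u mem Mc(6) Nc(3,6) by simp_all
    ultimately show "inv u \<in> M <#> N" by (simp add: set_mult_memI)
  next
    fix u v assume "u \<in> M <#> N" "v \<in> M <#> N"
    then obtain m n k l where u: "u = m \<otimes> n" "m \<in> M" "n \<in> N" and v: "v = k \<otimes> l" "k \<in> M" "l \<in> N"
      unfolding set_mult_def by blast
    have "u \<otimes> v = (m \<otimes> k) \<otimes> ((inv k \<otimes> n \<otimes> k) \<otimes> l)" using u v mem nem by (simp add: free_reduce)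
    moreover have "m \<otimes> k \<in> M" "(inv k \<otimes> n \<otimes> k) \<otimes> l \<in> N" using u v Mc(5) Nc(4,5) mem by simp_all
    ultimately show "u \<otimes> v \<in> M <#> N" by (simp add: set_mult_memI)
  qed
  fix g u assume g: "g \<in> carrier G" and "u \<in> M <#> N"
  then obtain m n where u: "u = m \<otimes> n" "m \<in> M" "n \<in> N" unfolding set_mult_def by blast
  have "g \<otimes> u \<otimes> inv g = (g \<otimes> m \<otimes> inv g) \<otimes> (g \<otimes> n \<otimes> inv g)"
    using g u mem nem by (simp add: free_reduce)
  moreover have "g \<otimes> m \<otimes> inv g \<in> M" "g \<otimes> n \<otimes> inv g \<in> N" using g u Mc(3) Nc(3) by simp_all
  ultimately show "g \<otimes> u \<otimes> inv g \<in> M <#> N" by (simp add: set_mult_memI)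
qed

lemma (in group) set_mult_left: "N \<lhd> G \<Longrightarrow> M \<subseteq> carrier G \<Longrightarrow> M \<subseteq> M <#> N"
  unfolding set_mult_def using normal_one by force

lemma (in group) set_mult_right: "M \<lhd> G \<Longrightarrow> N \<subseteq> carrier G \<Longrightarrow> N \<subseteq> M <#> N"
  unfolding set_mult_def using normal_one by force

section \<open>Ranks of elementary abelian 2-groups\<close>

text \<open>Adjoining an element outside a subgroup of an elementary abelian 2-group adds one coset, hence
  doubles the order.\<close>

lemma (in group) card_generate_independent:
  assumes comm: "comm_group G" and sq: "\<And>x. x \<in> carrier G \<Longrightarrow> x \<otimes> x = \<one>"
    and "finite B" "B \<subseteq> carrier G" "\<And>b. b \<in> B \<Longrightarrow> b \<notin> generate G (B - {b})"
  shows "finite (generate G B) \<and> card (generate G B) = 2 ^ card B"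
  using assms(3-5)
proof (induct B rule: finite_induct)
  case empty
  have "generate G {} = {\<one>}"
  proof
    show "generate G {} \<subseteq> {\<one>}"
      by (rule generate_subgroup_incl) (auto simp: triv_subgroup)
  qed (auto intro: generate.one)
  then show ?case by simp
next
  case (insert b B)
  interpret comm_group G by (rule comm)
  have bG: "b \<in> carrier G" and BG: "B \<subseteq> carrier G" using insert by auto
  define H where "H = generate G B"
  have H: "subgroup H G" unfolding H_def using BG by (rule generate_is_subgroup)
  note Hc = subgroup.m_closed[OF H] subgroup.m_inv_closed[OF H] subgroup.one_closed[OF H]
  have HG: "h \<in> H \<Longrightarrow> h \<in> carrier G" for h using subgroup.mem_carrier[OF H] .
  have ind: "c \<notin> generate G (B - {c})" if "c \<in> B" for c
  proof -
    have "generate G (B - {c}) \<subseteq> generate G (insert b B - {c})"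
      by (rule mono_generate) auto
    then show ?thesis using insert.prems(2)[of c] that by blast
  qed
  have IH: "finite H" "card H = 2 ^ card B"
    using insert.hyps(3)[OF BG ind] unfolding H_def by auto
  have bH: "b \<notin> H" using insert.prems(2)[of b] insert.hyps unfolding H_def by simp
  have ib: "inv b = b" using bG sq by (simp add: inv_equality)
  let ?U = "H \<union> (\<lambda>h. h \<otimes> b) ` H"
  have "subgroup ?U G"
  proof (rule subgroupI)
    show "?U \<subseteq> carrier G" using HG bG by auto
    show "?U \<noteq> {}" using Hc by auto
  next
    fix u assume "u \<in> ?U"
    then show "inv u \<in> ?U" using Hc HG bG ib by (auto simp: inv_mult)
  next
    fix u v assume "u \<in> ?U" "v \<in> ?U"
    moreover have "(h \<otimes> b) \<otimes> k = (h \<otimes> k) \<otimes> b" "(h \<otimes> b) \<otimes> (k \<otimes> b) = h \<otimes> k"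
      "h \<otimes> (k \<otimes> b) = (h \<otimes> k) \<otimes> b"
      if "h \<in> H" "k \<in> H" for h k
    proof -
      have "(h \<otimes> b) \<otimes> (k \<otimes> b) = (h \<otimes> k) \<otimes> (b \<otimes> b)"
        using that HG bG by (simp add: m_ac)
      then show "(h \<otimes> b) \<otimes> (k \<otimes> b) = h \<otimes> k" using that HG bG sq by simp
    qed (use that HG bG in \<open>simp_all add: m_ac\<close>)
    ultimately show "u \<otimes> v \<in> ?U" using Hc by auto
  qed
  then have "generate G (insert b B) \<subseteq> ?U"
  proof (rule generate_subgroup_incl[rotated])
    have "b \<in> (\<lambda>h. h \<otimes> b) ` H" using Hc(3) bG by (intro image_eqI[of _ _ \<one>]) auto
    then show "insert b B \<subseteq> ?U" unfolding H_def using generate.incl[of _ B G] by auto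
  qed
  moreover have "?U \<subseteq> generate G (insert b B)"
    using mono_generate[of B "insert b B"] unfolding H_def
    by (auto intro!: generate.eng intro: generate.incl)
  ultimately have U: "generate G (insert b B) = ?U" by blast
  have inj: "inj_on (\<lambda>h. h \<otimes> b) H" using HG bG by (auto intro: inj_onI)
  have "h \<otimes> b \<notin> H" if "h \<in> H" for h
  proof
    assume "h \<otimes> b \<in> H"
    then have "inv h \<otimes> (h \<otimes> b) \<in> H" using Hc that by blast
    then show False using bH HG[OF that] bG by (simp add: inv_cancel_left)
  qed
  then have "H \<inter> (\<lambda>h. h \<otimes> b) ` H = {}" by auto
  then have "card ?U = card H + card H"
    using IH(1) inj by (simp add: card_Un_disjoint card_image)
  then show ?case using U IH insert.hyps by simp
qed

text \<open>A generating set of least size is a basis, and every basis of a group of order \<open>2\<^sup>k\<close> has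
  \<open>k\<close> elements.\<close>

lemma F2_dim_eq:
  assumes A: "comm_group A" and sq: "\<And>x. x \<in> carrier A \<Longrightarrow> x \<otimes>\<^bsub>A\<^esub> x = \<one>\<^bsub>A\<^esub>"
    and card: "card (carrier A) = 2 ^ k"
  shows "F2_dim A = k"
proof -
  interpret comm_group A by (rule A)
  have fin: "finite (carrier A)" using card by (metis card.infinite power_not_zero zero_neq_numeral)
  define C where "C = {B. B \<subseteq> carrier A \<and> generate A B = carrier A}"
  have "carrier A \<in> C"
    unfolding C_def using generate_incl[of "carrier A"] generate.incl[of _ "carrier A" A] by auto
  then obtain B where B: "B \<in> C" and min: "\<And>D. D \<in> C \<Longrightarrow> card B \<le> card D"
    using arg_min_nat_lemma[of "\<lambda>B. B \<in> C" "carrier A" card] by blast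
  have "F2_basis A B"
    unfolding F2_basis_def
  proof (intro conjI ballI)
    fix b assume b: "b \<in> B"
    show "b \<notin> generate A (B - {b})"
    proof
      assume g: "b \<in> generate A (B - {b})"
      have sub: "B - {b} \<subseteq> carrier A" using B C_def by auto
      have "B \<subseteq> generate A (B - {b})" using g generate.incl[of _ "B - {b}" A] by auto
      then have "carrier A \<subseteq> generate A (B - {b})"
        using B generate_subgroup_incl[OF _ generate_is_subgroup[OF sub], of B] C_def by simp
      then have "B - {b} \<in> C" using sub generate_incl[OF sub] C_def by auto
      moreover have "card (B - {b}) < card B"
        using b B fin finite_subset C_def by (intro card_Diff1_less) auto
      ultimately show False using min by fastforce
    qed
  qed (use B C_def in auto)
  moreover have "card D = k" if "F2_basis A D" for D
  proof -
    have "finite D" using that fin finite_subset unfolding F2_basis_def by blast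
    then have "card (generate A D) = 2 ^ card D"
      using card_generate_independent[OF A sq, of D] that unfolding F2_basis_def by blast
    then have "(2::nat) ^ card D = 2 ^ k" using that card unfolding F2_basis_def by simp
    then show ?thesis by simp
  qed
  ultimately show ?thesis unfolding F2_dim_def by (metis someI)
qed

text \<open>For \<open>M\<close> of exponent 2 the map \<open>g \<otimes> s \<mapsto> g\<^sup>s\<close> is inverse to
  \<open>g \<mapsto> g \<otimes> 1\<close>: modulo the relations every element \<open>w\<close> of the free abelian group
  is the generator \<open>(h w, 1)\<close>, where \<open>h\<close> is the first map.\<close>

lemma tensor_F2_iso:
  fixes M (structure)
  assumes M: "comm_group M" and sq: "\<And>x. x \<in> carrier M \<Longrightarrow> x \<otimes> x = \<one>"
  shows "\<exists>\<phi>. \<phi> \<in> iso (tensor_F2 M) M"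
proof -
  interpret comm_group M by (rule M)
  define F where "F = free_Abelian_group (carrier M \<times> (UNIV :: bit set))"
  define Rel where "Rel = {frag_of (g \<otimes> h, s) - frag_of (g, s) - frag_of (h, s) | g h (s :: bit).
             g \<in> carrier M \<and> h \<in> carrier M} \<union>
          {frag_of (g, s + t) - frag_of (g, s) - frag_of (g, t) | g (s :: bit) t. g \<in> carrier M}"
  define N where "N = generate F Rel"
  have tensor: "tensor_F2 M = F Mod N"
    unfolding tensor_F2_def F_def N_def Rel_def ..
  interpret F: comm_group F unfolding F_def by (rule abelian_free_Abelian_group)
  have F: "x \<in> carrier F \<longleftrightarrow> Poly_Mapping.keys x \<subseteq> carrier M \<times> UNIV" "x \<otimes>\<^bsub>F\<^esub> y = x + y"
    "\<one>\<^bsub>F\<^esub> = 0" for x y unfolding F_def by auto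
  have Fm: "x \<in> carrier F \<Longrightarrow> inv\<^bsub>F\<^esub> x = - x" for x
    unfolding F_def by simp
  have Fd: "x - y \<in> carrier F" if "x \<in> carrier F" "y \<in> carrier F" for x y
    using F.m_closed[OF that(1) F.inv_closed[OF that(2)]] that(2) by (simp add: F Fm)
  have gen: "frag_of (g, s) \<in> carrier F" if "g \<in> carrier M" for g and s :: bit
    using that by (simp add: F)
  have RelF: "Rel \<subseteq> carrier F"
    unfolding Rel_def using gen by (auto intro!: Fd)
  have N: "subgroup N F" unfolding N_def using RelF by (rule F.generate_is_subgroup)
  have Nd: "x - y \<in> N" "x + y \<in> N" if "x \<in> N" "y \<in> N" for x y
    using subgroup.m_closed[OF N that(1) subgroup.m_inv_closed[OF N that(2)]] that
      subgroup.m_closed[OF N] subgroup.mem_carrier[OF N that(2)] by (simp_all add: F Fm)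
  have N0: "0 \<in> N" using subgroup.one_closed[OF N] by (simp add: F)
  have R1: "frag_of (g \<otimes> h, s) - frag_of (g, s) - frag_of (h, s) \<in> N"
    if "g \<in> carrier M" "h \<in> carrier M" for g h and s :: bit
    unfolding N_def Rel_def using that by (intro generate.incl) blast
  have R2: "frag_of (g, s + t) - frag_of (g, s) - frag_of (g, t) \<in> N"
    if "g \<in> carrier M" for g and s t :: bit
    unfolding N_def Rel_def using that by (intro generate.incl) blast
  have "(\<lambda>(g, s :: bit). if s = 1 then g else \<one>) ` (carrier M \<times> UNIV) \<subseteq> carrier M" by auto
  then obtain h where h: "h \<in> hom F M"
    and hf: "\<And>x. x \<in> carrier M \<times> UNIV \<Longrightarrow> h (frag_of x) = (\<lambda>(g, s :: bit). if s = 1 then g else \<one>) x"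
    unfolding F_def by (rule free_Abelian_group_universal) blast
  interpret h: group_hom F M h using h by unfold_locales
  have hs: "h (frag_of (g, s)) = (if s = 1 then g else \<one>)" if "g \<in> carrier M" for g s
    using hf[of "(g, s)"] that by auto
  have hd: "h (x - y) = h x \<otimes> inv (h y)" if "x \<in> carrier F" "y \<in> carrier F" for x y
    using h.hom_mult[OF that(1) F.inv_closed[OF that(2)]] h.hom_inv[OF that(2)]
    by (simp add: F(2) Fm[OF that(2)])
  have hm: "h (- x) = inv (h x)" if "x \<in> carrier F" for x
    using h.hom_inv[OF that] by (simp add: Fm[OF that])
  have inv_id: "inv x = x" if "x \<in> carrier M" for x
    using sq that by (simp add: inv_equality)
  have "h r = \<one>" if "r \<in> Rel" for r
    using that unfolding Rel_def
  proof (elim UnE CollectE exE conjE)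
    fix g k and s :: bit
    assume r: "r = frag_of (g \<otimes> k, s) - frag_of (g, s) - frag_of (k, s)"
      and gk: "g \<in> carrier M" "k \<in> carrier M"
    then show "h r = \<one>" by (auto simp: hd hs gen Fd inv_id inv_mult m_assoc sq inv_cancel_left)
  next
    fix g and s t :: bit
    assume r: "r = frag_of (g, s + t) - frag_of (g, s) - frag_of (g, t)" and g: "g \<in> carrier M"
    then show "h r = \<one>" by (cases s; cases t) (auto simp: hd hm hs gen Fd inv_id sq)
  qed
  then have "Rel \<subseteq> kernel F M h" unfolding kernel_def using RelF by auto
  then have NK: "N \<subseteq> kernel F M h"
    unfolding N_def by (rule F.generate_subgroup_incl) (rule h.subgroup_kernel)
  have zero1: "frag_of (\<one>, 1) \<in> N"
    using Nd(1)[OF N0 R1[of \<one> \<one> 1]] by simp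
  have zero2: "frag_of (g, 0) \<in> N" if "g \<in> carrier M" for g
    using Nd(1)[OF N0 R2[OF that, of 0 0]] by simp
  have red: "w - frag_of (h w, 1) \<in> N" if "Poly_Mapping.keys w \<subseteq> carrier M \<times> (UNIV :: bit set)" for w
    using that
  proof (rule free_Abelian_group_induct[where P = "\<lambda>w. w - frag_of (h w, 1) \<in> N"])
    have "h 0 = \<one>" using h.hom_one by (simp add: F)
    then show "0 - frag_of (h 0, 1) \<in> N" using Nd(1)[OF N0 zero1] by simp
  next
    fix x y :: "'a \<times> bit \<Rightarrow>\<^sub>0 int"
    assume 2: "Poly_Mapping.keys x \<subseteq> carrier M \<times> UNIV" "Poly_Mapping.keys y \<subseteq> carrier M \<times> UNIV"
      "x - frag_of (h x, 1) \<in> N" "y - frag_of (h y, 1) \<in> N"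
    have xy: "x \<in> carrier F" "y \<in> carrier F" using 2 by (simp_all add: F)
    define p q where "p = h x" and "q = h y"
    have pq: "p \<in> carrier M" "q \<in> carrier M" unfolding p_def q_def using xy by auto
    have hxy: "h (x - y) = p \<otimes> q" unfolding p_def q_def using xy by (simp add: hd inv_id)
    \<comment> \<open>subtracting \<open>(q, 1)\<close> is the same as adding it, because \<open>q\<^sup>2 = 1\<close>\<close>
    have "frag_of (\<one>, 1) - frag_of (q, 1) - frag_of (q, 1) \<in> N"
      using R1[of q q 1] pq sq by simp
    then have q2: "frag_of (\<one>, 1) - (frag_of (\<one>, 1) - frag_of (q, 1) - frag_of (q, 1)) \<in> N"
      using Nd zero1 by blast
    have "((x - frag_of (p, 1)) - (y - frag_of (q, 1)))
        - (frag_of (p \<otimes> q, 1) - frag_of (p, 1) - frag_of (q, 1))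
        - (frag_of (\<one>, 1) - (frag_of (\<one>, 1) - frag_of (q, 1) - frag_of (q, 1))) \<in> N"
      (is "?e \<in> N")
      using Nd(1)[OF Nd(1)[OF Nd(1)[OF 2(3,4)[folded p_def q_def]] R1[OF pq, of 1]] q2] .
    moreover have "?e = (x - y) - frag_of (p \<otimes> q, 1)" by simp
    ultimately show "x - y - frag_of (h (x - y), 1) \<in> N" using hxy by simp
  next
    fix a :: "'a \<times> bit" assume "a \<in> carrier M \<times> UNIV"
    then obtain g s where a: "a = (g, s)" "g \<in> carrier M" by auto
    then show "frag_of a - frag_of (h (frag_of a), 1) \<in> N"
      using N0 Nd(1)[OF zero2[of g] zero1] by (cases s) (auto simp: hs)
  qed
  have "kernel F M h \<subseteq> N"
  proof
    fix w assume "w \<in> kernel F M h"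
    then have w: "w \<in> carrier F" "h w = \<one>" unfolding kernel_def by auto
    then have "w - frag_of (\<one>, 1) \<in> N" using red[of w] by (simp add: F)
    then show "w \<in> N" using Nd(2)[OF _ zero1, of "w - frag_of (\<one>, 1)"] by simp
  qed
  then have ker: "kernel F M h = N" using NK by blast
  have "h ` carrier F = carrier M"
  proof
    show "carrier M \<subseteq> h ` carrier F"
    proof
      fix g assume "g \<in> carrier M"
      then show "g \<in> h ` carrier F" using hs[of g 1] gen[of g 1] by (auto intro!: image_eqI[of _ h])
    qed
  qed auto
  then show ?thesis
    using h.FactGroup_iso_set ker tensor by metis
qed

lemma F2_rank_eq:
  assumes M: "comm_group M" and sq: "\<And>x. x \<in> carrier M \<Longrightarrow> x \<otimes>\<^bsub>M\<^esub> x = \<one>\<^bsub>M\<^esub>"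
    and card: "card (carrier M) = 2 ^ k"
  shows "F2_rank M = k"
proof -
  interpret comm_group M by (rule M)
  obtain \<phi> where \<phi>: "\<phi> \<in> iso (tensor_F2 M) M" using tensor_F2_iso[OF M sq] by blast
  have bij: "bij_betw \<phi> (carrier (tensor_F2 M)) (carrier M)" using \<phi> unfolding iso_def by auto
  have "subgroup (generate (free_Abelian_group (carrier M \<times> UNIV))
         ({frag_of (g \<otimes>\<^bsub>M\<^esub> h, s) - frag_of (g, s) - frag_of (h, s) | g h (s :: bit).
             g \<in> carrier M \<and> h \<in> carrier M} \<union>
          {frag_of (g, s + t) - frag_of (g, s) - frag_of (g, t) | g (s :: bit) t. g \<in> carrier M}))
      (free_Abelian_group (carrier M \<times> UNIV))" (is "subgroup ?N ?F")
    by (intro group.generate_is_subgroup group_free_Abelian_group)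
      (auto dest!: subsetD[OF keys_diff] simp: keys_frag_of)
  then have T: "comm_group (tensor_F2 M)"
    unfolding tensor_F2_def
    by (intro comm_group.abelian_FactGroup abelian_free_Abelian_group)
  interpret T: comm_group "tensor_F2 M" by (rule T)
  interpret \<phi>: group_hom "tensor_F2 M" M \<phi> using \<phi> by unfold_locales (auto simp: iso_def)
  have "t \<otimes>\<^bsub>tensor_F2 M\<^esub> t = \<one>\<^bsub>tensor_F2 M\<^esub>" if t: "t \<in> carrier (tensor_F2 M)" for t
  proof (rule inj_onD[OF bij_betw_imp_inj_on[OF bij]])
    show "\<phi> (t \<otimes>\<^bsub>tensor_F2 M\<^esub> t) = \<phi> \<one>\<^bsub>tensor_F2 M\<^esub>"
      using t sq by simp
  qed (use t in auto)
  then show ?thesis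
    unfolding F2_rank_def using F2_dim_eq[OF T] bij_betw_same_card[OF bij] card by simp
qed

section \<open>Automorphisms of the tree as pairs\<close>

abbreviation tG_mult (infixl "\<odot>" 70) where "g \<odot> h \<equiv> g \<otimes>\<^bsub>tG\<^esub> h"
abbreviation tG_inv ("\<iota>") where "\<iota> g \<equiv> inv\<^bsub>tG\<^esub> g"
abbreviation "GG \<equiv> carrier tG"
abbreviation "comm \<equiv> commut tG"
abbreviation "LC \<equiv> lower_central tG"

declare lower_central.simps(3) [simp del]

lemma act_a_involution: "act_a \<circ> act_a = id"
proof
  fix w show "(act_a \<circ> act_a) w = id w" by (cases w) simp_all
qed

lemma act_bcd_involution: "act_b (act_b w) = w \<and> act_c (act_c w) = w \<and> act_d (act_d w) = w"
proof (induct w)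
  case (Cons u w)
  then show ?case using fun_cong[OF act_a_involution] by simp
qed simp

lemma generators_Bij: "{act_a, act_b, act_c, act_d} \<subseteq> carrier (BijGroup UNIV)"
proof -
  have "bij f" if "\<And>w. f (f w) = w" for f :: "word \<Rightarrow> word"
    using that by (intro o_bij[of f]) auto
  then show ?thesis
    using act_bcd_involution fun_cong[OF act_a_involution]
    by (auto simp: BijGroup_def Bij_def extensional_def)
qed

interpretation Bij: group "BijGroup (UNIV :: word set)"
  by (rule group_BijGroup)

lemma subgroup_tG: "subgroup GG (BijGroup UNIV)"
  unfolding tG_def by (simp add: Bij.generate_is_subgroup[OF generators_Bij])

interpretation tG: group tG
proof -
  have "tG = (BijGroup UNIV)\<lparr>carrier := GG\<rparr>" by (simp add: tG_def)
  then show "group tG" using Bij.subgroup_imp_group[OF subgroup_tG] by metis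
qed

lemma tG_mult_comp: "g \<in> GG \<Longrightarrow> h \<in> GG \<Longrightarrow> g \<odot> h = g \<circ> h"
  using subgroup.mem_carrier[OF subgroup_tG, of g] subgroup.mem_carrier[OF subgroup_tG, of h]
  unfolding tG_def by (auto simp: BijGroup_def compose_def fun_eq_iff)

lemma tG_one_id: "\<one>\<^bsub>tG\<^esub> = id"
  by (auto simp: tG_def BijGroup_def)

lemma generate_tG: "GG = generate tG {act_a, act_b, act_c, act_d}"
proof -
  have "generate ((BijGroup UNIV)\<lparr>carrier := GG\<rparr>) {act_a, act_b, act_c, act_d} =
      generate (BijGroup UNIV) {act_a, act_b, act_c, act_d}"
    by (rule Bij.generate_consistent[OF _ subgroup_tG]) (auto simp: tG_def intro: generate.incl)
  then show ?thesis by (simp add: tG_def)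
qed

lemma gens_in [simp]: "act_a \<in> GG" "act_b \<in> GG" "act_c \<in> GG" "act_d \<in> GG"
  by (auto simp: tG_def intro: generate.incl)

lemma gens_carrier: "{act_a, act_b, act_c, act_d} \<subseteq> GG" by simp

lemma id_in [simp]: "id \<in> GG"
  using tG.one_closed by (simp add: tG_one_id)

lemma id_mult [simp]: "g \<in> GG \<Longrightarrow> id \<odot> g = g" "g \<in> GG \<Longrightarrow> g \<odot> id = g" "\<iota> id = id"
  using tG.l_one[of g] tG.r_one[of g] tG.inv_one by (simp_all add: tG_one_id)

definition pair :: "(word \<Rightarrow> word) \<Rightarrow> (word \<Rightarrow> word) \<Rightarrow> word \<Rightarrow> word" where
  "pair g h w = (case w of [] \<Rightarrow> [] | u # s \<Rightarrow> u # (if u = 0 then g s else h s))"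

lemma pair_simps [simp]:
  "pair g h [] = []" "pair g h (0 # s) = 0 # g s" "pair g h (1 # s) = 1 # h s"
  by (simp_all add: pair_def)

lemma word_ext:
  assumes "f [] = g []" "\<And>s. f (0 # s) = g (0 # s)" "\<And>s. f (1 # s) = g ((1 :: bit) # s)"
  shows "f = g"
proof
  fix w :: word show "f w = g w"
    using assms by (cases w) (auto, metis bit_not_one_iff)
qed

lemma pair_comp: "pair g h \<circ> pair g' h' = pair (g \<circ> g') (h \<circ> h')"
  by (rule word_ext) simp_all

lemma pair_id [simp]: "pair id id = id"
  by (rule word_ext) simp_all

lemma pair_inject [simp]: "pair g h = pair g' h' \<longleftrightarrow> g = g' \<and> h = h'"
proof
  assume e: "pair g h = pair g' h'"
  then have "pair g h (0 # s) = pair g' h' (0 # s)" "pair g h (1 # s) = pair g' h' (1 # s)" for s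
    by simp_all
  then show "g = g' \<and> h = h'" by (auto simp: fun_eq_iff)
qed simp

lemma act_pair: "act_b = pair act_a act_c" "act_c = pair id act_d" "act_d = pair id act_b"
  by (rule word_ext; simp)+

lemma act_a_pair: "act_a \<circ> pair g h = pair h g \<circ> act_a"
  by (rule word_ext) simp_all

lemma pair_not_swap: "pair g h \<noteq> act_a \<circ> pair g' h'"
  by (auto dest!: fun_cong[of _ _ "[0]"])

lemma gens_squares [simp]:
  "act_a \<odot> act_a = id" "act_b \<odot> act_b = id" "act_c \<odot> act_c = id" "act_d \<odot> act_d = id"
  using act_bcd_involution by (auto simp: tG_mult_comp act_a_involution fun_eq_iff)

lemma gens_inv [simp]: "\<iota> act_a = act_a" "\<iota> act_b = act_b" "\<iota> act_c = act_c" "\<iota> act_d = act_d"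
  by (rule tG.inv_equality; simp add: tG_one_id)+

text \<open>The generators have this form, with generators or the identity as sections, and \<open>a\<close> normalises the
  group of pairs.\<close>

lemma tG_cases:
  assumes "g \<in> GG"
  obtains (pair) g0 g1 where "g0 \<in> GG" "g1 \<in> GG" "g = pair g0 g1"
  | (swap) g0 g1 where "g0 \<in> GG" "g1 \<in> GG" "g = act_a \<circ> pair g0 g1"
proof -
  have "g \<in> generate tG {act_a, act_b, act_c, act_d}" using assms generate_tG by simp
  then have "\<exists>g0 \<in> GG. \<exists>g1 \<in> GG. g = pair g0 g1 \<or> g = act_a \<circ> pair g0 g1"
  proof (induct g rule: generate.induct)
    case one
    have "\<one>\<^bsub>tG\<^esub> = pair id id" by (simp add: tG_one_id)
    then show ?case using id_in by blast
  next
    case (incl h)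
    have "act_a = act_a \<circ> pair id id" by simp
    then show ?case using incl act_pair gens_in id_in by blast
  next
    case (inv h)
    have "act_a = act_a \<circ> pair id id" by simp
    then show ?case using inv act_pair gens_in id_in gens_inv by (metis insertE empty_iff)
  next
    case (eng u v)
    then obtain u0 u1 v0 v1 where uv: "u0 \<in> GG" "u1 \<in> GG" "v0 \<in> GG" "v1 \<in> GG"
      "u = pair u0 u1 \<or> u = act_a \<circ> pair u0 u1" "v = pair v0 v1 \<or> v = act_a \<circ> pair v0 v1"
      by blast
    have "u \<in> GG" "v \<in> GG" using eng generate_tG by auto
    then have "u \<odot> v = u \<circ> v" by (rule tG_mult_comp)
    moreover have "pair u0 u1 \<circ> pair v0 v1 = pair (u0 \<odot> v0) (u1 \<odot> v1)"
      "(act_a \<circ> pair u0 u1) \<circ> pair v0 v1 = act_a \<circ> pair (u0 \<odot> v0) (u1 \<odot> v1)"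
      "pair u0 u1 \<circ> (act_a \<circ> pair v0 v1) = act_a \<circ> pair (u1 \<odot> v0) (u0 \<odot> v1)"
      "(act_a \<circ> pair u0 u1) \<circ> (act_a \<circ> pair v0 v1) = pair (u1 \<odot> v0) (u0 \<odot> v1)"
    proof -
      show "pair u0 u1 \<circ> pair v0 v1 = pair (u0 \<odot> v0) (u1 \<odot> v1)"
        "(act_a \<circ> pair u0 u1) \<circ> pair v0 v1 = act_a \<circ> pair (u0 \<odot> v0) (u1 \<odot> v1)"
        using uv by (simp_all add: pair_comp o_assoc[symmetric] tG_mult_comp)
      have "pair u0 u1 \<circ> (act_a \<circ> pair v0 v1) = (pair u0 u1 \<circ> act_a) \<circ> pair v0 v1"
        by (simp add: o_assoc)
      then show *: "pair u0 u1 \<circ> (act_a \<circ> pair v0 v1) = act_a \<circ> pair (u1 \<odot> v0) (u0 \<odot> v1)"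
        using uv by (simp flip: act_a_pair add: pair_comp o_assoc[symmetric] tG_mult_comp)
      have "(act_a \<circ> pair u0 u1) \<circ> (act_a \<circ> pair v0 v1) = act_a \<circ> (pair u0 u1 \<circ> (act_a \<circ> pair v0 v1))"
        by (simp add: o_assoc)
      then show "(act_a \<circ> pair u0 u1) \<circ> (act_a \<circ> pair v0 v1) = pair (u1 \<odot> v0) (u0 \<odot> v1)"
        unfolding * by (simp add: o_assoc act_a_involution)
    qed
    ultimately show ?case using uv tG.m_closed by metis
  qed
  then show ?thesis using that by blast
qed

lemma pair_memD:
  assumes "pair g h \<in> GG"
  shows "g \<in> GG" "h \<in> GG"
  by (cases rule: tG_cases[OF assms]; simp add: pair_not_swap)+

lemma pair_mult: "pair g h \<in> GG \<Longrightarrow> pair g' h' \<in> GG \<Longrightarrow> pair g h \<odot> pair g' h' = pair (g \<odot> g') (h \<odot> h')"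
  using pair_memD[of g h] pair_memD[of g' h'] by (simp add: tG_mult_comp pair_comp)

lemma pair_inv:
  assumes "pair g h \<in> GG"
  shows "\<iota> (pair g h) = pair (\<iota> g) (\<iota> h)"
proof -
  obtain k l where kl: "\<iota> (pair g h) = pair k l"
    using tG.inv_closed[OF assms]
  proof (cases rule: tG_cases)
    case (swap k l)
    have "\<iota> (pair g h) \<odot> pair g h = id" using assms by (simp add: tG_one_id)
    then have "act_a \<circ> pair (k \<circ> g) (l \<circ> h) = id"
      using assms tG.inv_closed[OF assms]
      by (simp add: swap tG_mult_comp pair_comp o_assoc[symmetric])
    then show ?thesis using pair_not_swap[of id id] pair_id by metis
  qed (use that in blast)
  have klG: "pair k l \<in> GG" using assms kl by (metis tG.inv_closed)
  have "pair (k \<odot> g) (l \<odot> h) = id"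
    using assms kl klG by (metis pair_mult tG.l_inv tG_one_id)
  then have "k \<odot> g = id" "l \<odot> h = id" by (metis pair_id pair_inject)+
  then have "\<iota> g = k" "\<iota> h = l"
    using pair_memD[OF assms] pair_memD[OF klG] by (auto intro!: tG.inv_equality simp: tG_one_id)
  then show ?thesis using kl by simp
qed

lemma pair_closed:
  assumes "pair g h \<in> GG" "pair g' h' \<in> GG"
  shows "pair (g \<odot> g') (h \<odot> h') \<in> GG"
  using tG.m_closed[OF assms] assms by (simp add: pair_mult)

lemma pair_inv_closed: "pair g h \<in> GG \<Longrightarrow> pair (\<iota> g) (\<iota> h) \<in> GG"
  using tG.inv_closed[of "pair g h"] by (simp add: pair_inv)

lemma conj_a_pair:
  assumes "pair g h \<in> GG"
  shows "act_a \<odot> pair g h \<odot> act_a = pair h g"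
proof -
  have "act_a \<odot> pair g h \<odot> act_a = act_a \<circ> pair g h \<circ> act_a"
    using assms tG_mult_comp gens_in tG.m_closed by metis
  also have "\<dots> = pair h g"
    by (simp add: act_a_pair act_a_involution o_assoc[symmetric])
  finally show ?thesis .
qed

lemma pair_swap: "pair g h \<in> GG \<Longrightarrow> pair h g \<in> GG"
  using conj_a_pair[of g h] gens_in tG.m_closed by metis

lemma swap_cases:
  assumes "g \<in> GG"
  obtains (pair) g0 g1 where "pair g0 g1 \<in> GG" "g = pair g0 g1"
  | (swap) g0 g1 where "pair g0 g1 \<in> GG" "g = act_a \<odot> pair g0 g1"
  using assms
proof (cases rule: tG_cases)
  case (pair g0 g1)
  then show ?thesis using that(1) assms by blast
next
  case (swap g0 g1)
  have "act_a \<odot> g = act_a \<circ> (act_a \<circ> pair g0 g1)" using assms by (simp add: swap tG_mult_comp)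
  also have "\<dots> = pair g0 g1" by (simp add: o_assoc act_a_involution)
  finally have p: "act_a \<odot> g = pair g0 g1" .
  have "pair g0 g1 \<in> GG" unfolding p[symmetric] using assms by simp
  moreover have "g = act_a \<odot> pair g0 g1"
    using assms p tG.m_assoc[of act_a act_a g] by simp
  ultimately show ?thesis using that(2) by blast
qed

lemma pair_commut:
  "pair g h \<in> GG \<Longrightarrow> pair g' h' \<in> GG \<Longrightarrow> comm (pair g h) (pair g' h') = pair (comm g g') (comm h h')"
  by (simp add: commut_def pair_mult pair_inv pair_closed pair_inv_closed)

lemma pair_commut_a:
  assumes "pair g h \<in> GG"
  shows "comm (pair g h) act_a = pair (g \<odot> \<iota> h) (h \<odot> \<iota> g)"
proof -
  have "comm (pair g h) act_a = pair g h \<odot> (act_a \<odot> \<iota> (pair g h) \<odot> act_a)"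
    using assms by (simp add: commut_def tG.m_assoc)
  then show ?thesis
    using assms pair_swap[OF pair_inv_closed[OF assms]]
    by (simp add: pair_inv pair_inv_closed conj_a_pair pair_mult)
qed

text \<open>The pairs \<open>a b a = (c, a)\<close>, \<open>d = (1, b)\<close>, \<open>b = (a, c)\<close> and
  \<open>c = (1, d)\<close> have all four generators as second entries; this is the self-replicating property of the
  group.\<close>

lemma right_section_surj:
  assumes "h \<in> GG"
  shows "\<exists>g. pair g h \<in> GG"
proof -
  have "h \<in> generate tG {act_a, act_b, act_c, act_d}" using assms generate_tG by simp
  then show ?thesis
  proof (induct h rule: generate.induct)
    case one
    then show ?case using pair_id id_in tG_one_id by metis
  next
    case (incl h)
    have "pair act_c act_a \<in> GG" using pair_swap[of act_a act_c] act_pair gens_in by metis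
    then show ?case using incl act_pair gens_in by (metis insertE empty_iff)
  next
    case (inv h)
    have "pair act_c act_a \<in> GG" using pair_swap[of act_a act_c] act_pair gens_in by metis
    then show ?case using inv act_pair gens_in by (metis insertE empty_iff gens_inv)
  next
    case (eng u v)
    then show ?case using pair_closed by blast
  qed
qed

lemma gens_commute [simp]:
  "act_c \<odot> act_b = act_b \<odot> act_c" "act_d \<odot> act_b = act_b \<odot> act_d" "act_d \<odot> act_c = act_c \<odot> act_d"
proof -
  have "act_c (act_b w) = act_b (act_c w) \<and> act_d (act_b w) = act_b (act_d w)
    \<and> act_d (act_c w) = act_c (act_d w)" for w
    by (induct w) auto
  then show "act_c \<odot> act_b = act_b \<odot> act_c" "act_d \<odot> act_b = act_b \<odot> act_d"
    "act_d \<odot> act_c = act_c \<odot> act_d"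
    by (auto simp: tG_mult_comp fun_eq_iff)
qed

lemma gens_cancel [simp]:
  "w \<in> GG \<Longrightarrow> act_a \<odot> (act_a \<odot> w) = w" "w \<in> GG \<Longrightarrow> act_b \<odot> (act_b \<odot> w) = w"
  "w \<in> GG \<Longrightarrow> act_c \<odot> (act_c \<odot> w) = w" "w \<in> GG \<Longrightarrow> act_d \<odot> (act_d \<odot> w) = w"
  by (simp_all flip: tG.m_assoc)

lemma gens_left_commute:
  assumes "w \<in> GG"
  shows "act_c \<odot> (act_b \<odot> w) = act_b \<odot> (act_c \<odot> w)" "act_d \<odot> (act_b \<odot> w) = act_b \<odot> (act_d \<odot> w)"
    "act_d \<odot> (act_c \<odot> w) = act_c \<odot> (act_d \<odot> w)"
  using assms by (simp_all flip: tG.m_assoc)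

text \<open>These rules decide equality of words in the free product \<open>C\<^sub>2 * C\<^sub>2\<^sup>3\<close> on
  \<open>a\<close> and \<open>b, c, d\<close>.\<close>

lemmas word_simps = commut_def tG.inv_mult_group tG.m_assoc gens_left_commute

definition z_elt :: "word \<Rightarrow> word" where "z_elt = comm act_a act_c"

lemmas elt_defs = x_elt_def y_elt_def z_elt_def x2_elt_def

lemma elts_in [simp]: "x_elt \<in> GG" "y_elt \<in> GG" "z_elt \<in> GG" "x2_elt \<in> GG"
  by (simp_all add: elt_defs)

lemma pairs_of_gens [simp]:
  "pair act_a act_c \<in> GG" "pair id act_d \<in> GG" "pair id act_b \<in> GG"
  "pair act_c act_a \<in> GG" "pair act_d id \<in> GG" "pair act_b id \<in> GG"
  using act_pair gens_in pair_swap by metis+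

lemma commut_a_pair:
  assumes "pair g h \<in> GG"
  shows "comm act_a (pair g h) = pair (h \<odot> \<iota> g) (g \<odot> \<iota> h)"
proof -
  have "comm act_a (pair g h) = \<iota> (comm (pair g h) act_a)"
    using assms by (simp add: tG.inv_commut)
  also have "\<dots> = \<iota> (pair (g \<odot> \<iota> h) (h \<odot> \<iota> g))" using assms by (simp add: pair_commut_a)
  also have "\<dots> = pair (h \<odot> \<iota> g) (g \<odot> \<iota> h)"
    using assms pair_memD[OF assms] tG.commut_closed[of "pair g h" act_a]
    by (subst pair_inv) (auto simp: pair_commut_a tG.inv_mult_group)
  finally show ?thesis .
qed

lemma commut_id [simp]: "g \<in> GG \<Longrightarrow> comm g id = id"
  using tG.r_inv[of g] by (simp add: commut_def tG_one_id)

lemma pair_commut_gens: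
  assumes "pair g h \<in> GG"
  shows "comm (pair g h) act_b = pair (comm g act_a) (comm h act_c)"
    "comm (pair g h) act_c = pair id (comm h act_d)"
    "comm (pair g h) act_d = pair id (comm h act_b)"
  using assms pair_memD[OF assms] pair_commut[OF assms, of act_a act_c]
    pair_commut[OF assms, of id act_d] pair_commut[OF assms, of id act_b]
  by (simp_all flip: act_pair)

lemma elt_pairs:
  "x_elt = pair (act_c \<odot> act_a) (act_a \<odot> act_c)" "y_elt = pair act_b act_b" "z_elt = pair act_d act_d"
  using commut_a_pair[of act_a act_c] commut_a_pair[of id act_d] commut_a_pair[of id act_b]
  by (simp_all add: elt_defs flip: act_pair)

lemma x2_pair: "x2_elt = pair (\<iota> z_elt) z_elt"
proof -
  have p: "pair (act_c \<odot> act_a) (act_a \<odot> act_c) \<in> GG" using elts_in(1) by (simp add: elt_pairs)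
  have "x2_elt = pair ((act_c \<odot> act_a) \<odot> (act_c \<odot> act_a)) ((act_a \<odot> act_c) \<odot> (act_a \<odot> act_c))"
    unfolding x2_elt_def elt_pairs by (rule pair_mult[OF p p])
  then show ?thesis by (simp add: z_elt_def word_simps)
qed

lemma elt_squares: "z_elt \<odot> z_elt = id" "y_elt \<odot> y_elt = id" "x2_elt \<odot> x2_elt = id"
proof -
  have p: "pair act_d act_d \<in> GG" "pair act_b act_b \<in> GG"
    using elts_in by (simp_all flip: elt_pairs)
  show z: "z_elt \<odot> z_elt = id" "y_elt \<odot> y_elt = id" using p by (simp_all add: elt_pairs pair_mult)
  have "\<iota> z_elt \<odot> \<iota> z_elt = id" using z by (metis elts_in(3) id_mult(3) tG.inv_mult_group)
  then show "x2_elt \<odot> x2_elt = id"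
    using z elts_in(4) unfolding x2_pair by (simp add: pair_mult)
qed

lemma elt_inverses: "\<iota> z_elt = z_elt" "\<iota> y_elt = y_elt" "\<iota> x2_elt = x2_elt"
  using elt_squares by (auto intro!: tG.inv_equality simp: tG_one_id)

text \<open>All computations in low degree rest on these relations and those for \<open>y\<close>, \<open>z\<close>,
  \<open>x\<^sup>2\<close>.\<close>

lemma commut_x:
  "comm x_elt act_a = x2_elt" "comm x_elt act_b = x2_elt"
  "comm x_elt act_c = pair id y_elt" "comm x_elt act_d = pair id x_elt"
proof -
  show "comm x_elt act_b = x2_elt" by (simp add: elt_defs word_simps)
  show "comm x_elt act_a = x2_elt" by (simp add: elt_defs word_simps)
  have p: "pair (act_c \<odot> act_a) (act_a \<odot> act_c) \<in> GG" using elts_in(1) by (simp add: elt_pairs)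
  have "comm (act_a \<odot> act_c) act_d = y_elt" "comm (act_a \<odot> act_c) act_b = x_elt"
    by (simp_all add: x_elt_def y_elt_def word_simps)
  then show "comm x_elt act_c = pair id y_elt" "comm x_elt act_d = pair id x_elt"
    using pair_commut_gens(2,3)[OF p] by (simp_all flip: elt_pairs(1))
qed

lemma commut_y:
  "comm y_elt act_a = id" "comm y_elt act_b = pair (\<iota> x_elt) id"
  "comm y_elt act_c = id" "comm y_elt act_d = id"
proof -
  have p: "pair act_b act_b \<in> GG" using elts_in(2) by (simp add: elt_pairs)
  show "comm y_elt act_a = id" unfolding elt_pairs using p by (simp add: pair_commut_a)
  show "comm y_elt act_b = pair (\<iota> x_elt) id" "comm y_elt act_c = id" "comm y_elt act_d = id"
    unfolding elt_pairs(2) using p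
    by (simp_all add: pair_commut_gens) (simp_all add: x_elt_def word_simps)
qed

lemma commut_z:
  "comm z_elt act_a = id" "comm z_elt act_b = pair y_elt id"
  "comm z_elt act_c = id" "comm z_elt act_d = id"
proof -
  have p: "pair act_d act_d \<in> GG" using elts_in(3) by (simp add: elt_pairs)
  show "comm z_elt act_a = id" unfolding elt_pairs using p by (simp add: pair_commut_a)
  have "comm z_elt act_b = pair (\<iota> y_elt) id"
    unfolding elt_pairs(3) using p
    by (simp add: pair_commut_gens) (simp_all add: y_elt_def word_simps)
  then show "comm z_elt act_b = pair y_elt id" by (simp add: elt_inverses)
  show "comm z_elt act_c = id" "comm z_elt act_d = id"
    unfolding elt_pairs(3) using p
    by (simp_all add: pair_commut_gens) (simp_all add: word_simps)
qed

lemma commut_x2: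
  "comm x2_elt act_a = id" "comm x2_elt act_b = id"
  "comm x2_elt act_c = id" "comm x2_elt act_d = pair id (pair y_elt id)"
proof -
  have p: "pair (\<iota> z_elt) z_elt \<in> GG" using elts_in(4) by (simp add: x2_pair)
  show "comm x2_elt act_a = id"
    unfolding x2_pair using p by (simp add: pair_commut_a elt_inverses elt_squares)
  \<comment> \<open>\<open>b\<close> inverts \<open>x\<close>, hence commutes with the involution \<open>x\<^sup>2\<close>\<close>
  have "act_b \<odot> x2_elt \<odot> act_b = \<iota> x2_elt"
    by (simp add: elt_defs word_simps)
  then have e: "act_b \<odot> x2_elt \<odot> act_b = x2_elt" by (simp add: elt_inverses)
  have "comm x2_elt act_b = x2_elt \<odot> (act_b \<odot> x2_elt \<odot> act_b)"
    by (simp add: commut_def elt_inverses tG.m_assoc)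
  then show "comm x2_elt act_b = id" by (simp add: e elt_squares)
  show "comm x2_elt act_c = id" "comm x2_elt act_d = pair id (pair y_elt id)"
    unfolding x2_pair using p by (simp_all add: pair_commut_gens commut_z)
qed

section \<open>Lower central series and the wreath recursion\<close>

definition prs :: "(word \<Rightarrow> word) set \<Rightarrow> (word \<Rightarrow> word) set \<Rightarrow> (word \<Rightarrow> word) set" where
  "prs A B = {pair g h | g h. g \<in> A \<and> h \<in> B}"

text \<open>For \<open>[Q, G] \<le> R \<le> Q\<close> this is the kernel of the homomorphism
  \<open>Q \<times> Q \<rightarrow> Q / R\<close> given by the product.\<close>

definition diag :: "(word \<Rightarrow> word) set \<Rightarrow> (word \<Rightarrow> word) set \<Rightarrow> (word \<Rightarrow> word) set" where
  "diag Q R = {pair g h | g h. g \<in> Q \<and> h \<in> Q \<and> g \<odot> h \<in> R}"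

definition level_stabilizer :: "(word \<Rightarrow> word) set" where
  "level_stabilizer = {p \<in> GG. \<exists>g h. p = pair g h}"

text \<open>The intersection of \<open>L\<close> with the second factor \<open>1 \<times> G\<close>, as a set of
  sections.\<close>

definition rfactor :: "(word \<Rightarrow> word) set \<Rightarrow> (word \<Rightarrow> word) set" where
  "rfactor L = {u \<in> GG. pair id u \<in> L}"

text \<open>Every element is a pair or \<open>a\<close> times a pair, and conjugation by \<open>a\<close> swaps the
  entries.\<close>

lemma pairs_normalI:
  assumes M: "subgroup M tG" "M \<subseteq> level_stabilizer"
    and swap: "\<And>g h. pair g h \<in> M \<Longrightarrow> pair h g \<in> M"
    and conj: "\<And>g h k l. pair g h \<in> M \<Longrightarrow> pair k l \<in> GG \<Longrightarrow> pair (k \<odot> g \<odot> \<iota> k) (l \<odot> h \<odot> \<iota> l) \<in> M"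
  shows "M \<lhd> tG"
proof (rule tG.normal_invI[OF M(1)])
  fix t p assume t: "t \<in> GG" and pM: "p \<in> M"
  obtain g h where p: "p = pair g h" and pG: "pair g h \<in> GG"
    using pM M(2) unfolding level_stabilizer_def by blast
  have conj': "pair k l \<odot> p \<odot> \<iota> (pair k l) = pair (k \<odot> g \<odot> \<iota> k) (l \<odot> h \<odot> \<iota> l)"
    if "pair k l \<in> GG" for k l
    using that pG by (simp add: p pair_mult pair_inv pair_closed pair_inv_closed)
  show "t \<odot> p \<odot> \<iota> t \<in> M"
    using t
  proof (cases rule: swap_cases)
    case (pair k l)
    then show ?thesis using conj conj' pM p by simp
  next
    case (swap k l)
    let ?q = "pair (k \<odot> g \<odot> \<iota> k) (l \<odot> h \<odot> \<iota> l)"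
    have q: "?q \<in> M" using conj swap pM p by blast
    then have "?q \<in> GG" using M(2) unfolding level_stabilizer_def by blast
    have "t \<odot> p \<odot> \<iota> t = act_a \<odot> (pair k l \<odot> p \<odot> \<iota> (pair k l)) \<odot> act_a"
      using swap pG by (simp add: p tG.inv_mult_group tG.m_assoc)
    also have "\<dots> = pair (l \<odot> h \<odot> \<iota> l) (k \<odot> g \<odot> \<iota> k)"
      using swap conj' conj_a_pair[OF \<open>?q \<in> GG\<close>] by simp
    finally show ?thesis using assms(3)[OF q] by simp
  qed
qed

lemma level_stabilizer_normal: "level_stabilizer \<lhd> tG"
proof (rule pairs_normalI)
  show "subgroup level_stabilizer tG"
  proof (rule tG.subgroupI)
    have "pair id id \<in> level_stabilizer"
      unfolding level_stabilizer_def by (intro CollectI conjI exI[of _ id] refl) simp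
    then show "level_stabilizer \<noteq> {}" by blast
    fix p assume p: "p \<in> level_stabilizer"
    then obtain g h where "p = pair g h" "pair g h \<in> GG" unfolding level_stabilizer_def by blast
    then show "\<iota> p \<in> level_stabilizer"
      unfolding level_stabilizer_def by (auto simp: pair_inv pair_inv_closed)
  next
    fix p q assume "p \<in> level_stabilizer" "q \<in> level_stabilizer"
    then obtain g h k l where "p = pair g h" "pair g h \<in> GG" "q = pair k l" "pair k l \<in> GG"
      unfolding level_stabilizer_def by blast
    then show "p \<odot> q \<in> level_stabilizer"
      unfolding level_stabilizer_def by (auto simp: pair_mult pair_closed)
  qed (auto simp: level_stabilizer_def)
next
  fix g h k l assume p: "pair g h \<in> level_stabilizer" and q: "pair k l \<in> GG"
  then have "pair k l \<odot> pair g h \<odot> \<iota> (pair k l) = pair (k \<odot> g \<odot> \<iota> k) (l \<odot> h \<odot> \<iota> l)"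
    by (simp add: level_stabilizer_def pair_mult pair_inv pair_closed pair_inv_closed)
  moreover have "pair k l \<odot> pair g h \<odot> \<iota> (pair k l) \<in> GG"
    using p q unfolding level_stabilizer_def by simp
  ultimately show "pair (k \<odot> g \<odot> \<iota> k) (l \<odot> h \<odot> \<iota> l) \<in> level_stabilizer"
    unfolding level_stabilizer_def by auto
qed (auto simp: level_stabilizer_def pair_swap)

lemma normal_pair_swap:
  assumes L: "L \<lhd> tG" and p: "pair g h \<in> L"
  shows "pair h g \<in> L"
proof -
  have "act_a \<odot> pair g h \<odot> \<iota> act_a \<in> L" using tG.normal_conj[OF L gens_in(1) p] .
  then show ?thesis using conj_a_pair[OF tG.normal_mem[OF L p]] by simp
qed

lemma pair_cancel:
  assumes L: "L \<lhd> tG" and u: "pair u id \<in> L" "pair u w \<in> L"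
  shows "pair id w \<in> L"
proof -
  have G: "pair u id \<in> GG" "pair u w \<in> GG" using u tG.normal_mem[OF L] by auto
  have "\<iota> u \<odot> u = id" using tG.l_inv[of u] pair_memD(1)[OF G(1)] by (simp add: tG_one_id)
  then have "\<iota> (pair u id) \<odot> pair u w = pair id w"
    using G pair_inv_closed[OF G(1)] pair_memD[OF G(2)] by (simp add: pair_inv pair_mult)
  then show ?thesis using tG.normal_mult[OF L tG.normal_m_inv[OF L u(1)] u(2)] by simp
qed

text \<open>Self-replication turns normality in the group into normality of a factor.\<close>

lemma rfactor_normal:
  assumes L: "L \<lhd> tG"
  shows "rfactor L \<lhd> tG"
proof (rule tG.normal_invI)
  have pm: "pair id u \<odot> pair id v = pair id (u \<odot> v)" if "u \<in> rfactor L" "v \<in> rfactor L" for u v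
    using that tG.normal_mem[OF L] by (simp add: rfactor_def pair_mult)
  have pi: "\<iota> (pair id u) = pair id (\<iota> u)" if "u \<in> rfactor L" for u
    using that tG.normal_mem[OF L] by (simp add: rfactor_def pair_inv)
  show "subgroup (rfactor L) tG"
  proof (rule tG.subgroupI)
    show "rfactor L \<noteq> {}"
      using tG.normal_one[OF L] id_in unfolding rfactor_def by (auto simp: tG_one_id intro!: exI[of _ id])
    fix u assume u: "u \<in> rfactor L"
    then have "\<iota> (pair id u) \<in> L" unfolding rfactor_def using tG.normal_m_inv[OF L] by blast
    then show "\<iota> u \<in> rfactor L" using u pi[OF u] by (simp add: rfactor_def)
  next
    fix u v assume uv: "u \<in> rfactor L" "v \<in> rfactor L"
    then have "pair id u \<odot> pair id v \<in> L" unfolding rfactor_def using tG.normal_mult[OF L] by blast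
    then show "u \<odot> v \<in> rfactor L" using uv pm[OF uv] by (simp add: rfactor_def)
  qed (auto simp: rfactor_def)
next
  fix t u assume t: "t \<in> GG" and u: "u \<in> rfactor L"
  obtain s where s: "pair s t \<in> GG" using right_section_surj[OF t] by blast
  have uG: "u \<in> GG" "pair id u \<in> GG" using u tG.normal_mem[OF L] by (auto simp: rfactor_def)
  have "pair s t \<odot> pair id u \<odot> \<iota> (pair s t) = pair (s \<odot> id \<odot> \<iota> s) (t \<odot> u \<odot> \<iota> t)"
    using s uG pair_closed[OF s uG(2)] by (simp add: pair_mult pair_inv pair_inv_closed)
  moreover have "s \<odot> id \<odot> \<iota> s = id" using pair_memD[OF s] by (simp add: tG_one_id[symmetric])
  moreover have "pair s t \<odot> pair id u \<odot> \<iota> (pair s t) \<in> L"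
    using tG.normal_conj[OF L s] u by (simp add: rfactor_def)
  ultimately show "t \<odot> u \<odot> \<iota> t \<in> rfactor L"
    using t uG by (simp add: rfactor_def)
qed

text \<open>Any element of the stabilizer with second section \<open>g\<close> will do: its first section meets the
  identity.\<close>

lemma commut_in_rfactor:
  assumes "pair id u \<in> P" "pair id u \<in> GG" "g \<in> GG"
  shows "comm u g \<in> rfactor (commg tG P)"
proof -
  obtain s where s: "pair s g \<in> GG" using right_section_surj[OF assms(3)] by blast
  have "s \<in> GG" using pair_memD[OF s] by blast
  then have "comm id s = id" using tG.r_inv[of s] by (simp add: commut_def tG_one_id)
  then have "comm (pair id u) (pair s g) = pair id (comm u g)"
    using assms(2) s by (simp add: pair_commut)
  then show ?thesis
    using tG.commut_in_commg[OF assms(1) s] pair_memD[OF assms(2)] assms(3)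
    by (simp add: rfactor_def)
qed

lemma prs_subset_rfactor:
  assumes L: "L \<lhd> tG" and R: "R \<subseteq> rfactor L"
  shows "prs R R \<subseteq> L"
proof
  fix p assume "p \<in> prs R R"
  then obtain g h where p: "p = pair g h" and gh: "g \<in> R" "h \<in> R" unfolding prs_def by blast
  then have "pair g id \<in> L" "pair id h \<in> L"
    using R normal_pair_swap[OF L] unfolding rfactor_def by auto
  then have "pair g id \<odot> pair id h \<in> L" by (rule tG.normal_mult[OF L])
  moreover have "pair g id \<odot> pair id h = p"
    using \<open>pair g id \<in> L\<close> \<open>pair id h \<in> L\<close> tG.normal_mem[OF L] gh R
    by (auto simp: p pair_mult rfactor_def)
  ultimately show "p \<in> L" by simp
qed

text \<open>By \<open>[p, a t] = [p, a] \<cdot> a [p, t] a\<close> the commutators of a pair with \<open>a\<close>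
  and with pairs suffice.\<close>

lemma commg_pairs_least:
  assumes M: "M \<lhd> tG" and P: "P \<subseteq> level_stabilizer"
    and a: "\<And>g h. pair g h \<in> P \<Longrightarrow> pair (g \<odot> \<iota> h) (h \<odot> \<iota> g) \<in> M"
    and b: "\<And>g h k l. pair g h \<in> P \<Longrightarrow> pair k l \<in> GG \<Longrightarrow> pair (comm g k) (comm h l) \<in> M"
  shows "commg tG P \<subseteq> M"
proof (rule tG.commg_least[OF tG.normal_sub[OF M]])
  fix p t assume "p \<in> P" and t: "t \<in> GG"
  then obtain g h where p: "p = pair g h" and pP: "pair g h \<in> P" and pG: "pair g h \<in> GG"
    using P unfolding level_stabilizer_def by blast
  have pr: "comm p (pair k l) \<in> M" if "pair k l \<in> GG" for k l
    using b[OF pP that] pG that by (simp add: p pair_commut)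
  show "comm p t \<in> M"
    using t
  proof (cases rule: swap_cases)
    case (pair k l)
    then show ?thesis using pr by simp
  next
    case (swap k l)
    have "comm p t = comm p act_a \<odot> (act_a \<odot> comm p (pair k l) \<odot> \<iota> act_a)"
      using swap pG tG.commut_mult_right[of p act_a "pair k l"] by (simp add: p)
    moreover have "comm p act_a \<in> M" using a[OF pP] pG by (simp add: p pair_commut_a)
    moreover have "act_a \<odot> comm p (pair k l) \<odot> \<iota> act_a \<in> M"
      using tG.normal_conj[OF M gens_in(1) pr[OF swap(1)]] .
    ultimately show ?thesis using tG.normal_mult[OF M] by simp
  qed
qed

lemma tK_normal: "tK \<lhd> tG"
  unfolding tK_def by (rule tG.normal_closure_normal) simp

lemma tT_normal: "tT \<lhd> tG"
  unfolding tT_def by (rule tG.normal_closure_normal) simp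

lemma xy_in_tK: "x_elt \<in> tK" "y_elt \<in> tK"
  unfolding tK_def by (auto intro!: tG.normal_closure_incl)

lemma x2_in_tT: "x2_elt \<in> tT"
  unfolding tT_def by (auto intro!: tG.normal_closure_incl)

lemma tK_least: "N \<lhd> tG \<Longrightarrow> x_elt \<in> N \<Longrightarrow> y_elt \<in> N \<Longrightarrow> tK \<subseteq> N"
  unfolding tK_def by (rule tG.normal_closure_least) auto

lemma tT_least: "N \<lhd> tG \<Longrightarrow> x2_elt \<in> N \<Longrightarrow> tT \<subseteq> N"
  unfolding tT_def by (rule tG.normal_closure_least) auto

lemma tK_stabilizer: "tK \<subseteq> level_stabilizer"
  using tK_least[OF level_stabilizer_normal] elts_in elt_pairs
  unfolding level_stabilizer_def by blast

text \<open>The elements \<open>(1, x) = [x, d]\<close> and \<open>(1, y) = [x, c]\<close> lie in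
  \<open>[K, G]\<close>, and normality spreads them over both factors.\<close>

lemma prs_tK_commg: "prs tK tK \<subseteq> commg tG tK"
proof (rule prs_subset_rfactor)
  show L: "commg tG tK \<lhd> tG" using tK_normal by (rule tG.commg_normal)
  show "tK \<subseteq> rfactor (commg tG tK)"
  proof (rule tK_least[OF rfactor_normal[OF L]])
    show "x_elt \<in> rfactor (commg tG tK)" "y_elt \<in> rfactor (commg tG tK)"
      using tG.commut_in_commg[OF xy_in_tK(1), of act_d] tG.commut_in_commg[OF xy_in_tK(1), of act_c]
      by (simp_all add: commut_x rfactor_def)
  qed
qed

lemma prs_tK_subset: "prs tK tK \<subseteq> tK"
  using prs_tK_commg tG.commg_subset[OF tK_normal] by blast

lemma pair_tK: "g \<in> tK \<Longrightarrow> h \<in> tK \<Longrightarrow> pair g h \<in> GG"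
  using prs_tK_subset tG.normal_mem[OF tK_normal] unfolding prs_def by blast

text \<open>Modulo \<open>R\<close> the group \<open>Q\<close> is central, so entries may be permuted and conjugated freely
  in products.\<close>

lemma diag_normal:
  assumes Q: "Q \<lhd> tG" "Q \<subseteq> tK" and R: "R \<lhd> tG" and QR: "commg tG Q \<subseteq> R"
  shows "diag Q R \<lhd> tG"
proof -
  have G: "pair g h \<in> GG" if "g \<in> Q" "h \<in> Q" for g h using that Q pair_tK by blast
  have QG: "g \<in> GG" if "g \<in> Q" for g using that tG.normal_mem[OF Q(1)] by blast
  note Qc = tG.normalD[OF Q(1)] and Rc = tG.normalD[OF R]
  have c: "comm g k \<in> R" if "g \<in> Q" "k \<in> GG" for g k
    using tG.commut_in_commg[OF that] QR by blast
  show ?thesis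
  proof (rule pairs_normalI)
    show "diag Q R \<subseteq> level_stabilizer" unfolding diag_def level_stabilizer_def using G by blast
    show "subgroup (diag Q R) tG"
    proof (rule tG.subgroupI)
      show "diag Q R \<subseteq> GG" unfolding diag_def using G by blast
      have "pair \<one>\<^bsub>tG\<^esub> \<one>\<^bsub>tG\<^esub> \<in> diag Q R" unfolding diag_def using Qc(7) Rc(7) by auto
      then show "diag Q R \<noteq> {}" by blast
    next
      fix p assume "p \<in> diag Q R"
      then obtain g h where p: "p = pair g h" and gh: "g \<in> Q" "h \<in> Q" "g \<odot> h \<in> R"
        unfolding diag_def by blast
      have "\<iota> g \<odot> \<iota> h = \<iota> g \<odot> \<iota> (g \<odot> h) \<odot> g"
        using gh QG by (simp add: tG.inv_mult_group tG.m_assoc)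
      then have "\<iota> g \<odot> \<iota> h \<in> R" using Rc gh QG by simp
      then show "\<iota> p \<in> diag Q R" unfolding diag_def using gh Qc G by (auto simp: p pair_inv)
    next
      fix p q assume "p \<in> diag Q R" "q \<in> diag Q R"
      then obtain g h k l where p: "p = pair g h" and q: "q = pair k l"
        and gh: "g \<in> Q" "h \<in> Q" "g \<odot> h \<in> R" and kl: "k \<in> Q" "l \<in> Q" "k \<odot> l \<in> R"
        unfolding diag_def by blast
      have "(g \<odot> k) \<odot> (h \<odot> l) = (g \<odot> h) \<odot> (comm (\<iota> h) k \<odot> (k \<odot> l))"
        using gh kl QG by (simp add: tG.free_reduce)
      then have "(g \<odot> k) \<odot> (h \<odot> l) \<in> R"
        using Rc gh kl c[of "\<iota> h" k] Qc QG by simp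
      then show "p \<odot> q \<in> diag Q R"
        unfolding diag_def using gh kl Qc G by (auto simp: p q pair_mult)
    qed
  next
    fix g h assume "pair g h \<in> diag Q R"
    then have gh: "g \<in> Q" "h \<in> Q" "g \<odot> h \<in> R" unfolding diag_def by auto
    have "h \<odot> g = h \<odot> (g \<odot> h) \<odot> \<iota> h" using gh QG by (simp add: tG.m_assoc)
    then show "pair h g \<in> diag Q R" unfolding diag_def using gh Rc QG by auto
  next
    fix g h k l assume "pair g h \<in> diag Q R" and kl: "pair k l \<in> GG"
    then have gh: "g \<in> Q" "h \<in> Q" "g \<odot> h \<in> R" unfolding diag_def by auto
    note klG = pair_memD[OF kl]
    have "(k \<odot> g \<odot> \<iota> k) \<odot> (l \<odot> h \<odot> \<iota> l) = \<iota> (comm g k) \<odot> ((g \<odot> \<iota> (comm h l) \<odot> \<iota> g) \<odot> (g \<odot> h))"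
      using gh QG klG by (simp add: tG.free_reduce)
    then have "(k \<odot> g \<odot> \<iota> k) \<odot> (l \<odot> h \<odot> \<iota> l) \<in> R"
      using Rc gh c klG QG by simp
    then show "pair (k \<odot> g \<odot> \<iota> k) (l \<odot> h \<odot> \<iota> l) \<in> diag Q R"
      unfolding diag_def using gh klG Qc by auto
  qed
qed

lemma prs_eq_diag: "Q \<lhd> tG \<Longrightarrow> prs Q Q = diag Q Q"
  unfolding prs_def diag_def using tG.normal_mult by blast

lemma prs_normal: "Q \<lhd> tG \<Longrightarrow> Q \<subseteq> tK \<Longrightarrow> prs Q Q \<lhd> tG"
  by (simp add: prs_eq_diag diag_normal tG.commg_subset)

text \<open>The commutators of \<open>(g, 1)\<close> with \<open>a\<close> give all \<open>(g, g\<^sup>-\<^sup>1)\<close>,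
  and self-replication gives the commutators inside one factor. Together they generate all pairs with product in
  \<open>[Q, G]\<close>.\<close>

lemma commg_prs:
  assumes Q: "Q \<lhd> tG" "Q \<subseteq> tK"
  shows "commg tG (prs Q Q) = diag Q (commg tG Q)"
proof
  have G: "pair g h \<in> GG" if "g \<in> Q" "h \<in> Q" for g h using that Q pair_tK by blast
  have QG: "g \<in> GG" if "g \<in> Q" for g using that tG.normal_mem[OF Q(1)] by blast
  have R: "commg tG Q \<lhd> tG" using Q(1) by (rule tG.commg_normal)
  have RQ: "commg tG Q \<subseteq> Q" using Q(1) by (rule tG.commg_subset)
  note Qc = tG.normalD[OF Q(1)] and Rc = tG.normalD[OF R]
  have c: "comm g k \<in> commg tG Q" if "g \<in> Q" "k \<in> GG" for g k
    using tG.commut_in_commg[OF that] .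
  have idQ: "id \<in> Q" "id \<in> commg tG Q" using Qc(7) Rc(7) by (simp_all add: tG_one_id)
  show "commg tG (prs Q Q) \<subseteq> diag Q (commg tG Q)"
  proof (rule commg_pairs_least[OF diag_normal[OF Q R order_refl]])
    show "prs Q Q \<subseteq> level_stabilizer" unfolding prs_def level_stabilizer_def using G by blast
    fix g h assume "pair g h \<in> prs Q Q"
    then have gh: "g \<in> Q" "h \<in> Q" unfolding prs_def by auto
    have "(g \<odot> \<iota> h) \<odot> (h \<odot> \<iota> g) = id"
      using gh QG by (simp add: tG.free_reduce tG_one_id[symmetric])
    then show "pair (g \<odot> \<iota> h) (h \<odot> \<iota> g) \<in> diag Q (commg tG Q)"
      unfolding diag_def using gh Qc idQ by auto
    fix k l assume "pair k l \<in> GG"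
    then have "comm g k \<in> commg tG Q" "comm h l \<in> commg tG Q"
      using c gh pair_memD[of k l] by blast+
    then show "pair (comm g k) (comm h l) \<in> diag Q (commg tG Q)"
      unfolding diag_def using RQ Rc(5) by auto
  qed
  define L where "L = commg tG (prs Q Q)"
  have L: "L \<lhd> tG" unfolding L_def by (intro tG.commg_normal prs_normal Q)
  have RF: "commg tG Q \<subseteq> rfactor L"
  proof (rule tG.commg_least)
    show "subgroup (rfactor L) tG" using rfactor_normal[OF L] by (rule tG.normal_sub)
    fix q g assume "q \<in> Q" "g \<in> GG"
    then show "comm q g \<in> rfactor L"
      unfolding L_def using idQ G by (intro commut_in_rfactor) (auto simp: prs_def)
  qed
  show "diag Q (commg tG Q) \<subseteq> commg tG (prs Q Q)"
  proof
    fix p assume "p \<in> diag Q (commg tG Q)"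
    then obtain g h where p: "p = pair g h" and gh: "g \<in> Q" "h \<in> Q" "g \<odot> h \<in> commg tG Q"
      unfolding diag_def by blast
    have "pair g id \<in> prs Q Q" unfolding prs_def using gh idQ by blast
    then have "comm (pair g id) act_a \<in> L" unfolding L_def by (rule tG.commut_in_commg) simp
    then have 1: "pair g (\<iota> g) \<in> L" using G[OF gh(1) idQ(1)] gh QG by (simp add: pair_commut_a)
    have 2: "pair id (g \<odot> h) \<in> L" using RF gh unfolding rfactor_def by blast
    have "pair g (\<iota> g) \<odot> pair id (g \<odot> h) = p"
      using 1 2 tG.normal_mem[OF L] gh QG by (simp add: p pair_mult tG.inv_cancel_left)
    then show "p \<in> commg tG (prs Q Q)" using tG.normal_mult[OF L 1 2] unfolding L_def by simp
  qed
qed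

text \<open>An element of \<open>diag Q R\<close> has \<open>g h\<^sup>-\<^sup>1 = (g h) h\<^sup>-\<^sup>2\<close>, so
  exponent 2 puts its commutator with \<open>a\<close> into \<open>R \<times> R\<close>.\<close>

lemma commg_diag_le:
  assumes Q: "Q \<lhd> tG" "Q \<subseteq> tK" and sq: "\<And>q. q \<in> Q \<Longrightarrow> q \<odot> q \<in> commg tG Q"
  shows "commg tG (diag Q (commg tG Q)) \<subseteq> prs (commg tG Q) (commg tG Q)"
proof -
  have G: "pair g h \<in> GG" if "g \<in> Q" "h \<in> Q" for g h using that Q pair_tK by blast
  have QG: "g \<in> GG" if "g \<in> Q" for g using that tG.normal_mem[OF Q(1)] by blast
  have R: "commg tG Q \<lhd> tG" using Q(1) by (rule tG.commg_normal)
  have RQ: "commg tG Q \<subseteq> Q" using Q(1) by (rule tG.commg_subset)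
  note Rc = tG.normalD[OF R]
  have c: "comm g k \<in> commg tG Q" if "g \<in> Q" "k \<in> GG" for g k
    using tG.commut_in_commg[OF that] .
  show ?thesis
  proof (rule commg_pairs_least)
    show "prs (commg tG Q) (commg tG Q) \<lhd> tG" using R RQ Q(2) by (intro prs_normal) auto
    show "diag Q (commg tG Q) \<subseteq> level_stabilizer"
      unfolding diag_def level_stabilizer_def using G by blast
    fix g h assume "pair g h \<in> diag Q (commg tG Q)"
    then have gh: "g \<in> Q" "h \<in> Q" "g \<odot> h \<in> commg tG Q" unfolding diag_def by auto
    have "g \<odot> \<iota> h = (g \<odot> h) \<odot> \<iota> (h \<odot> h)" using gh QG by (simp add: tG.free_reduce)
    then have r: "g \<odot> \<iota> h \<in> commg tG Q" using Rc gh sq by simp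
    have "h \<odot> \<iota> g = \<iota> (g \<odot> \<iota> h)" using gh QG by (simp add: tG.free_reduce)
    then show "pair (g \<odot> \<iota> h) (h \<odot> \<iota> g) \<in> prs (commg tG Q) (commg tG Q)"
      unfolding prs_def using r Rc by auto
    fix k l assume "pair k l \<in> GG"
    then show "pair (comm g k) (comm h l) \<in> prs (commg tG Q) (commg tG Q)"
      unfolding prs_def using c gh pair_memD[of k l] by auto
  qed
qed

text \<open>These are the commutators of \<open>(q\<^sup>-\<^sup>1, q)\<close> with \<open>c = (1, d)\<close>,
  \<open>d = (1, b)\<close> and \<open>b = (a, c)\<close>.\<close>

lemma antidiagonal_commut:
  assumes Q: "Q \<lhd> tG" "Q \<subseteq> tK" and q: "q \<in> Q"
  shows "comm q act_d \<in> rfactor (commg tG (diag Q (commg tG Q)))"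
    and "comm q act_b \<in> rfactor (commg tG (diag Q (commg tG Q)))"
    and "pair (comm (\<iota> q) act_a) (comm q act_c) \<in> commg tG (diag Q (commg tG Q))"
proof -
  have qG: "q \<in> GG" using q tG.normal_mem[OF Q(1)] by blast
  have iq: "\<iota> q \<in> Q" using q tG.normal_m_inv[OF Q(1)] by blast
  have p: "pair (\<iota> q) q \<in> GG" using q iq Q pair_tK by blast
  have "pair (\<iota> q) q \<in> diag Q (commg tG Q)"
    unfolding diag_def using q iq qG tG.normal_one[OF tG.commg_normal[OF Q(1)]] by auto
  then have "comm (pair (\<iota> q) q) s \<in> commg tG (diag Q (commg tG Q))" if "s \<in> GG" for s
    using that by (rule tG.commut_in_commg)
  from this[of act_b] this[of act_c] this[of act_d] show
    "comm q act_d \<in> rfactor (commg tG (diag Q (commg tG Q)))"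
    "comm q act_b \<in> rfactor (commg tG (diag Q (commg tG Q)))"
    "pair (comm (\<iota> q) act_a) (comm q act_c) \<in> commg tG (diag Q (commg tG Q))"
    using qG by (simp_all add: pair_commut_gens[OF p] rfactor_def)
qed

text \<open>The commutators \<open>[q, b]\<close> and \<open>[q, d]\<close> already occur in a single factor. The
  commutator of \<open>(q\<^sup>-\<^sup>1, q)\<close> with \<open>b = (a, c)\<close> has the two entries
  \<open>[q\<^sup>-\<^sup>1, a]\<close> and \<open>[q, c]\<close>; if one of them can be removed, because it lies in
  \<open>[[Q, G], G]\<close>, the other one is isolated too.\<close>

lemma commg_diag:
  assumes Q: "Q \<lhd> tG" "Q \<subseteq> tK" and sq: "\<And>q. q \<in> Q \<Longrightarrow> q \<odot> q \<in> commg tG Q"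
    and ac: "(\<forall>q \<in> Q. comm q act_a \<in> commg tG (commg tG Q)) \<or>
      (\<forall>q \<in> Q. comm q act_c \<in> commg tG (commg tG Q))"
  shows "commg tG (diag Q (commg tG Q)) = prs (commg tG Q) (commg tG Q)"
proof
  show "commg tG (diag Q (commg tG Q)) \<subseteq> prs (commg tG Q) (commg tG Q)"
    using assms by (intro commg_diag_le)
  define R where "R = commg tG Q"
  define L where "L = commg tG (diag Q R)"
  have G: "pair g h \<in> GG" if "g \<in> Q" "h \<in> Q" for g h using that Q pair_tK by blast
  have QG: "g \<in> GG" if "g \<in> Q" for g using that tG.normal_mem[OF Q(1)] by blast
  have R: "R \<lhd> tG" unfolding R_def using Q(1) by (rule tG.commg_normal)
  have RQ: "R \<subseteq> Q" unfolding R_def using Q(1) by (rule tG.commg_subset)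
  have L: "L \<lhd> tG" unfolding L_def
    using tG.commg_normal[OF diag_normal[OF Q R]] by (simp add: R_def)
  have F: "rfactor L \<lhd> tG" using L by (rule rfactor_normal)
  have idQ: "id \<in> Q" using tG.normal_one[OF Q(1)] by (simp add: tG_one_id)
  have RF: "commg tG R \<subseteq> rfactor L"
  proof (rule tG.commg_least[OF tG.normal_sub[OF F]])
    fix r g assume r: "r \<in> R" and g: "g \<in> GG"
    then have "pair id r \<in> diag Q R" unfolding diag_def using idQ RQ QG by auto
    then show "comm r g \<in> rfactor L" unfolding L_def
      using commut_in_rfactor G[OF idQ] r RQ g by blast
  qed
  have iQ: "\<iota> q \<in> Q" if "q \<in> Q" for q using that tG.normal_m_inv[OF Q(1)] by blast
  have cl: "comm q s \<in> GG" "pair (comm q s) id \<in> GG" "pair id (comm q s) \<in> GG"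
    if "q \<in> Q" "s \<in> GG" for q s
    using tG.commut_mem_normal[OF Q(1) that] G idQ QG by auto
  have "comm q act_a \<in> rfactor L \<and> comm q act_c \<in> rfactor L" if q: "q \<in> Q" for q
  proof -
    have p: "pair (comm (\<iota> q) act_a) (comm q act_c) \<in> L" if "q \<in> Q" for q
      using antidiagonal_commut(3)[OF Q that] unfolding L_def R_def .
    have split: "comm (\<iota> q) act_a \<in> rfactor L \<longleftrightarrow> comm q act_c \<in> rfactor L" if q: "q \<in> Q" for q
    proof -
      have "pair (comm (\<iota> q) act_a) id \<in> L \<longleftrightarrow> pair id (comm q act_c) \<in> L"
        using pair_cancel[OF L _ p[OF q]] pair_cancel[OF L _ normal_pair_swap[OF L p[OF q]]]
          normal_pair_swap[OF L] by blast
      then show ?thesis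
        using normal_pair_swap[OF L] cl q iQ unfolding rfactor_def by auto
    qed
    show ?thesis
      using ac
    proof
      assume "\<forall>q \<in> Q. comm q act_a \<in> commg tG (commg tG Q)"
      then show ?thesis using split[OF q] q iQ RF unfolding R_def by blast
    next
      assume c: "\<forall>q \<in> Q. comm q act_c \<in> commg tG (commg tG Q)"
      then have "comm (\<iota> (\<iota> q)) act_a \<in> rfactor L"
        using split[OF iQ[OF q]] q iQ RF unfolding R_def by blast
      then show ?thesis using c q RF QG unfolding R_def by auto
    qed
  qed
  then have "comm q s \<in> rfactor L" if "q \<in> Q" "s \<in> {act_a, act_b, act_c, act_d}" for q s
    using that antidiagonal_commut(1,2)[OF Q that(1)] unfolding L_def R_def by auto
  then have "comm q g \<in> rfactor L" if "q \<in> Q" "g \<in> GG" for q g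
    using tG.commut_mod_right[OF F _ gens_carrier generate_tG] that QG by blast
  then have "R \<subseteq> rfactor L"
    unfolding R_def by (intro tG.commg_least[OF tG.normal_sub[OF F]])
  then show "prs (commg tG Q) (commg tG Q) \<subseteq> commg tG (diag Q (commg tG Q))"
    using prs_subset_rfactor[OF L] unfolding L_def R_def by blast
qed

section \<open>The first terms of the lower central series\<close>

text \<open>The group \<open>N\<^sub>1 = (K \<times> K) T\<close>.\<close>

definition tN1 :: "(word \<Rightarrow> word) set" where
  "tN1 = prs tK tK <#>\<^bsub>tG\<^esub> tT"

lemma prs_tK_normal: "prs tK tK \<lhd> tG"
  using tK_normal by (rule prs_normal) simp

lemma tN1_normal: "tN1 \<lhd> tG"
  unfolding tN1_def using prs_tK_normal tT_normal by (rule tG.set_mult_normal)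

lemma tN1_incl: "prs tK tK \<subseteq> tN1" "tT \<subseteq> tN1"
  unfolding tN1_def
  using tG.set_mult_left[OF tT_normal tG.normal_carrier[OF prs_tK_normal]]
    tG.set_mult_right[OF prs_tK_normal tG.normal_carrier[OF tT_normal]] by auto

lemma tN1_least:
  assumes "N \<lhd> tG" "prs tK tK \<subseteq> N" "x2_elt \<in> N"
  shows "tN1 \<subseteq> N"
  unfolding tN1_def set_mult_def
  using assms(2) tT_least[OF assms(1,3)] tG.normal_mult[OF assms(1)] by blast

lemma pair_id_tN1: "pair id x_elt \<in> tN1" "pair id y_elt \<in> tN1"
  "pair (\<iota> x_elt) id \<in> tN1" "pair y_elt id \<in> tN1" "x2_elt \<in> tN1" "id \<in> tN1"
proof -
  note K = tG.normalD[OF tK_normal]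
  have "id \<in> tK" using K(7) by (simp add: tG_one_id)
  then have "pair id x_elt \<in> prs tK tK" "pair id y_elt \<in> prs tK tK"
    "pair (\<iota> x_elt) id \<in> prs tK tK" "pair y_elt id \<in> prs tK tK"
    unfolding prs_def using xy_in_tK K(6) by auto
  then show "pair id x_elt \<in> tN1" "pair id y_elt \<in> tN1" "pair (\<iota> x_elt) id \<in> tN1" "pair y_elt id \<in> tN1"
    using tN1_incl by auto
  show "x2_elt \<in> tN1" using tN1_incl x2_in_tT by blast
  show "id \<in> tN1" using tG.normal_one[OF tN1_normal] by (simp add: tG_one_id)
qed

lemma LC_Suc: "n \<ge> 1 \<Longrightarrow> LC (Suc n) = commg tG (LC n)"
  by (rule tG.lower_central_Suc)

text \<open>The generators \<open>b\<close>, \<open>c\<close>, \<open>d\<close> commute with each other, so only their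
  commutators with \<open>a\<close> survive.\<close>

lemma LC2: "LC 2 = normal_closure tG {x_elt, y_elt, z_elt}"
proof
  let ?D = "normal_closure tG {x_elt, y_elt, z_elt}"
  have D: "?D \<lhd> tG" by (rule tG.normal_closure_normal) simp
  have xyz: "x_elt \<in> ?D" "y_elt \<in> ?D" "z_elt \<in> ?D"
    by (auto intro!: tG.normal_closure_incl)
  have inv_mem: "comm s t \<in> ?D" if "comm t s \<in> ?D" "s \<in> GG" "t \<in> GG" for s t
    using that tG.inv_commut[of t s] tG.normal_m_inv[OF D] by metis
  have self: "comm s s \<in> ?D" if "s \<in> {act_a, act_b, act_c, act_d}" for s
    using that tG.normal_one[OF D] by (auto simp: commut_def tG_one_id)
  have 1: "comm act_a t \<in> ?D" if "t \<in> {act_a, act_b, act_c, act_d}" for t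
    using that xyz self unfolding elt_defs by blast
  have 2: "comm s t \<in> ?D" if "s \<in> {act_b, act_c, act_d}" "t \<in> {act_b, act_c, act_d}" for s t
  proof -
    have "s \<odot> t = t \<odot> s" using that by auto
    then have "comm s t = id" using that by (auto simp: commut_def tG.m_assoc)
    then show ?thesis using tG.normal_one[OF D] by (simp add: tG_one_id)
  qed
  have gens: "comm s t \<in> ?D" if "s \<in> {act_a, act_b, act_c, act_d}" "t \<in> {act_a, act_b, act_c, act_d}" for s t
    using that 1 2 inv_mem[OF 1] gens_in by blast
  have "generate tG {act_a, act_b, act_c, act_d} \<subseteq> {x \<in> GG. \<forall>g \<in> GG. comm x g \<in> ?D}"
  proof (rule tG.generate_subgroup_incl)
    show "subgroup {x \<in> GG. \<forall>g \<in> GG. comm x g \<in> ?D} tG"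
      using tG.normal_sub[OF tG.centre_mod_normal[OF D]] .
    show "{act_a, act_b, act_c, act_d} \<subseteq> {x \<in> GG. \<forall>g \<in> GG. comm x g \<in> ?D}"
      using tG.commut_mod_right[OF D _ gens_carrier generate_tG gens] gens_in by blast
  qed
  then have "comm x g \<in> ?D" if "x \<in> GG" "g \<in> GG" for x g
    using that generate_tG by blast
  then have "commg tG GG \<subseteq> ?D" by (rule tG.commg_least[OF tG.normal_sub[OF D]])
  then show "LC 2 \<subseteq> ?D" using LC_Suc[of 1] by (simp add: numeral_2_eq_2)
  show "?D \<subseteq> LC 2"
  proof (rule tG.normal_closure_least[OF tG.lower_central_normal])
    have "comm s t \<in> LC 2" if "s \<in> GG" "t \<in> GG" for s t
      using tG.commut_in_commg[of s GG t] that LC_Suc[of 1] by (simp add: numeral_2_eq_2)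
    then show "{x_elt, y_elt, z_elt} \<subseteq> LC 2" unfolding elt_defs by simp
  qed
qed

lemma tK_LC2: "tK \<subseteq> LC 2"
  unfolding LC2 tK_def by (rule tG.normal_closure_least)
    (auto intro!: tG.normal_closure_normal tG.normal_closure_incl)

text \<open>Commutators of \<open>x\<close>, \<open>y\<close>, \<open>z\<close> with the generators are trivial, equal to
  \<open>x\<^sup>2\<close>, or have an entry \<open>x\<close>, \<open>y\<close> or an inverse in one factor, which gives
  \<open>[\<gamma>\<^sub>2, G] \<le> N\<^sub>1\<close>. Conversely \<open>x\<^sup>2 = [x, a]\<close>,
  \<open>(1, x) = [x, d]\<close> and \<open>(1, y) = [x, c]\<close> are commutators of \<open>x\<close> alone, so
  that \<open>K\<close> already produces all of \<open>N\<^sub>1\<close>.\<close>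

lemma LC3: "LC 3 = tN1" and commg_tK: "commg tG tK = tN1"
proof -
  have "LC 3 = commg tG (LC 2)" using LC_Suc[of 2] by (simp add: numeral_3_eq_3 numeral_2_eq_2)
  moreover have "commg tG (LC 2) \<subseteq> tN1"
    unfolding LC2
  proof (rule tG.commg_normal_closure_least[OF tN1_normal _ gens_carrier generate_tG])
    fix s t assume "s \<in> {x_elt, y_elt, z_elt}" "t \<in> {act_a, act_b, act_c, act_d}"
    then show "comm s t \<in> tN1" using pair_id_tN1 by (auto simp: commut_x commut_y commut_z)
  qed simp
  moreover have "tN1 \<subseteq> commg tG tK"
    using tN1_least[OF tG.commg_normal[OF tK_normal] prs_tK_commg]
      tG.commut_in_commg[OF xy_in_tK(1), of act_a] by (simp add: commut_x)
  moreover have "commg tG tK \<subseteq> commg tG (LC 2)" using tK_LC2 by (rule tG.commg_mono)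
  ultimately show "LC 3 = tN1" "commg tG tK = tN1" by auto
qed

lemma tN1_subset_tK: "tN1 \<subseteq> tK"
  using tG.commg_subset[OF tK_normal] by (simp add: commg_tK)

lemma gens_involutions: "t \<in> {act_a, act_b, act_c, act_d} \<Longrightarrow> t \<odot> t = \<one>\<^bsub>tG\<^esub>"
  by (auto simp: tG_one_id)

lemma LC_squares: "n \<ge> 1 \<Longrightarrow> u \<in> LC n \<Longrightarrow> u \<odot> u \<in> LC (Suc n)"
  by (rule tG.lower_central_squares[OF gens_carrier generate_tG gens_involutions])

lemma tK_squares: "u \<in> tK \<Longrightarrow> u \<odot> u \<in> tN1"
  using LC_squares[of 2 u] tK_LC2 LC3 by (auto simp: numeral_3_eq_3 numeral_2_eq_2)

text \<open>Modulo \<open>diag K N\<^sub>1\<close> the element \<open>x\<^sup>2\<close> is central, its only nontrivial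
  commutator with a generator being \<open>[x\<^sup>2, d] = (1, (y, 1))\<close>, with \<open>(y, 1)\<close> in
  \<open>N\<^sub>1\<close>. Hence only \<open>K \<times> K\<close> contributes to \<open>[N\<^sub>1, G]\<close>.\<close>

lemma LC4: "LC 4 = diag tK tN1"
proof -
  have D: "diag tK tN1 \<lhd> tG"
    by (intro diag_normal tK_normal tN1_normal) (simp_all add: commg_tK)
  have e: "commg tG (prs tK tK) = diag tK tN1"
    using commg_prs[OF tK_normal order_refl] by (simp add: commg_tK)
  have id: "id \<in> tK" "id \<in> tN1"
    using tG.normal_one[OF tK_normal] tG.normal_one[OF tN1_normal] by (simp_all add: tG_one_id)
  let ?Z = "{x \<in> GG. \<forall>g \<in> GG. comm x g \<in> diag tK tN1}"
  have "prs tK tK \<subseteq> ?Z"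
    using tG.commut_in_commg[of _ "prs tK tK"] tG.normal_carrier[OF prs_tK_normal] e by blast
  moreover have "comm x2_elt t \<in> diag tK tN1" if "t \<in> {act_a, act_b, act_c, act_d}" for t
  proof -
    have "pair y_elt id \<in> tK" using pair_id_tN1(4) tN1_subset_tK by blast
    then have "pair id (pair y_elt id) \<in> diag tK tN1"
      unfolding diag_def using pair_id_tN1(4) id tG.normal_mem[OF tK_normal] by auto
    then show ?thesis using that tG.normal_one[OF D] by (auto simp: commut_x2 tG_one_id)
  qed
  then have "x2_elt \<in> ?Z"
    using tG.commut_mod_right[OF D elts_in(4) gens_carrier generate_tG] by simp
  ultimately have "tN1 \<subseteq> ?Z" by (intro tN1_least tG.centre_mod_normal D)
  then have "commg tG tN1 \<subseteq> diag tK tN1"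
    by (intro tG.commg_least[OF tG.normal_sub[OF D]]) blast
  moreover have "diag tK tN1 \<subseteq> commg tG tN1"
    using tG.commg_mono[OF tN1_incl(1)] e by simp
  moreover have "LC 4 = commg tG tN1" using LC_Suc[of 3] LC3 by simp
  ultimately show ?thesis by blast
qed

text \<open>Neither \<open>a\<close> nor \<open>c\<close> centralises \<open>K\<close> modulo
  \<open>\<gamma>\<^sub>4\<close>, since \<open>[x, a] = x\<^sup>2\<close> and \<open>[x, c] = (1, y)\<close>. But
  \<open>[x, a]\<close> equals \<open>[x, b]\<close>, which the commutator with \<open>d\<close> isolates in one factor;
  this frees \<open>[x, c]\<close> as well.\<close>

lemma LC5: "LC 5 = prs tN1 tN1"
proof -
  note Q = tK_normal order_refl[of tK]
  define L where "L = commg tG (diag tK tN1)"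
  have L: "L \<lhd> tG" unfolding L_def using tG.lower_central_normal[of 4] LC4
    by (intro tG.commg_normal) simp
  have F: "rfactor L \<lhd> tG" using L by (rule rfactor_normal)
  note FF = rfactor_normal[OF F]
  have idK: "id \<in> tK" using tG.normal_one[OF tK_normal] by (simp add: tG_one_id)
  note ac = antidiagonal_commut[OF Q xy_in_tK(1), unfolded commg_tK, folded L_def]
  have x2: "x2_elt \<in> rfactor L" using ac(2) by (simp add: commut_x)
  have x: "pair id x_elt \<in> rfactor L" using ac(1) by (simp add: commut_x)
  have "comm (\<iota> x_elt) act_a \<in> rfactor L"
    using x2 tG.normalD[OF F] by (simp add: tG.commut_inv_left commut_x)
  \<comment> \<open>removing the first entry of the commutator of \<open>(x\<^sup>-\<^sup>1, x)\<close> with \<open>b\<close> leaves \<open>(1, [x, c])\<close>\<close>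
  then have u: "pair (comm (\<iota> x_elt) act_a) id \<in> L"
    unfolding rfactor_def using normal_pair_swap[OF L] by blast
  have v: "pair (comm (\<iota> x_elt) act_a) (pair id y_elt) \<in> L" using ac(3) by (simp add: commut_x)
  have "pair id (pair id y_elt) \<in> L" using pair_cancel[OF L u v] .
  then have y: "pair id y_elt \<in> rfactor L"
    unfolding rfactor_def using pair_memD(2) tG.normal_mem[OF L] by blast
  have "tK \<subseteq> rfactor (rfactor L)"
    using x y by (intro tK_least FF) (simp_all add: rfactor_def)
  then have "tN1 \<subseteq> rfactor L" using x2 prs_subset_rfactor[OF F] by (intro tN1_least F)
  then have "prs tN1 tN1 \<subseteq> L" by (rule prs_subset_rfactor[OF L])
  moreover have "L \<subseteq> prs tN1 tN1"
    using commg_diag_le[OF Q] tK_squares unfolding L_def commg_tK by blast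
  moreover have "LC 5 = L" unfolding L_def using LC_Suc[of 4] LC4 by simp
  ultimately show ?thesis by blast
qed

lemma commut_x2_prs: "g \<in> GG \<Longrightarrow> comm x2_elt g \<in> prs tK tK"
proof -
  assume "g \<in> GG"
  then have "comm x2_elt g \<in> diag tK tN1"
    using tG.commut_in_commg[OF pair_id_tN1(5)] LC_Suc[of 3] LC3 LC4 by simp
  then show ?thesis unfolding diag_def prs_def by blast
qed

text \<open>The group \<open>T\<close> contributes a single generator modulo \<open>K \<times> K\<close>, because
  \<open>x\<^sup>2\<close> is central modulo \<open>\<gamma>\<^sub>4 \<le> K \<times> K\<close>.\<close>

lemma tN1_generate: "tN1 = generate tG (prs tK tK \<union> {x2_elt})"
proof
  have "comm x2_elt g \<in> prs tK tK" if "g \<in> GG" for g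
    using that by (rule commut_x2_prs)
  then have "tT \<subseteq> generate tG (prs tK tK \<union> {x2_elt})"
    unfolding tT_def by (intro tG.normal_closure_le_generate prs_tK_normal) auto
  then show "tN1 \<subseteq> generate tG (prs tK tK \<union> {x2_elt})"
    unfolding tN1_def set_mult_def by (auto intro!: generate.eng intro: generate.incl)
  show "generate tG (prs tK tK \<union> {x2_elt}) \<subseteq> tN1"
    using tN1_incl pair_id_tN1(5) tG.normal_sub[OF tN1_normal]
    by (intro tG.generate_subgroup_incl) auto
qed

lemma LC_subset_tK: "n \<ge> 3 \<Longrightarrow> LC n \<subseteq> tK"
  using tG.lower_central_antimono[of 3 n] LC3 tN1_subset_tK by auto

lemma LC_even_of_odd:
  assumes "n \<ge> 3" "LC (2 * n - 1) = prs (LC n) (LC n)"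
  shows "LC (2 * n) = diag (LC n) (LC (Suc n))"
  using commg_prs[OF tG.lower_central_normal LC_subset_tK[OF assms(1)]] assms
    LC_Suc[of "2 * n - 1"] LC_Suc[of n] by simp

text \<open>Modulo \<open>\<gamma>\<^sub>5 = N\<^sub>1 \<times> N\<^sub>1\<close> the element
  \<open>c = (1, d)\<close> commutes with \<open>K \<times> K\<close>, because \<open>[K, d] \<le> N\<^sub>1\<close>,
  and it commutes with \<open>x\<^sup>2\<close>.\<close>

lemma commut_c_LC3:
  assumes "q \<in> LC 3"
  shows "comm q act_c \<in> LC 5"
proof -
  note M = tG.lower_central_normal[of 5]
  have id5: "id \<in> LC 5" using tG.normal_one[OF M] by (simp only: tG_one_id)
  have base: "comm q act_c \<in> LC 5" if "q \<in> prs tK tK \<union> {x2_elt}" for q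
    using that
  proof
    assume "q \<in> prs tK tK"
    then obtain g h where q: "q = pair g h" and gh: "g \<in> tK" "h \<in> tK" unfolding prs_def by blast
    then have "comm h act_d \<in> tN1" using tG.commut_in_commg[of h tK act_d] commg_tK by simp
    then show ?thesis
      unfolding q LC5 prs_def using pair_id_tN1(6) by (auto simp: pair_commut_gens pair_tK gh)
  next
    assume "q \<in> {x2_elt}"
    then show ?thesis using id5 by (simp add: commut_x2)
  qed
  have "q \<in> generate tG (prs tK tK \<union> {x2_elt})" using assms LC3 tN1_generate by simp
  then show ?thesis
  proof (induct q rule: generate.induct)
    case one
    have "comm \<one>\<^bsub>tG\<^esub> act_c = id" by (simp add: commut_def tG_one_id)
    then show ?case using id5 by metis
  next
    case (incl q)
    then show ?case by (rule base)
  next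
    case (inv q)
    have "q \<in> GG" using inv tG.normal_carrier[OF prs_tK_normal] by auto
    then show ?case
      using base[OF inv] by (simp add: tG.commut_inv_left tG.normalD[OF M])
  next
    case (eng u v)
    have "u \<in> GG" "v \<in> GG" using eng tN1_generate tG.normal_mem[OF tN1_normal] by auto
    then show ?case
      using eng by (simp add: tG.commut_mult_left tG.normalD[OF M])
  qed
qed

text \<open>By induction, using that \<open>commg_diag\<close> applies to \<open>\<gamma>\<^sub>m\<close>. For even
  \<open>m = 2k\<close> the elements of \<open>\<gamma>\<^sub>m\<close> are pairs \<open>(g, h)\<close> with
  \<open>g h \<in> \<gamma>\<^sub>k\<^sub>+\<^sub>1\<close>, and
  \<open>[(g, h), a] = (g h\<^sup>-\<^sup>1, h g\<^sup>-\<^sup>1)\<close> has entries in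
  \<open>\<gamma>\<^sub>k\<^sub>+\<^sub>1\<close> with trivial product, so it lies in
  \<open>\<gamma>\<^sub>2\<^sub>k\<^sub>+\<^sub>2\<close>. For odd \<open>m = 2k - 1\<close> the commutator with
  \<open>c = (1, d)\<close> lies in
  \<open>1 \<times> \<gamma>\<^sub>k\<^sub>+\<^sub>1 \<le> \<gamma>\<^sub>2\<^sub>k\<^sub>+\<^sub>1\<close>. Both cases
  use the recursion only up to \<open>m\<close>.\<close>

lemma LC_odd: "n \<ge> 3 \<Longrightarrow> LC (2 * n - 1) = prs (LC n) (LC n)"
proof (induct n rule: less_induct)
  case (less n)
  show ?case
  proof (cases "n = 3")
    case True
    then show ?thesis using LC5 LC3 by simp
  next
    case False
    then obtain m where n: "n = Suc m" and m: "m \<ge> 3" using less.prems by (cases n) auto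
    have IH: "LC (2 * k - 1) = prs (LC k) (LC k)" if "3 \<le> k" "k \<le> m" for k
      using less.hyps[of k] that n by simp
    have E: "LC (2 * k) = diag (LC k) (LC (Suc k))" if "3 \<le> k" "k \<le> m" for k
      using LC_even_of_odd[OF that(1) IH[OF that]] .
    note Q = tG.lower_central_normal[of m] LC_subset_tK[OF m]
    have Qs: "commg tG (LC m) = LC (Suc m)" "commg tG (LC (Suc m)) = LC (m + 2)"
      using LC_Suc[of m] LC_Suc[of "Suc m"] m by simp_all
    have LG: "u \<in> GG" if "u \<in> LC k" for u k
      using that tG.normal_mem[OF tG.lower_central_normal] by blast
    have "(\<forall>q \<in> LC m. comm q act_a \<in> LC (m + 2)) \<or> (\<forall>q \<in> LC m. comm q act_c \<in> LC (m + 2))"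
    proof (cases "even m")
      case True
      then obtain k where k: "m = 2 * k" by blast
      then have k2: "k \<ge> 2" "3 \<le> Suc k" "Suc k \<le> m" using m by auto
      have k2m: "m + 2 = 2 * Suc k" using k by simp
      have "comm q act_a \<in> LC (m + 2)" if q: "q \<in> LC m" for q
      proof -
        \<comment> \<open>for \<open>m = 4\<close> the group \<open>K\<close> takes the place of \<open>\<gamma>\<^sub>2\<close>\<close>
        have "\<exists>Q. Q \<lhd> tG \<and> Q \<subseteq> tK \<and> (\<forall>h\<in>Q. h \<odot> h \<in> LC (Suc k)) \<and> LC m = diag Q (LC (Suc k))"
        proof (cases "k = 2")
          case True
          then show ?thesis
            using tK_normal tK_squares LC4 LC3 k by (intro exI[of _ tK]) simp
        next
          case False
          then show ?thesis
            using k2 E[of k] k LC_subset_tK[of k] LC_squares[of k]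
            by (intro exI[of _ "LC k"]) (auto simp: tG.lower_central_normal)
        qed
        then obtain Q where Q: "Q \<lhd> tG" "Q \<subseteq> tK" "\<And>h. h \<in> Q \<Longrightarrow> h \<odot> h \<in> LC (Suc k)"
          "LC m = diag Q (LC (Suc k))" by blast
        obtain g h where p: "q = pair g h" and gh: "g \<in> Q" "h \<in> Q" "g \<odot> h \<in> LC (Suc k)"
          using q Q(4) unfolding diag_def by auto
        have ghG: "g \<in> GG" "h \<in> GG" using gh tG.normal_mem[OF Q(1)] by auto
        note R = tG.normalD[OF tG.lower_central_normal[of "Suc k"]]
        have "g \<odot> \<iota> h = (g \<odot> h) \<odot> \<iota> (h \<odot> h)" using ghG by (simp add: tG.free_reduce)
        then have r: "g \<odot> \<iota> h \<in> LC (Suc k)" using R(5,6) gh Q(3) by simp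
        have s: "h \<odot> \<iota> g = \<iota> (g \<odot> \<iota> h)" using ghG by (simp add: tG.inv_mult_group)
        have "(g \<odot> \<iota> h) \<odot> (h \<odot> \<iota> g) \<in> LC (Suc (Suc k))"
          unfolding s using r LG[OF r] tG.normal_one[OF tG.lower_central_normal]
          by simp
        then have "pair (g \<odot> \<iota> h) (h \<odot> \<iota> g) \<in> LC (m + 2)"
          unfolding k2m E[OF k2(2,3)] diag_def using r s R(6) by auto
        moreover have "pair g h \<in> GG" using gh Q(2) pair_tK by blast
        ultimately show ?thesis by (simp add: p pair_commut_a)
      qed
      then show ?thesis by blast
    next
      case False
      then obtain j where "m = 2 * j + 1" by (auto elim: oddE)
      then obtain k where k: "m = 2 * k - 1" "k \<ge> 2" using m by (intro that[of "Suc j"]) auto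
      have k2: "3 \<le> Suc k" "Suc k \<le> m" "m + 2 = 2 * Suc k - 1" using k m by auto
      have "comm q act_c \<in> LC (m + 2)" if q: "q \<in> LC m" for q
      proof (cases "k = 2")
        case True
        then show ?thesis using commut_c_LC3 q k by simp
      next
        case False
        then have k3: "3 \<le> k" "k \<le> m" using k by auto
        obtain g h where p: "q = pair g h" and gh: "g \<in> LC k" "h \<in> LC k"
          using q IH[OF k3] k unfolding prs_def by auto
        have "pair g h \<in> GG" using gh LC_subset_tK[OF k3(1)] pair_tK by blast
        moreover have "comm h act_d \<in> LC (Suc k)"
          using tG.commut_in_commg[OF gh(2), of act_d] LC_Suc[of k] k by simp
        moreover have "id \<in> LC (Suc k)"
          using tG.normal_one[OF tG.lower_central_normal] by (simp add: tG_one_id)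
        ultimately show ?thesis
          unfolding k2(3) IH[OF k2(1,2)] by (auto simp: p pair_commut_gens prs_def)
      qed
      then show ?thesis by blast
    qed
    then have "commg tG (diag (LC m) (LC (Suc m))) = prs (LC (Suc m)) (LC (Suc m))"
      using commg_diag[OF Q, unfolded Qs] LC_squares[of m] m by simp
    then show ?thesis
      using E[OF m order_refl] LC_Suc[of "2 * m"] m n by simp
  qed
qed

lemma LC_even: "n \<ge> 3 \<Longrightarrow> LC (2 * n) = diag (LC n) (LC (Suc n))"
  using LC_even_of_odd LC_odd by blast

section \<open>Parity characters\<close>

definition lsec :: "(word \<Rightarrow> word) \<Rightarrow> word \<Rightarrow> word" where "lsec g s = tl (g (0 # s))"
definition rsec :: "(word \<Rightarrow> word) \<Rightarrow> word \<Rightarrow> word" where "rsec g s = tl (g (1 # s))"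

lemma sec_pair [simp]: "lsec (pair g h) = g" "rsec (pair g h) = h"
  "lsec (act_a \<circ> pair g h) = g" "rsec (act_a \<circ> pair g h) = h"
  by (auto simp: lsec_def rsec_def fun_eq_iff)

text \<open>The parity of the number of vertices at level \<open>k\<close> below which \<open>g\<close> flips the next
  letter.\<close>

fun par :: "nat \<Rightarrow> (word \<Rightarrow> word) \<Rightarrow> bit" where
  "par 0 g = hd (g [0])"
| "par (Suc k) g = par k (lsec g) + par k (rsec g)"

lemma bit_self_add [simp]: "(e :: bit) + e = 0"
  by (cases e) simp_all

lemma bit_add_eq_0_iff: "(e :: bit) + f = 0 \<longleftrightarrow> e = f"
  by (cases e; cases f) simp_all

lemma par_mult:
  "g \<in> GG \<Longrightarrow> h \<in> GG \<Longrightarrow> par k (g \<odot> h) = par k g + par k h"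
proof (induct k arbitrary: g h)
  case (0 g h)
  from 0(1) have "par 0 (g \<circ> h) = par 0 g + par 0 h"
  proof (cases rule: tG_cases)
    case (pair g0 g1)
    from 0(2) show ?thesis by (cases rule: tG_cases) (simp_all add: pair)
  next
    case (swap g0 g1)
    from 0(2) show ?thesis by (cases rule: tG_cases) (simp_all add: swap)
  qed
  then show ?case using tG_mult_comp[OF 0] by metis
next
  case (Suc k g h)
  have comp: "pair p q \<circ> (act_a \<circ> pair s t) = act_a \<circ> pair (q \<circ> s) (p \<circ> t)"
    "act_a \<circ> (act_a \<circ> pair s t) = pair s t" for p q s t
  proof -
    have "pair p q \<circ> (act_a \<circ> pair s t) = (act_a \<circ> pair q p) \<circ> pair s t"
      by (simp only: act_a_pair[of q p] o_assoc)
    then show "pair p q \<circ> (act_a \<circ> pair s t) = act_a \<circ> pair (q \<circ> s) (p \<circ> t)"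
      by (simp only: o_assoc[symmetric] pair_comp)
    show "act_a \<circ> (act_a \<circ> pair s t) = pair s t"
      by (simp add: o_assoc act_a_involution)
  qed
  have IH: "par k (p \<circ> q) = par k p + par k q" if "p \<in> GG" "q \<in> GG" for p q
    using Suc(1)[OF that] tG_mult_comp[OF that] by metis
  from Suc(2) have "par (Suc k) (g \<circ> h) = par (Suc k) g + par (Suc k) h"
  proof (cases rule: tG_cases)
    case (pair g0 g1)
    from Suc(3) show ?thesis
      by (cases rule: tG_cases) (simp_all only: pair IH comp pair_comp par.simps sec_pair ac_simps)
  next
    case (swap g0 g1)
    from Suc(3) show ?thesis
      by (cases rule: tG_cases)
        (simp_all only: swap IH comp pair_comp o_assoc[symmetric] par.simps sec_pair ac_simps)
  qed
  then show ?case using tG_mult_comp[OF Suc(2,3)] by metis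
qed

declare par.simps [simp del]

lemma par_id [simp]: "par k id = 0"
  using par_mult[of id id k] by simp

lemma par_inv [simp]: "g \<in> GG \<Longrightarrow> par k (\<iota> g) = par k g"
  using par_mult[of g "\<iota> g" k] bit_add_eq_0_iff[of "par k g" "par k (\<iota> g)"] by (simp add: tG_one_id)

lemma par_conj: "g \<in> GG \<Longrightarrow> h \<in> GG \<Longrightarrow> par k (g \<odot> h \<odot> \<iota> g) = par k h"
  by (cases "par k g"; cases "par k h") (simp_all add: par_mult)

lemma par_commut [simp]: "g \<in> GG \<Longrightarrow> h \<in> GG \<Longrightarrow> par k (comm g h) = 0"
  by (cases "par k g"; cases "par k h") (simp_all add: commut_def par_mult)

lemma par_act_Suc:
  "par (Suc k) act_b = par k act_a + par k act_c" "par (Suc k) act_c = par k act_d"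
  "par (Suc k) act_d = par k act_b" "par (Suc k) act_a = 0"
proof -
  have "act_a = act_a \<circ> pair id id" by simp
  then have "lsec act_a = id" "rsec act_a = id" using sec_pair by metis+
  then show "par (Suc k) act_a = 0" by (simp add: par.simps)
  have "lsec act_b = act_a" "rsec act_b = act_c" "lsec act_c = id" "rsec act_c = act_d"
    "lsec act_d = id" "rsec act_d = act_b"
    by (auto simp: lsec_def rsec_def fun_eq_iff)
  then show "par (Suc k) act_b = par k act_a + par k act_c" "par (Suc k) act_c = par k act_d"
    "par (Suc k) act_d = par k act_b"
    by (simp_all add: par.simps)
qed

text \<open>Restricted to \<open>a\<close>, \<open>b\<close>, \<open>d\<close>, \<open>c\<close> the levels 0 to 3 give the
  identity matrix, so these four characters are coordinates on the abelianization.\<close>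

lemma par_gens:
  "par 0 act_a = 1" "par 1 act_a = 0" "par 2 act_a = 0" "par 3 act_a = 0"
  "par 0 act_b = 0" "par 1 act_b = 1" "par 2 act_b = 0" "par 3 act_b = 0"
  "par 0 act_c = 0" "par 1 act_c = 0" "par 2 act_c = 0" "par 3 act_c = 1"
  "par 0 act_d = 0" "par 1 act_d = 0" "par 2 act_d = 1" "par 3 act_d = 0"
  by (simp_all add: eval_nat_numeral par_act_Suc) (simp_all add: par.simps)

definition lpar :: "nat \<Rightarrow> (word \<Rightarrow> word) \<Rightarrow> bit" where "lpar k g = par k (lsec g)"

lemma lpar_pair [simp]: "lpar k (pair g h) = par k g"
  by (simp add: lpar_def)

lemma par_LC2: "u \<in> LC 2 \<Longrightarrow> par k u = 0"
proof -
  have "commg tG GG \<subseteq> {u \<in> GG. par k u = 0}"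
  proof (rule tG.commg_least)
    show "subgroup {u \<in> GG. par k u = 0} tG"
      by (rule tG.subgroupI) (auto simp: par_mult intro: exI[of _ id])
  qed auto
  then show "u \<in> LC 2 \<Longrightarrow> par k u = 0" using LC_Suc[of 1] by (auto simp: numeral_2_eq_2)
qed

lemma LC2_stabilizer: "LC 2 \<subseteq> level_stabilizer"
  unfolding LC2
proof (rule tG.normal_closure_least[OF level_stabilizer_normal])
  show "{x_elt, y_elt, z_elt} \<subseteq> level_stabilizer"
    unfolding level_stabilizer_def using elts_in elt_pairs by blast
qed

lemma LC2_pair:
  assumes "u \<in> LC 2"
  obtains g h where "u = pair g h" "pair g h \<in> GG" "g \<in> GG" "h \<in> GG" "par k g = par k h"
proof -
  obtain g h where u: "u = pair g h" "pair g h \<in> GG"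
    using assms LC2_stabilizer unfolding level_stabilizer_def by blast
  moreover have "par k g = par k h"
    using par_LC2[OF assms, of "Suc k"] unfolding u(1) by (simp only: par.simps sec_pair bit_add_eq_0_iff)
  ultimately show ?thesis using that pair_memD by blast
qed

lemma lpar_mult: "u \<in> level_stabilizer \<Longrightarrow> w \<in> level_stabilizer \<Longrightarrow> lpar k (u \<odot> w) = lpar k u + lpar k w"
proof -
  assume "u \<in> level_stabilizer" "w \<in> level_stabilizer"
  then obtain g h s t where e: "u = pair g h" "pair g h \<in> GG" "w = pair s t" "pair s t \<in> GG"
    unfolding level_stabilizer_def by blast
  then show ?thesis
    using par_mult[of g s] pair_memD[of g h] pair_memD[of s t] by (simp only: pair_mult lpar_pair)
qed

lemma lpar_inv: "u \<in> level_stabilizer \<Longrightarrow> lpar k (\<iota> u) = lpar k u"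
proof -
  assume "u \<in> level_stabilizer"
  then obtain g h where e: "u = pair g h" "pair g h \<in> GG"
    unfolding level_stabilizer_def by blast
  then show ?thesis
    using par_inv[of g] pair_memD[of g h] by (simp add: pair_inv)
qed

text \<open>Elements of \<open>\<gamma>\<^sub>2\<close> have equal parities in both sections, so the parity of the left
  section is invariant under conjugation.\<close>

lemma lpar_kernel_normal: "{u \<in> LC 2. lpar k u = 0} \<lhd> tG"
proof (rule pairs_normalI)
  note N = tG.normalD[OF tG.lower_central_normal[of 2]]
  have st: "u \<in> level_stabilizer" if "u \<in> LC 2" for u using that LC2_stabilizer by blast
  show "subgroup {u \<in> LC 2. lpar k u = 0} tG"
  proof (rule tG.subgroupI)
    have "id \<in> LC 2" using N(7) by (simp only: tG_one_id)
    moreover have "lpar k id = 0" using lpar_pair[of k id id] by simp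
    ultimately show "{u \<in> LC 2. lpar k u = 0} \<noteq> {}" by blast
  qed (use N(2,5,6) st in \<open>auto simp: lpar_mult lpar_inv\<close>)
  show "{u \<in> LC 2. lpar k u = 0} \<subseteq> level_stabilizer" using st by blast
next
  fix g h assume p: "pair g h \<in> {u \<in> LC 2. lpar k u = 0}"
  then have "par k h = 0" by (auto elim: LC2_pair[of _ k])
  moreover have "pair h g \<in> LC 2" using p normal_pair_swap[OF tG.lower_central_normal] by blast
  ultimately show "pair h g \<in> {u \<in> LC 2. lpar k u = 0}" by simp
next
  fix g h s t assume p: "pair g h \<in> {u \<in> LC 2. lpar k u = 0}" and q: "pair s t \<in> GG"
  have pG: "pair g h \<in> GG" using p tG.normal_mem[OF tG.lower_central_normal] by blast
  have "pair s t \<odot> pair g h \<odot> \<iota> (pair s t) = pair (s \<odot> g \<odot> \<iota> s) (t \<odot> h \<odot> \<iota> t)"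
    using pG q by (simp add: pair_mult pair_inv pair_closed pair_inv_closed)
  moreover have "pair s t \<odot> pair g h \<odot> \<iota> (pair s t) \<in> LC 2"
    using tG.normal_conj[OF tG.lower_central_normal q] p by blast
  ultimately show "pair (s \<odot> g \<odot> \<iota> s) (t \<odot> h \<odot> \<iota> t) \<in> {u \<in> LC 2. lpar k u = 0}"
    using p pair_memD[OF pG] pair_memD[OF q] by (simp add: par_conj)
qed

lemma lpar_elts:
  "lpar 0 x_elt = 1" "lpar 1 x_elt = 0" "lpar 2 x_elt = 0"
  "lpar 0 y_elt = 0" "lpar 1 y_elt = 1" "lpar 2 y_elt = 0"
  "lpar 0 z_elt = 0" "lpar 1 z_elt = 0" "lpar 2 z_elt = 1"
  using par_gens by (simp_all add: elt_pairs par_mult)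

lemma xyz_LC2: "x_elt \<in> LC 2" "y_elt \<in> LC 2" "z_elt \<in> LC 2"
  unfolding LC2 by (auto intro!: tG.normal_closure_incl)

lemma lpar_tN1: assumes "u \<in> tN1" shows "lpar k u = 0"
proof -
  have "tN1 \<subseteq> {u \<in> LC 2. lpar k u = 0}"
  proof (rule tN1_least[OF lpar_kernel_normal])
    show "prs tK tK \<subseteq> {u \<in> LC 2. lpar k u = 0}"
      using prs_tK_subset tK_LC2 par_LC2 unfolding prs_def by auto
    have "x2_elt \<in> LC 2" using pair_id_tN1(5) tN1_subset_tK tK_LC2 by blast
    then show "x2_elt \<in> {u \<in> LC 2. lpar k u = 0}"
      using par_LC2[OF xyz_LC2(3)] by (simp add: x2_pair)
  qed
  then show ?thesis using assms by blast
qed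

lemma lpar_tK: assumes "u \<in> tK" shows "lpar 2 u = 0"
proof -
  have "tK \<subseteq> {u \<in> LC 2. lpar 2 u = 0}"
    by (rule tK_least[OF lpar_kernel_normal]) (use xyz_LC2 lpar_elts in auto)
  then show ?thesis using assms by blast
qed

lemma commut_LC: "n \<ge> 1 \<Longrightarrow> u \<in> LC n \<Longrightarrow> g \<in> GG \<Longrightarrow> comm u g \<in> LC (Suc n)"
  using tG.commut_in_commg LC_Suc by blast

lemma normal_absorb: "N \<lhd> tG \<Longrightarrow> generate tG (N \<union> {}) = N"
  using tG.normal_sub tG.generateI[of N N] by auto

text \<open>The characters strip off the generators one after the other.\<close>

lemma par_kernel:
  assumes g: "g \<in> GG" and p: "par 0 g = 0" "par 1 g = 0" "par 2 g = 0" "par 3 g = 0"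
  shows "g \<in> LC 2"
proof -
  note N = tG.normalD[OF tG.lower_central_normal[of 2]]
  have ss: "s \<odot> s \<in> LC 2" if "s \<in> {act_a, act_b, act_c, act_d}" for s
    using that N(7) by (auto simp only: gens_squares tG_one_id insert_iff empty_iff)
  have c: "comm s t \<in> LC 2" if "s \<in> GG" "t \<in> GG" for s t
    using commut_LC[of 1 s t] that by (simp add: numeral_2_eq_2)
  have peel: "h \<in> generate tG (LC 2 \<union> S)"
    if "insert s S \<subseteq> {act_a, act_b, act_c, act_d}" "par k s = 1" "\<And>t. t \<in> S \<Longrightarrow> par k t = 0"
      "h \<in> generate tG (LC 2 \<union> insert s S)" "par k h = 0" for s S k h
  proof (rule tG.kernel_of_character[OF tG.lower_central_normal tG.subgroup_self, where \<chi> = "par k" and s = s])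
    have SG: "insert s S \<subseteq> GG" using that gens_carrier by blast
    then show "insert s (LC 2 \<union> S) \<subseteq> GG" using N(2) by blast
    show "s \<odot> s \<in> LC 2" using ss that by blast
    show "comm s t \<in> LC 2" if "t \<in> GG" for t using c that SG by blast
    show "par k t = 0" if "t \<in> LC 2 \<union> S" for t
      using that par_LC2 \<open>\<And>t. t \<in> S \<Longrightarrow> par k t = 0\<close> by blast
  qed (use that par_mult in auto)
  have "g \<in> generate tG (LC 2 \<union> {act_a, act_b, act_c, act_d})"
    using g generate_tG tG.mono_generate[of "{act_a, act_b, act_c, act_d}"] by blast
  then have "g \<in> generate tG (LC 2 \<union> {act_b, act_c, act_d})"
    by (rule peel[where k = 0 and s = act_a, rotated 3]) (use p(1) par_gens in auto)
  then have "g \<in> generate tG (LC 2 \<union> {act_c, act_d})"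
    by (rule peel[where k = 1 and s = act_b, rotated 3]) (use p(2) par_gens in auto)
  then have "g \<in> generate tG (LC 2 \<union> {act_d})"
    by (rule peel[where k = 3 and s = act_c, rotated 3]) (use p(4) par_gens in auto)
  then have "g \<in> generate tG (LC 2 \<union> {})"
    by (rule peel[where k = 2 and s = act_d, rotated 3]) (use p(3) par_gens in auto)
  then show ?thesis using normal_absorb[OF tG.lower_central_normal] by blast
qed

text \<open>On \<open>\<gamma>\<^sub>2\<close> the characters of the left section are dual to \<open>x\<close>,
  \<open>y\<close>, \<open>z\<close>.\<close>

lemma lpar_kernel:
  assumes g: "g \<in> LC 2" and p: "lpar 0 g = 0" "lpar 1 g = 0" "lpar 2 g = 0"
  shows "g \<in> tN1"
proof -
  note N = tG.normalD[OF tN1_normal]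
  have L: "subgroup (LC 2) tG" using tG.normal_sub[OF tG.lower_central_normal] .
  have sub: "tN1 \<subseteq> LC 2" using tN1_subset_tK tK_LC2 by blast
  have ss: "s \<odot> s \<in> tN1" if "s \<in> LC 2" for s
    using LC_squares[of 2 s] that LC3 by (simp add: numeral_3_eq_3 numeral_2_eq_2)
  have c: "comm s t \<in> tN1" if "s \<in> LC 2" "t \<in> GG" for s t
    using commut_LC[of 2 s t] that LC3 by (simp add: numeral_3_eq_3 numeral_2_eq_2)
  have peel: "h \<in> generate tG (tN1 \<union> S)"
    if "insert s S \<subseteq> {x_elt, y_elt, z_elt}" "lpar k s = 1" "\<And>t. t \<in> S \<Longrightarrow> lpar k t = 0"
      "h \<in> generate tG (tN1 \<union> insert s S)" "lpar k h = 0" for s S k h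
  proof (rule tG.kernel_of_character[OF tN1_normal L, where \<chi> = "lpar k" and s = s])
    show SL: "insert s (tN1 \<union> S) \<subseteq> LC 2" using that sub xyz_LC2 by blast
    show "s \<odot> s \<in> tN1" using ss SL by blast
    show "comm s t \<in> tN1" if "t \<in> LC 2" for t using c that SL subgroup.subset[OF L] by blast
    show "lpar k (p \<odot> q) = lpar k p + lpar k q" if "p \<in> LC 2" "q \<in> LC 2" for p q
      using that lpar_mult LC2_stabilizer by blast
    show "lpar k t = 0" if "t \<in> tN1 \<union> S" for t
      using that lpar_tN1 \<open>\<And>t. t \<in> S \<Longrightarrow> lpar k t = 0\<close> by blast
  qed (use that in auto)
  have "LC 2 \<subseteq> generate tG (tN1 \<union> {x_elt, y_elt, z_elt})"
    unfolding LC2 using c xyz_LC2 by (intro tG.normal_closure_le_generate tN1_normal) auto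
  then have "g \<in> generate tG (tN1 \<union> {x_elt, y_elt, z_elt})" using g by blast
  then have "g \<in> generate tG (tN1 \<union> {y_elt, z_elt})"
    by (rule peel[where k = 0 and s = x_elt, rotated 3]) (use p(1) lpar_elts in auto)
  then have "g \<in> generate tG (tN1 \<union> {z_elt})"
    by (rule peel[where k = 1 and s = y_elt, rotated 3]) (use p(2) lpar_elts in auto)
  then have "g \<in> generate tG (tN1 \<union> {})"
    by (rule peel[where k = 2 and s = z_elt, rotated 3]) (use p(3) lpar_elts in auto)
  then show ?thesis using normal_absorb[OF tN1_normal] by blast
qed

text \<open>The generators \<open>K \<times> K\<close> and \<open>x\<^sup>2 = (z\<^sup>-\<^sup>1, z)\<close> have their
  sections in \<open>\<gamma>\<^sub>2\<close>, where parities are additive and conjugation invariant.\<close>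

lemma tN1_pair:
  assumes "p \<in> tN1"
  obtains s t where "p = pair s t" "pair s t \<in> GG" "s \<in> LC 2" "t \<in> LC 2"
proof -
  let ?H = "{pair s t | s t. pair s t \<in> GG \<and> s \<in> LC 2 \<and> t \<in> LC 2}"
  note L = tG.normalD[OF tG.lower_central_normal[of 2]]
  have idL: "id \<in> LC 2" using L(7) by (simp only: tG_one_id)
  have "subgroup ?H tG"
  proof (rule tG.subgroupI)
    have "pair id id \<in> ?H" using idL by (intro CollectI exI[of _ id] conjI refl) simp_all
    then show "?H \<noteq> {}" by blast
  next
    fix u assume "u \<in> ?H"
    then obtain s t where "u = pair s t" "pair s t \<in> GG" "s \<in> LC 2" "t \<in> LC 2" by blast
    then have "\<iota> u = pair (\<iota> s) (\<iota> t)" "pair (\<iota> s) (\<iota> t) \<in> GG" "\<iota> s \<in> LC 2" "\<iota> t \<in> LC 2"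
      using L(6) pair_inv pair_inv_closed by simp_all
    then show "\<iota> u \<in> ?H" by blast
  next
    fix u w assume "u \<in> ?H" "w \<in> ?H"
    then obtain s t s' t' where "u = pair s t" "pair s t \<in> GG" "s \<in> LC 2" "t \<in> LC 2"
      "w = pair s' t'" "pair s' t' \<in> GG" "s' \<in> LC 2" "t' \<in> LC 2" by blast
    then have "u \<odot> w = pair (s \<odot> s') (t \<odot> t')" "pair (s \<odot> s') (t \<odot> t') \<in> GG"
      "s \<odot> s' \<in> LC 2" "t \<odot> t' \<in> LC 2"
      using L(5) pair_mult pair_closed by simp_all
    then show "u \<odot> w \<in> ?H" by blast
  qed blast
  moreover have "prs tK tK \<subseteq> ?H"
    unfolding prs_def using pair_tK tK_LC2 by blast
  moreover have "x2_elt \<in> ?H"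
  proof -
    have "pair (\<iota> z_elt) z_elt \<in> GG" using elts_in(4) by (simp add: x2_pair)
    then show ?thesis unfolding x2_pair using xyz_LC2(3) L(6) by blast
  qed
  ultimately have "tN1 \<subseteq> ?H"
    unfolding tN1_generate by (intro tG.generate_subgroup_incl) simp_all
  then show ?thesis using assms that by blast
qed

lemma tN1_sections:
  assumes "pair u w \<in> tN1"
  shows "u \<in> LC 2" "w \<in> LC 2"
  using assms by (auto elim: tN1_pair)

lemma tN1_section_mult:
  assumes pq: "p \<in> tN1" "q \<in> tN1"
  shows "lpar k (lsec (p \<odot> q)) = lpar k (lsec p) + lpar k (lsec q)"
    "lpar k (rsec (p \<odot> q)) = lpar k (rsec p) + lpar k (rsec q)"
proof -
  have st: "s \<in> level_stabilizer" if "s \<in> LC 2" for s using that LC2_stabilizer by blast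
  obtain s t s' t' where e: "p = pair s t" "q = pair s' t'" "pair s t \<in> GG" "pair s' t' \<in> GG"
    and m: "s \<in> LC 2" "t \<in> LC 2" "s' \<in> LC 2" "t' \<in> LC 2"
    using pq tN1_pair by metis
  have "lsec (p \<odot> q) = s \<odot> s'" "rsec (p \<odot> q) = t \<odot> t'" using e by (simp_all add: pair_mult)
  then show "lpar k (lsec (p \<odot> q)) = lpar k (lsec p) + lpar k (lsec q)"
    "lpar k (rsec (p \<odot> q)) = lpar k (rsec p) + lpar k (rsec q)"
    using e lpar_mult st m by (simp_all only: sec_pair)
qed

text \<open>The parity at depth 2 of the leftmost grandchild separates \<open>x\<^sup>2\<close> from
  \<open>K \<times> K\<close>.\<close>

lemma tN1_kernel:
  assumes p: "pair u w \<in> tN1" and u: "lpar 2 u = 0"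
  shows "u \<in> tK" "w \<in> tK"
proof -
  have "pair u w \<in> generate tG (prs tK tK \<union> {})"
  proof (rule tG.kernel_of_character[OF prs_tK_normal tG.normal_sub[OF tN1_normal],
        where \<chi> = "\<lambda>p. lpar 2 (lsec p)" and s = x2_elt])
    show "insert x2_elt (prs tK tK \<union> {}) \<subseteq> tN1" using tN1_incl pair_id_tN1(5) by simp
    show "x2_elt \<odot> x2_elt \<in> prs tK tK"
      using tG.normal_one[OF prs_tK_normal] by (simp add: elt_squares tG_one_id)
    fix t assume "t \<in> tN1"
    then show "comm x2_elt t \<in> prs tK tK"
      using commut_x2_prs tG.normal_mem[OF tN1_normal] by blast
  next
    show "lpar 2 (lsec x2_elt) = 1"
      unfolding x2_pair by (simp add: elt_inverses lpar_elts)
    show "lpar 2 (lsec t) = 0" if "t \<in> prs tK tK \<union> {}" for t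
      using that lpar_tK unfolding prs_def by auto
    show "pair u w \<in> generate tG (prs tK tK \<union> {x2_elt})"
      using p tN1_generate by simp
  qed (use u tN1_section_mult(1) in auto)
  then have "pair u w \<in> prs tK tK" using normal_absorb[OF prs_tK_normal] by simp
  then show "u \<in> tK" "w \<in> tK" unfolding prs_def by auto
qed

lemma diag_iff_parities:
  assumes p: "pair s t \<in> tN1"
  shows "pair s t \<in> diag tK tN1 \<longleftrightarrow> lpar 2 s = 0 \<and> lpar 0 s = lpar 0 t \<and> lpar 1 s = lpar 1 t"
proof -
  have stm: "lpar k (s \<odot> t) = 0 \<longleftrightarrow> lpar k s = lpar k t" for k
    unfolding lpar_mult[OF subsetD[OF LC2_stabilizer tN1_sections(1)[OF p]]
        subsetD[OF LC2_stabilizer tN1_sections(2)[OF p]]]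
    by (rule bit_add_eq_0_iff)
  show ?thesis
    unfolding stm[symmetric]
  proof
    assume "pair s t \<in> diag tK tN1"
    then have "s \<in> tK" "s \<odot> t \<in> tN1" unfolding diag_def by auto
    then show "lpar 2 s = 0 \<and> lpar 0 (s \<odot> t) = 0 \<and> lpar 1 (s \<odot> t) = 0"
      using lpar_tK lpar_tN1 by blast
  next
    assume a: "lpar 2 s = 0 \<and> lpar 0 (s \<odot> t) = 0 \<and> lpar 1 (s \<odot> t) = 0"
    then have K: "s \<in> tK" "t \<in> tK" using tN1_kernel[OF p] by auto
    then have "s \<odot> t \<in> tK" using tG.normal_mult[OF tK_normal] by blast
    then have "s \<odot> t \<in> tN1"
      using a lpar_kernel[OF subsetD[OF tK_LC2]] lpar_tK by simp
    then show "pair s t \<in> diag tK tN1" unfolding diag_def using K by blast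
  qed
qed

section \<open>The ranks of the factors\<close>

lemma card_image_eq_kernel:
  assumes "\<And>g h. g \<in> H \<Longrightarrow> h \<in> H \<Longrightarrow> \<phi> g = \<phi> h \<longleftrightarrow> \<psi> g = \<psi> h"
  shows "card (\<phi> ` H) = card (\<psi> ` H)"
proof -
  have mem: "inv_into H \<phi> (\<phi> g) \<in> H" "\<phi> (inv_into H \<phi> (\<phi> g)) = \<phi> g" if "g \<in> H" for g
    using that inv_into_into f_inv_into_f by (metis imageI)+
  have "bij_betw (\<lambda>z. \<psi> (inv_into H \<phi> z)) (\<phi> ` H) (\<psi> ` H)"
  proof (rule bij_betw_imageI)
    show "inj_on (\<lambda>z. \<psi> (inv_into H \<phi> z)) (\<phi> ` H)"
      using mem assms by (auto intro!: inj_onI)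
    have "\<psi> (inv_into H \<phi> (\<phi> g)) = \<psi> g" if "g \<in> H" for g
      using mem[OF that] assms that by blast
    then show "(\<lambda>z. \<psi> (inv_into H \<phi> z)) ` \<phi> ` H = \<psi> ` H" by (force simp: image_image)
  qed
  then show ?thesis by (rule bij_betw_same_card)
qed

context group
begin

lemma r_coset_eq_iff:
  assumes "subgroup N G" "g \<in> carrier G" "h \<in> carrier G"
  shows "N #> g = N #> h \<longleftrightarrow> g \<otimes> inv h \<in> N"
  using subgroup.rcos_module[OF assms(1) group_axioms assms(3,2)] repr_independence[OF _ assms(3,1)]
    rcos_self[OF assms(2,1)] by blast

lemma carrier_section:
  "carrier (G\<lparr>carrier := H\<rparr> Mod N) = (\<lambda>a. N #> a) ` H"
  by (auto simp: FactGroup_def RCOSETS_def r_coset_def)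

lemma card_section:
  assumes "subgroup N G" "H \<subseteq> carrier G"
    and "\<And>g h. g \<in> H \<Longrightarrow> h \<in> H \<Longrightarrow> \<phi> g = \<phi> h \<longleftrightarrow> g \<otimes> inv h \<in> N"
  shows "card (carrier (G\<lparr>carrier := H\<rparr> Mod N)) = card (\<phi> ` H)"
  unfolding carrier_section
  using assms r_coset_eq_iff by (intro card_image_eq_kernel) (meson subsetD)

lemma section_elementary_abelian:
  assumes H: "subgroup H G" and N: "N \<lhd> G" "N \<subseteq> H"
    and c: "\<And>g h. g \<in> H \<Longrightarrow> h \<in> H \<Longrightarrow> commut G g h \<in> N" and sq: "\<And>g. g \<in> H \<Longrightarrow> g \<otimes> g \<in> N"
  shows "comm_group (G\<lparr>carrier := H\<rparr> Mod N)"
    and "\<And>X. X \<in> carrier (G\<lparr>carrier := H\<rparr> Mod N) \<Longrightarrow>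
      X \<otimes>\<^bsub>G\<lparr>carrier := H\<rparr> Mod N\<^esub> X = \<one>\<^bsub>G\<lparr>carrier := H\<rparr> Mod N\<^esub>"
proof -
  let ?Q = "G\<lparr>carrier := H\<rparr> Mod N"
  have HG: "g \<in> H \<Longrightarrow> g \<in> carrier G" for g using subgroup.mem_carrier[OF H] .
  have NH: "N \<lhd> G\<lparr>carrier := H\<rparr>" using normal_restrict_supergroup[OF H N] .
  have mult: "(N #> g) \<otimes>\<^bsub>?Q\<^esub> (N #> h) = N #> (g \<otimes> h)" if "g \<in> H" "h \<in> H" for g h
    using normal.rcos_sum[OF N(1)] HG that by (simp add: FactGroup_def set_mult_def)
  show "comm_group ?Q"
  proof (rule group.group_comm_groupI)
    show "Group.group ?Q" using normal.factorgroup_is_group[OF NH] .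
    fix X Y assume "X \<in> carrier ?Q" "Y \<in> carrier ?Q"
    then obtain g h where e: "X = N #> g" "Y = N #> h" "g \<in> H" "h \<in> H"
      unfolding carrier_section by blast
    have "(g \<otimes> h) \<otimes> inv (h \<otimes> g) = commut G g h" using e HG by (simp add: free_reduce)
    then have "N #> (g \<otimes> h) = N #> (h \<otimes> g)"
      using e HG c r_coset_eq_iff[OF normal_sub[OF N(1)]] by simp
    then show "X \<otimes>\<^bsub>?Q\<^esub> Y = Y \<otimes>\<^bsub>?Q\<^esub> X" using e mult by simp
  qed
  fix X assume "X \<in> carrier ?Q"
  then obtain g where e: "X = N #> g" "g \<in> H" unfolding carrier_section by blast
  have "N #> (g \<otimes> g) = N"
    using e HG sq coset_join2[OF _ normal_sub[OF N(1)]] by simp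
  then show "X \<otimes>\<^bsub>?Q\<^esub> X = \<one>\<^bsub>?Q\<^esub>" using e mult by (simp add: FactGroup_def)
qed

end

definition index :: "(word \<Rightarrow> word) set \<Rightarrow> (word \<Rightarrow> word) set \<Rightarrow> nat" where
  "index H N = card (carrier (tG\<lparr>carrier := H\<rparr> Mod N))"

abbreviation "LC_index n \<equiv> index (LC n) (LC (Suc n))"

lemma LC_rank:
  assumes n: "n \<ge> 1" and i: "LC_index n = 2 ^ k"
  shows "F2_rank (tG\<lparr>carrier := LC n\<rparr> Mod LC (n + 1)) = k"
proof -
  note N = tG.lower_central_normal
  have c: "comm g h \<in> LC (Suc n)" if "g \<in> LC n" "h \<in> LC n" for g h
    using commut_LC[OF n that(1)] tG.normal_mem[OF N that(2)] .
  note Q = tG.section_elementary_abelian[OF tG.normal_sub[OF N] N tG.lower_central_decreasing c LC_squares[OF n]]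
  show ?thesis using F2_rank_eq[OF Q] i by (simp add: index_def)
qed

lemma index_eq:
  assumes "H \<lhd> tG" "N \<lhd> tG" "\<And>g h. g \<in> H \<Longrightarrow> h \<in> H \<Longrightarrow> \<phi> g = \<phi> h \<longleftrightarrow> g \<odot> \<iota> h \<in> N"
  shows "index H N = card (\<phi> ` H)"
  unfolding index_def
  using tG.normal_sub[OF assms(2)] tG.normal_carrier[OF assms(1)] assms(3) by (rule tG.card_section)

text \<open>The isomorphism behind this is \<open>(g, h) \<mapsto> g h\<close>.\<close>

lemma index_prs:
  assumes Q: "Q \<lhd> tG" "Q \<subseteq> tK" and R: "R \<lhd> tG" "R \<subseteq> Q" and QR: "commg tG Q \<subseteq> R"
  shows "index (prs Q Q) (diag Q R) = index Q R"
proof -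
  note L = tG.normalD[OF Q(1)] and N = tG.normalD[OF R(1)]
  have pG: "pair g h \<in> GG" if "g \<in> Q" "h \<in> Q" for g h using that Q pair_tK by blast
  let ?\<phi> = "\<lambda>p. R #>\<^bsub>tG\<^esub> (lsec p \<odot> rsec p)"
  have "index (prs Q Q) (diag Q R) = card (?\<phi> ` prs Q Q)"
  proof (rule index_eq[OF prs_normal[OF Q] diag_normal[OF Q R(1) QR]])
    fix p q assume "p \<in> prs Q Q" "q \<in> prs Q Q"
    then obtain g h k l where e: "p = pair g h" "q = pair k l"
      and m: "g \<in> Q" "h \<in> Q" "k \<in> Q" "l \<in> Q"
      unfolding prs_def by blast
    have mG: "g \<in> GG" "h \<in> GG" "k \<in> GG" "l \<in> GG" using m L(8) by auto
    have c: "comm u w \<in> R" if "u \<in> Q" "w \<in> GG" for u w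
      using tG.commut_in_commg[OF that] QR by blast
    have pq: "p \<odot> \<iota> q = pair (g \<odot> \<iota> k) (h \<odot> \<iota> l)"
      using e m pG by (simp add: pair_mult pair_inv pair_inv_closed)
    \<comment> \<open>the product of the entries of \<open>p q\<^sup>-\<^sup>1\<close> differs from \<open>(g h) (k l)\<^sup>-\<^sup>1\<close> by two commutators\<close>
    let ?w = "(g \<odot> h) \<odot> \<iota> (k \<odot> l)"
    let ?c = "(g \<odot> h) \<odot> comm (\<iota> h) (\<iota> k) \<odot> \<iota> (g \<odot> h)"
    have cs: "?c \<in> R" "comm k l \<in> R"
      using N(3) c L(6) m mG by simp_all
    have wG: "?w \<in> GG" "?c \<in> GG" "comm k l \<in> GG" using mG by auto
    have w: "(g \<odot> \<iota> k) \<odot> (h \<odot> \<iota> l) = ?c \<odot> ?w \<odot> comm k l"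
      using mG by (simp add: tG.free_reduce)
    then have w': "?w = \<iota> ?c \<odot> ((g \<odot> \<iota> k) \<odot> (h \<odot> \<iota> l)) \<odot> \<iota> (comm k l)"
      using wG by (simp add: tG.m_assoc tG.inv_cancel_left)
    have "(g \<odot> \<iota> k) \<odot> (h \<odot> \<iota> l) \<in> R \<longleftrightarrow> ?w \<in> R"
      using w w' cs N(5,6) by metis
    moreover have "?\<phi> p = ?\<phi> q \<longleftrightarrow> ?w \<in> R"
      using tG.r_coset_eq_iff[OF N(1)] mG e by simp
    moreover have "p \<odot> \<iota> q \<in> diag Q R \<longleftrightarrow> (g \<odot> \<iota> k) \<odot> (h \<odot> \<iota> l) \<in> R"
      unfolding pq diag_def using m L(5,6) by auto
    ultimately show "?\<phi> p = ?\<phi> q \<longleftrightarrow> p \<odot> \<iota> q \<in> diag Q R" by blast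
  qed
  also have "?\<phi> ` prs Q Q = carrier (tG\<lparr>carrier := Q\<rparr> Mod R)"
    unfolding tG.carrier_section
  proof (intro subset_antisym subsetI)
    fix X assume "X \<in> ?\<phi> ` prs Q Q"
    then show "X \<in> (\<lambda>a. R #>\<^bsub>tG\<^esub> a) ` Q"
      unfolding prs_def using L(5) by auto
  next
    fix X assume "X \<in> (\<lambda>a. R #>\<^bsub>tG\<^esub> a) ` Q"
    then obtain g where g: "g \<in> Q" "X = R #>\<^bsub>tG\<^esub> g" by blast
    have "id \<in> Q" using L(7) by (simp only: tG_one_id)
    then have "pair g id \<in> prs Q Q" unfolding prs_def using g by blast
    moreover have "X = ?\<phi> (pair g id)" using g L(8) by simp
    ultimately show "X \<in> ?\<phi> ` prs Q Q" by blast
  qed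
  finally show ?thesis by (simp add: index_def)
qed

text \<open>The isomorphism behind this is \<open>(g, h) \<mapsto> g\<close>: modulo \<open>R\<close> the second entry is
  the inverse of the first.\<close>

lemma index_diag:
  assumes Q: "Q \<lhd> tG" "Q \<subseteq> tK" and R: "R \<lhd> tG" "R \<subseteq> Q" and QR: "commg tG Q \<subseteq> R"
  shows "index (diag Q R) (prs R R) = index Q R"
proof -
  note L = tG.normalD[OF Q(1)] and N = tG.normalD[OF R(1)]
  have pG: "pair g h \<in> GG" if "g \<in> Q" "h \<in> Q" for g h using that Q pair_tK by blast
  let ?\<phi> = "\<lambda>p. R #>\<^bsub>tG\<^esub> lsec p"
  have "index (diag Q R) (prs R R) = card (?\<phi> ` diag Q R)"
  proof (rule index_eq[OF diag_normal[OF Q R(1) QR] prs_normal[OF R(1) order_trans[OF R(2) Q(2)]]])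
    fix p q assume "p \<in> diag Q R" "q \<in> diag Q R"
    then obtain g h k l where e: "p = pair g h" "q = pair k l"
      and m: "g \<in> Q" "h \<in> Q" "k \<in> Q" "l \<in> Q" and gh: "g \<odot> h \<in> R" "k \<odot> l \<in> R"
      unfolding diag_def by blast
    have mG: "g \<in> GG" "h \<in> GG" "k \<in> GG" "l \<in> GG" using m L(8) by auto
    have pq: "p \<odot> \<iota> q = pair (g \<odot> \<iota> k) (h \<odot> \<iota> l)"
      using e m pG by (simp add: pair_mult pair_inv pair_inv_closed)
    have "h \<odot> \<iota> l = (\<iota> g \<odot> ((g \<odot> h) \<odot> \<iota> (k \<odot> l)) \<odot> g) \<odot> \<iota> (\<iota> k \<odot> (g \<odot> \<iota> k) \<odot> k)"
      using mG by (simp add: tG.free_reduce)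
    then have "h \<odot> \<iota> l \<in> R" if "g \<odot> \<iota> k \<in> R"
      using that gh mG N(4,5,6) by metis
    moreover have "?\<phi> p = ?\<phi> q \<longleftrightarrow> g \<odot> \<iota> k \<in> R"
      using tG.r_coset_eq_iff[OF N(1)] mG e by simp
    ultimately show "?\<phi> p = ?\<phi> q \<longleftrightarrow> p \<odot> \<iota> q \<in> prs R R"
      unfolding pq prs_def by auto
  qed
  also have "?\<phi> ` diag Q R = carrier (tG\<lparr>carrier := Q\<rparr> Mod R)"
    unfolding tG.carrier_section
  proof (intro subset_antisym subsetI)
    fix X assume "X \<in> ?\<phi> ` diag Q R"
    then show "X \<in> (\<lambda>a. R #>\<^bsub>tG\<^esub> a) ` Q"
      unfolding diag_def by auto
  next
    fix X assume "X \<in> (\<lambda>a. R #>\<^bsub>tG\<^esub> a) ` Q"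
    then obtain g where g: "g \<in> Q" "X = R #>\<^bsub>tG\<^esub> g" by blast
    have "g \<odot> \<iota> g \<in> R" using L(8)[OF g(1)] N(7) by simp
    then have "pair g (\<iota> g) \<in> diag Q R" unfolding diag_def using g L(6) by blast
    moreover have "X = ?\<phi> (pair g (\<iota> g))" using g by simp
    ultimately show "X \<in> ?\<phi> ` diag Q R" by blast
  qed
  finally show ?thesis by (simp add: index_def)
qed

lemma LC_index_double:
  assumes n: "n \<ge> 3"
  shows "LC_index (2 * n - 1) = LC_index n" "LC_index (2 * n) = LC_index n"
proof -
  note Q = tG.lower_central_normal LC_subset_tK[OF n] tG.lower_central_normal
    tG.lower_central_decreasing[of n]
  have c: "commg tG (LC n) \<subseteq> LC (Suc n)" using LC_Suc[of n] n by simp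
  have "Suc (2 * n - 1) = 2 * n" using n by simp
  then show "LC_index (2 * n - 1) = LC_index n"
    using index_prs[OF Q c] LC_odd[OF n] LC_even[OF n] by simp
  show "LC_index (2 * n) = LC_index n"
    using index_diag[OF Q c] LC_odd[of "Suc n"] LC_even[OF n] n by simp
qed

definition bpow :: "(word \<Rightarrow> word) \<Rightarrow> bit \<Rightarrow> word \<Rightarrow> word" where
  "bpow g e = (if e = 1 then g else id)"

lemma bpow_mem: "N \<lhd> tG \<Longrightarrow> g \<in> N \<Longrightarrow> bpow g e \<in> N"
  using tG.normal_one by (auto simp: bpow_def tG_one_id)

lemma par_bpow: "par k (bpow g e) = par k g * e"
  by (cases e) (simp_all add: bpow_def)

lemma lpar_id [simp]: "lpar k id = 0"
  using lpar_pair[of k id id] by simp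

lemma lpar_bpow: "lpar k (bpow g e) = lpar k g * e"
  by (cases e) (simp_all add: bpow_def)

lemma card_bit: "card (UNIV :: bit set) = 2"
proof -
  have U: "(UNIV :: bit set) = {0, 1}"
  proof (rule UNIV_eq_I)
    fix e :: bit show "e \<in> {0, 1}" by (cases e) simp_all
  qed
  show ?thesis unfolding U by simp
qed

lemma LC_index_1: "LC_index 1 = 2 ^ 4"
proof -
  let ?\<phi> = "\<lambda>g. (par 0 g, par 1 g, par 2 g, par 3 g)"
  have "LC_index 1 = card (?\<phi> ` LC 1)"
  proof (rule index_eq[OF tG.lower_central_normal tG.lower_central_normal])
    fix g h assume "g \<in> LC 1" "h \<in> LC 1"
    then have gh: "g \<in> GG" "h \<in> GG" by auto
    have p: "par k (g \<odot> \<iota> h) = 0 \<longleftrightarrow> par k g = par k h" for k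
      unfolding par_mult[OF gh(1) tG.inv_closed[OF gh(2)]] par_inv[OF gh(2)] by (rule bit_add_eq_0_iff)
    have "g \<odot> \<iota> h \<in> LC 2 \<longleftrightarrow> (\<forall>k \<in> {0, 1, 2, 3}. par k (g \<odot> \<iota> h) = 0)"
      using par_kernel[of "g \<odot> \<iota> h"] par_LC2 gh by (auto)
    then show "?\<phi> g = ?\<phi> h \<longleftrightarrow> g \<odot> \<iota> h \<in> LC (Suc 1)"
      unfolding p by (simp add: numeral_2_eq_2)
  qed
  also have "?\<phi> ` LC 1 = UNIV"
  proof (rule UNIV_eq_I[symmetric])
    fix e :: "bit \<times> bit \<times> bit \<times> bit"
    obtain e0 e1 e2 e3 where e: "e = (e0, e1, e2, e3)" by (cases e)
    note m = bpow_mem[OF tG.normal_self]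
    let ?g = "bpow act_a e0 \<odot> (bpow act_b e1 \<odot> (bpow act_d e2 \<odot> bpow act_c e3))"
    have "par k ?g = par k act_a * e0 + (par k act_b * e1 + (par k act_d * e2 + par k act_c * e3))" for k
      by (simp only: par_mult m par_bpow gens_in tG.m_closed)
    then have "?\<phi> ?g = e" using par_gens by (simp add: e)
    moreover have "?g \<in> LC 1" by (simp add: m)
    ultimately show "e \<in> ?\<phi> ` LC 1" by blast
  qed
  finally show ?thesis
    unfolding UNIV_Times_UNIV[symmetric] card_cartesian_product card_bit by simp
qed

lemma lpar_quotient:
  assumes "g \<in> level_stabilizer" "h \<in> level_stabilizer"
  shows "lpar k (g \<odot> \<iota> h) = 0 \<longleftrightarrow> lpar k g = lpar k h"
  unfolding lpar_mult[OF assms(1) tG.normal_m_inv[OF level_stabilizer_normal assms(2)]]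
    lpar_inv[OF assms(2)] by (rule bit_add_eq_0_iff)

lemma LC_index_2: "LC_index 2 = 2 ^ 3"
proof -
  let ?\<phi> = "\<lambda>g. (lpar 0 g, lpar 1 g, lpar 2 g)"
  note L = tG.lower_central_normal[of 2]
  have "LC_index 2 = card (?\<phi> ` LC 2)"
  proof (rule index_eq[OF tG.lower_central_normal tG.lower_central_normal])
    fix g h assume gh: "g \<in> LC 2" "h \<in> LC 2"
    then have p: "lpar k (g \<odot> \<iota> h) = 0 \<longleftrightarrow> lpar k g = lpar k h" for k
      using lpar_quotient LC2_stabilizer by blast
    have "g \<odot> \<iota> h \<in> LC 2" using gh tG.normal_mult[OF L] tG.normal_m_inv[OF L] by blast
    then have "g \<odot> \<iota> h \<in> tN1 \<longleftrightarrow> (\<forall>k \<in> {0, 1, 2}. lpar k (g \<odot> \<iota> h) = 0)"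
      using lpar_kernel[of "g \<odot> \<iota> h"] lpar_tN1 by auto
    then show "?\<phi> g = ?\<phi> h \<longleftrightarrow> g \<odot> \<iota> h \<in> LC (Suc 2)"
      unfolding p using LC3 by simp
  qed
  also have "?\<phi> ` LC 2 = UNIV"
  proof (rule UNIV_eq_I[symmetric])
    fix e :: "bit \<times> bit \<times> bit"
    obtain e0 e1 e2 where e: "e = (e0, e1, e2)" by (cases e)
    note m = bpow_mem[OF L xyz_LC2(1)] bpow_mem[OF L xyz_LC2(2)] bpow_mem[OF L xyz_LC2(3)]
    let ?g = "bpow x_elt e0 \<odot> (bpow y_elt e1 \<odot> bpow z_elt e2)"
    have g: "bpow y_elt e1 \<odot> bpow z_elt e2 \<in> LC 2" using m tG.normal_mult[OF L] by blast
    have "lpar k ?g = lpar k x_elt * e0 + (lpar k y_elt * e1 + lpar k z_elt * e2)" for k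
      using m g LC2_stabilizer
      by (subst lpar_mult, blast, blast, subst lpar_mult, blast, blast) (simp add: lpar_bpow)
    then have "?\<phi> ?g = e" using lpar_elts by (simp add: e)
    moreover have "?g \<in> LC 2" using m g tG.normal_mult[OF L] by blast
    ultimately show "e \<in> ?\<phi> ` LC 2" by blast
  qed
  finally show ?thesis
    unfolding UNIV_Times_UNIV[symmetric] card_cartesian_product card_bit by simp
qed

lemma LC_index_3: "LC_index 3 = 2 ^ 3"
proof -
  let ?\<phi> = "\<lambda>p. (lpar 0 (lsec p) + lpar 0 (rsec p), lpar 1 (lsec p) + lpar 1 (rsec p), lpar 2 (lsec p))"
  note N = tN1_normal
  have "LC_index 3 = card (?\<phi> ` LC 3)"
  proof (rule index_eq[OF tG.lower_central_normal tG.lower_central_normal])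
    fix p q assume "p \<in> LC 3" "q \<in> LC 3"
    then have pq: "p \<in> tN1" "q \<in> tN1" using LC3 by auto
    then have r: "p \<odot> \<iota> q \<in> tN1" using tG.normal_mult[OF N] tG.normal_m_inv[OF N] by blast
    then obtain s t where st: "p \<odot> \<iota> q = pair s t" using tN1_pair by metis
    have pe: "(p \<odot> \<iota> q) \<odot> q = p" using pq tG.normal_mem[OF N] by (simp add: tG.m_assoc)
    have p: "lpar k (lsec p) = lpar k s + lpar k (lsec q)" "lpar k (rsec p) = lpar k t + lpar k (rsec q)" for k
      using tN1_section_mult[OF r pq(2), of k] unfolding pe unfolding st sec_pair .
    have bits: "(e + e') + (f + f') = e' + f' \<longleftrightarrow> e = f" "e + e' = e' \<longleftrightarrow> e = 0" for e e' f f' :: bit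
      by (cases e; cases e'; cases f; cases f'; simp)+
    have "?\<phi> p = ?\<phi> q \<longleftrightarrow> lpar 2 s = 0 \<and> lpar 0 s = lpar 0 t \<and> lpar 1 s = lpar 1 t"
      unfolding p prod.inject bits by blast
    also have "\<dots> \<longleftrightarrow> pair s t \<in> diag tK tN1" using diag_iff_parities r st by metis
    finally show "?\<phi> p = ?\<phi> q \<longleftrightarrow> p \<odot> \<iota> q \<in> LC (Suc 3)"
      unfolding st using LC4 by simp
  qed
  also have "?\<phi> ` LC 3 = UNIV"
  proof (rule UNIV_eq_I[symmetric])
    fix e :: "bit \<times> bit \<times> bit"
    obtain e0 e1 e2 where e: "e = (e0, e1, e2)" by (cases e)
    note m = bpow_mem[OF N pair_id_tN1(1)] bpow_mem[OF N pair_id_tN1(2)] bpow_mem[OF N pair_id_tN1(5)]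
    let ?g = "bpow (pair id x_elt) e0 \<odot> (bpow (pair id y_elt) e1 \<odot> bpow x2_elt e2)"
    have g: "bpow (pair id y_elt) e1 \<odot> bpow x2_elt e2 \<in> tN1" using m tG.normal_mult[OF N] by blast
    have ls: "lsec id = id" "rsec id = id" using sec_pair[of id id] by simp_all
    have b: "lpar k (lsec (bpow g e)) = lpar k (lsec g) * e" "lpar k (rsec (bpow g e)) = lpar k (rsec g) * e"
      for g e k by (cases e; simp add: bpow_def ls)+
    have x2: "lsec x2_elt = z_elt" "rsec x2_elt = z_elt"
      by (simp_all add: x2_pair elt_inverses)
    have "?\<phi> ?g = e"
      unfolding tN1_section_mult[OF m(1) g] tN1_section_mult[OF m(2,3)] b x2 sec_pair using lpar_elts by (simp add: e)
    moreover have "?g \<in> LC 3" using m g tG.normal_mult[OF N] LC3 by blast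
    ultimately show "e \<in> ?\<phi> ` LC 3" by blast
  qed
  finally show ?thesis
    unfolding UNIV_Times_UNIV[symmetric] card_cartesian_product card_bit by simp
qed

lemma LC_index_4: "LC_index 4 = 2 ^ 2"
proof -
  let ?\<phi> = "\<lambda>p. (lpar 0 p, lpar 1 p)"
  note K = tG.normalD[OF tK_normal]
  have KL: "g \<in> level_stabilizer" if "g \<in> tK" for g using that tK_stabilizer by blast
  have KN: "g \<in> tN1 \<longleftrightarrow> lpar 0 g = 0 \<and> lpar 1 g = 0" if "g \<in> tK" for g
    using lpar_tN1[of g] lpar_kernel[OF subsetD[OF tK_LC2 that]] lpar_tK[OF that] by blast
  have "LC_index 4 = index tK tN1"
    using index_diag[OF tK_normal order_refl tN1_normal tN1_subset_tK] commg_tK LC4 LC5 by simp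
  also have "\<dots> = card (?\<phi> ` tK)"
  proof (rule index_eq[OF tK_normal tN1_normal])
    fix g h assume gh: "g \<in> tK" "h \<in> tK"
    then show "?\<phi> g = ?\<phi> h \<longleftrightarrow> g \<odot> \<iota> h \<in> tN1"
      using KN[of "g \<odot> \<iota> h"] K(5,6) lpar_quotient[OF KL KL, of g h] by simp
  qed
  also have "?\<phi> ` tK = UNIV"
  proof (rule UNIV_eq_I[symmetric])
    fix e :: "bit \<times> bit"
    obtain e0 e1 where e: "e = (e0, e1)" by (cases e)
    note m = bpow_mem[OF tK_normal xy_in_tK(1)] bpow_mem[OF tK_normal xy_in_tK(2)]
    let ?g = "bpow x_elt e0 \<odot> bpow y_elt e1"
    have g: "?g \<in> tK" using m K(5) by blast
    have "lpar k ?g = lpar k x_elt * e0 + lpar k y_elt * e1" for k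
      unfolding lpar_mult[OF KL[OF m(1)] KL[OF m(2)]] lpar_bpow ..
    then have eq: "e = ?\<phi> ?g" using lpar_elts by (simp add: e)
    show "e \<in> ?\<phi> ` tK" using eq g by (rule image_eqI[where f = ?\<phi>])
  qed
  finally show ?thesis
    unfolding UNIV_Times_UNIV[symmetric] card_cartesian_product card_bit by simp
qed

text \<open>The index \<open>n = 2\<^sup>m + 1 + r\<close> of a layer goes to \<open>2n - 1\<close> and
  \<open>2n\<close> for \<open>2r\<close> and \<open>2r + 1\<close> in the next layer.\<close>

lemma LC_index_layers:
  assumes "m \<ge> 1" "r < 2 ^ m"
  shows "LC_index (2 ^ m + 1 + r) = (if r < 2 ^ (m - 1) then 2 ^ 3 else 2 ^ 2)"
  using assms
proof (induct m arbitrary: r rule: dec_induct)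
  case base
  then have "r = 0 \<or> r = 1" by auto
  then show ?case using LC_index_3 LC_index_4 by (auto simp: eval_nat_numeral)
next
  case (step m)
  define s where "s = r div 2"
  have s: "s < 2 ^ m" "s < 2 ^ (m - 1) \<longleftrightarrow> r < 2 ^ m"
    using step.prems step.hyps unfolding s_def
    by (simp_all add: less_mult_imp_div_less div_less_iff_less_mult flip: power_Suc2)
  define n where "n = 2 ^ m + 1 + s"
  have "(2::nat) ^ 1 \<le> 2 ^ m" using step.hyps by (intro power_increasing) auto
  then have n: "n \<ge> 3" unfolding n_def by simp
  have "2 ^ Suc m + 1 + r = 2 * n - 1 \<or> 2 ^ Suc m + 1 + r = 2 * n"
    unfolding n_def s_def by (cases "even r") (auto elim!: evenE oddE)
  then have "LC_index (2 ^ Suc m + 1 + r) = LC_index n"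
    using LC_index_double[OF n] by auto
  then show ?case using step.hyps(3)[OF s(1)] s(2) unfolding n_def by simp
qed

section \<open>The modules as spaces of functions on words\<close>

definition odd_support :: "(nat \<Rightarrow>\<^sub>0 nat) \<Rightarrow> nat set" where
  "odd_support e = {i. odd (Poly_Mapping.lookup e i)}"

text \<open>The coefficient of the squarefree monomial \<open>\<Prod>i\<in>S. X\<^sub>i\<close> after all exponents are
  reduced modulo 2. These functionals separate the points of the quotient ring.\<close>

definition pcoef :: "F2_mpoly \<Rightarrow> nat set \<Rightarrow> bit" where
  "pcoef p S = (\<Sum>e | e \<in> Poly_Mapping.keys p \<and> odd_support e = S. Poly_Mapping.lookup p e)"

lemma pcoef_superset:
  assumes "finite A" "Poly_Mapping.keys p \<subseteq> A"
  shows "pcoef p S = (\<Sum>e\<in>A. if odd_support e = S then Poly_Mapping.lookup p e else 0)"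
proof -
  have "pcoef p S = (\<Sum>e\<in>Poly_Mapping.keys p. if odd_support e = S then Poly_Mapping.lookup p e else 0)"
    unfolding pcoef_def by (simp add: sum.inter_filter[symmetric])
  also have "\<dots> = (\<Sum>e\<in>A. if odd_support e = S then Poly_Mapping.lookup p e else 0)"
    using assms by (intro sum.mono_neutral_left) (auto simp: in_keys_iff)
  finally show ?thesis .
qed

lemma pcoef_add: "pcoef (p + q) S = pcoef p S + pcoef q S"
proof -
  let ?A = "Poly_Mapping.keys p \<union> Poly_Mapping.keys q"
  have "pcoef (p + q) S = (\<Sum>e\<in>?A. if odd_support e = S then Poly_Mapping.lookup (p + q) e else 0)"
    by (rule pcoef_superset) (auto dest: subsetD[OF keys_add])
  also have "\<dots> = (\<Sum>e\<in>?A. (if odd_support e = S then Poly_Mapping.lookup p e else 0) +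
      (if odd_support e = S then Poly_Mapping.lookup q e else 0))"
    by (intro sum.cong) (simp_all add: lookup_add)
  also have "\<dots> = pcoef p S + pcoef q S"
    unfolding sum.distrib by (simp add: pcoef_superset[of ?A])
  finally show ?thesis .
qed

lemma pcoef_single: "pcoef (Poly_Mapping.single e c) S = (if odd_support e = S then c else 0)"
  using pcoef_superset[of "{e}" "Poly_Mapping.single e c" S] by auto

lemma pcoef_0 [simp]: "pcoef 0 S = 0"
  by (simp add: pcoef_def)

lemma mpoly_minus: "p - q = p + (q :: F2_mpoly)" "- q = q"
  by (rule poly_mapping_eqI; simp add: lookup_add lookup_minus)+

lemma mpoly_double: "p + p = (0 :: F2_mpoly)"
  using diff_self[of p] unfolding mpoly_minus .

lemma mpoly_sum_monomials:
  "p = (\<Sum>e\<in>Poly_Mapping.keys p. Poly_Mapping.single e (Poly_Mapping.lookup p e))"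
  by (rule poly_mapping_eqI)
    (simp add: lookup_sum lookup_single when_def sum.delta not_in_keys_iff_lookup_eq_zero)

lemma mpoly_induct [case_names zero monomial add]:
  fixes p :: F2_mpoly
  assumes "P 0" "\<And>e c. e \<in> Poly_Mapping.keys p \<Longrightarrow> P (Poly_Mapping.single e c)"
    "\<And>q r. P q \<Longrightarrow> P r \<Longrightarrow> P (q + r)"
  shows "P p"
proof -
  have "P (\<Sum>e\<in>A. Poly_Mapping.single e (Poly_Mapping.lookup p e))"
    if "finite A" "A \<subseteq> Poly_Mapping.keys p" for A
    using that by (induct A rule: finite_induct) (auto intro: assms)
  from this[OF finite_keys subset_refl] show ?thesis using mpoly_sum_monomials[of p] by simp
qed

lemma odd_support_add: "odd_support (e + f) = (odd_support e - odd_support f) \<union> (odd_support f - odd_support e)"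
  by (auto simp: odd_support_def lookup_add)

text \<open>Multiplication by a monomial translates by its odd support: the quotient is the group algebra of the
  subsets of the variables under symmetric difference.\<close>

lemma pcoef_single_mult:
  "pcoef (Poly_Mapping.single e c * p) S = c * pcoef p ((S - odd_support e) \<union> (odd_support e - S))"
proof (induct p rule: mpoly_induct)
  case (monomial f d)
  have "odd_support (e + f) = S \<longleftrightarrow> odd_support f = (S - odd_support e) \<union> (odd_support e - S)"
    unfolding odd_support_add by blast
  then show ?case by (simp add: mult_single pcoef_single)
qed (simp_all add: distrib_left pcoef_add)

lemma pcoef_X_mult: "pcoef (X i * p) S = pcoef p ((S - {i}) \<union> ({i} - S))"
proof -
  have "odd_support (Poly_Mapping.single i 1) = {i}"
    by (auto simp: odd_support_def lookup_single when_def)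
  then show ?thesis unfolding X_def pcoef_single_mult by simp
qed

lemma pcoef_1: "pcoef 1 S = (if S = {} then 1 else 0)"
proof -
  have "odd_support 0 = {}" by (simp add: odd_support_def)
  then show ?thesis using pcoef_single[of 0 1 S] by auto
qed

lemma pcoef_prod_X:
  "finite A \<Longrightarrow> pcoef (\<Prod>i\<in>A. if Q i then X i else 1) S = (if S = {i \<in> A. Q i} then 1 else 0)"
proof (induct A arbitrary: S rule: finite_induct)
  case empty
  then show ?case by (simp add: pcoef_1)
next
  case (insert j A)
  show ?case
  proof (cases "Q j")
    case True
    have "(S - {j}) \<union> ({j} - S) = {i \<in> A. Q i} \<longleftrightarrow> S = {i \<in> insert j A. Q i}"
      using insert(2) True by blast
    then show ?thesis using insert True by (simp add: pcoef_X_mult)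
  next
    case False
    then have "{i \<in> insert j A. Q i} = {i \<in> A. Q i}" by auto
    then show ?thesis using insert False by simp
  qed
qed

lemma pcoef_prod_binomials:
  assumes "\<And>i. b i \<in> {0, 1 :: nat}"
  shows "finite A \<Longrightarrow>
    pcoef (\<Prod>i\<in>A. (1 - X i) ^ b i) S = (if S \<subseteq> {i \<in> A. b i = 1} then 1 else 0)"
proof (induct A arbitrary: S rule: finite_induct)
  case empty
  then show ?case by (simp add: pcoef_1)
next
  case (insert j A)
  let ?P = "\<Prod>i\<in>A. (1 - X i) ^ b i"
  show ?case
  proof (cases "b j = 1")
    case True
    have "pcoef ((1 - X j) * ?P) S = pcoef ?P S + pcoef ?P ((S - {j}) \<union> ({j} - S))"
      unfolding mpoly_minus distrib_right pcoef_add pcoef_X_mult by simp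
    also have "\<dots> = (if S \<subseteq> {i \<in> A. b i = 1} then 1 else 0) +
        (if (S - {j}) \<union> ({j} - S) \<subseteq> {i \<in> A. b i = 1} then 1 else 0)"
      by (simp only: insert(3))
    also have "\<dots> = (if S \<subseteq> {i \<in> insert j A. b i = 1} then 1 else 0)"
    proof (cases "j \<in> S")
      case j: True
      have "\<not> S \<subseteq> {i \<in> A. b i = 1}" using j insert(2) by blast
      moreover have "(S - {j}) \<union> ({j} - S) \<subseteq> {i \<in> A. b i = 1} \<longleftrightarrow> S \<subseteq> {i \<in> insert j A. b i = 1}"
        using j True insert(2) by blast
      ultimately show ?thesis by simp
    next
      case j: False
      have "\<not> (S - {j}) \<union> ({j} - S) \<subseteq> {i \<in> A. b i = 1}" using j insert(2) by blast
      moreover have "S \<subseteq> {i \<in> A. b i = 1} \<longleftrightarrow> S \<subseteq> {i \<in> insert j A. b i = 1}"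
        using j by blast
      ultimately show ?thesis by simp
    qed
    finally show ?thesis using insert True by simp
  next
    case False
    then have "b j = 0" using assms[of j] by auto
    moreover have "{i \<in> insert j A. b i = 1} = {i \<in> A. b i = 1}" using False by auto
    ultimately show ?thesis using insert by simp
  qed
qed

lemma poly_ring_carrier:
  "p \<in> carrier (poly_ring n) \<longleftrightarrow> (\<forall>e \<in> Poly_Mapping.keys p. Poly_Mapping.keys e \<subseteq> {1..n})"
  by (simp add: poly_ring_def)

lemma poly_ring_simps [simp]:
  "p \<otimes>\<^bsub>poly_ring n\<^esub> q = p * q" "p \<oplus>\<^bsub>poly_ring n\<^esub> q = p + q"
  "\<one>\<^bsub>poly_ring n\<^esub> = 1" "\<zero>\<^bsub>poly_ring n\<^esub> = 0"
  by (simp_all add: poly_ring_def)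

lemma poly_ring_closed:
  assumes "p \<in> carrier (poly_ring n)" "q \<in> carrier (poly_ring n)"
  shows "p + q \<in> carrier (poly_ring n)" "p * q \<in> carrier (poly_ring n)"
proof -
  show "p + q \<in> carrier (poly_ring n)"
    using assms keys_add[of p q] unfolding poly_ring_carrier by blast
  show "p * q \<in> carrier (poly_ring n)"
    unfolding poly_ring_carrier
  proof
    fix e assume "e \<in> Poly_Mapping.keys (p * q)"
    then obtain f g where "e = f + g" "f \<in> Poly_Mapping.keys p" "g \<in> Poly_Mapping.keys q"
      using keys_mult[of p q] by blast
    then show "Poly_Mapping.keys e \<subseteq> {1..n}"
      using assms keys_add[of f g] unfolding poly_ring_carrier by blast
  qed
qed

lemma zero_in: "0 \<in> carrier (poly_ring n)"
  and one_in: "1 \<in> carrier (poly_ring n)"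
  and X_in: "i \<in> {1..n} \<Longrightarrow> X i \<in> carrier (poly_ring n)"
  by (simp_all add: poly_ring_carrier X_def)

lemma cring_poly_ring: "cring (poly_ring n)"
proof (rule cringI)
  show "abelian_group (poly_ring n)"
  proof (rule abelian_groupI)
    fix p assume "p \<in> carrier (poly_ring n)"
    then show "\<exists>q\<in>carrier (poly_ring n). q \<oplus>\<^bsub>poly_ring n\<^esub> p = \<zero>\<^bsub>poly_ring n\<^esub>"
      using mpoly_minus(1)[of p p] by (intro bexI[of _ p]) simp_all
  qed (simp_all add: poly_ring_closed(1) zero_in add.assoc add.commute)
  show "comm_monoid (poly_ring n)"
    by (rule comm_monoidI) (simp_all add: poly_ring_closed(2) one_in mult.assoc mult.commute)
qed (simp add: distrib_right)

lemma prod_in: "(\<And>i. i \<in> A \<Longrightarrow> f i \<in> carrier (poly_ring n)) \<Longrightarrow> prod f A \<in> carrier (poly_ring n)"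
proof (induct A rule: infinite_finite_induct)
  case (insert x A)
  then show ?case using poly_ring_closed(2)[of "f x" n "prod f A"] by simp
qed (simp_all add: one_in)

lemma sum_in: "(\<And>i. i \<in> A \<Longrightarrow> f i \<in> carrier (poly_ring n)) \<Longrightarrow> sum f A \<in> carrier (poly_ring n)"
proof (induct A rule: infinite_finite_induct)
  case (insert x A)
  then show ?case using poly_ring_closed(1)[of "f x" n "sum f A"] by simp
qed (simp_all add: zero_in)

lemma power_in: "p \<in> carrier (poly_ring n) \<Longrightarrow> p ^ k \<in> carrier (poly_ring n)"
  using prod_in[of "{..<k}" "\<lambda>_. p"] by simp

lemma V_gens_in: "(\<lambda>i. (X i)\<^sup>2 - 1) ` {1..n} \<subseteq> carrier (poly_ring n)"
proof -
  have "(X i)\<^sup>2 - 1 \<in> carrier (poly_ring n)" if "i \<in> {1..n}" for i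
    unfolding mpoly_minus by (intro poly_ring_closed power_in X_in that one_in)
  then show ?thesis by blast
qed

lemma V_ideal: "ideal (V_ideal n) (poly_ring n)"
  unfolding V_ideal_def
  using ring.genideal_ideal[OF cring.axioms(1)[OF cring_poly_ring] V_gens_in] .

lemma V_ideal_closed:
  shows "p \<in> V_ideal n \<Longrightarrow> q \<in> V_ideal n \<Longrightarrow> p + q \<in> V_ideal n"
    and "p \<in> V_ideal n \<Longrightarrow> q \<in> carrier (poly_ring n) \<Longrightarrow> q * p \<in> V_ideal n"
    and "0 \<in> V_ideal n"
  using ideal.I_l_closed[OF V_ideal, of p n q] additive_subgroup.a_closed[OF ideal.axioms(1)[OF V_ideal], of p n q]
    additive_subgroup.zero_closed[OF ideal.axioms(1)[OF V_ideal], of n] by simp_all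

text \<open>The common kernel of the functionals is an ideal, and it contains the generators of the defining ideal.\<close>

lemma V_ideal_pcoef: "p \<in> V_ideal n \<Longrightarrow> pcoef p S = 0"
proof -
  interpret cring "poly_ring n" by (rule cring_poly_ring)
  let ?J = "{p \<in> carrier (poly_ring n). \<forall>S. pcoef p S = 0}"
  have mult: "pcoef (q * p) S = 0" if "\<And>S. pcoef p S = 0" for p q S
  proof (induct q rule: mpoly_induct)
    case (monomial e c)
    then show ?case using that by (simp add: pcoef_single_mult)
  qed (simp_all add: distrib_right pcoef_add)
  have "ideal ?J (poly_ring n)"
  proof (rule idealI[OF ring_axioms])
    show "subgroup ?J (add_monoid (poly_ring n))"
    proof (rule add.subgroupI)
      have "0 \<in> ?J" by (simp add: zero_in)
      then show "?J \<noteq> {}" by blast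
      fix p assume p: "p \<in> ?J"
      have "\<ominus>\<^bsub>poly_ring n\<^esub> p = p"
        using p mpoly_minus(1)[of p p] by (intro minus_equality) auto
      then show "\<ominus>\<^bsub>poly_ring n\<^esub> p \<in> ?J" using p by simp
    next
      fix p q assume "p \<in> ?J" "q \<in> ?J"
      then show "p \<oplus>\<^bsub>poly_ring n\<^esub> q \<in> ?J"
        using poly_ring_closed(1)[of p n q] by (simp add: pcoef_add)
    qed auto
    fix p q assume "p \<in> ?J" "q \<in> carrier (poly_ring n)"
    then show "q \<otimes>\<^bsub>poly_ring n\<^esub> p \<in> ?J" "p \<otimes>\<^bsub>poly_ring n\<^esub> q \<in> ?J"
      using poly_ring_closed(2)[of q n p] mult[of p q] by (simp_all add: mult.commute)
  qed
  moreover have "(\<lambda>i. (X i)\<^sup>2 - 1) ` {1..n} \<subseteq> ?J"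
  proof -
    have "pcoef ((X i)\<^sup>2 - 1) S = 0" for i S
    proof -
      have "pcoef (X i * (X i * 1)) S = pcoef 1 S"
        unfolding pcoef_X_mult by (rule arg_cong[of _ _ "pcoef 1"]) blast
      then show ?thesis unfolding mpoly_minus pcoef_add by (simp add: power2_eq_square)
    qed
    then show ?thesis using V_gens_in by blast
  qed
  ultimately have "V_ideal n \<subseteq> ?J" unfolding V_ideal_def by (rule genideal_minimal)
  then show "p \<in> V_ideal n \<Longrightarrow> pcoef p S = 0" by blast
qed

definition reduce :: "(nat \<Rightarrow>\<^sub>0 nat) \<Rightarrow> nat \<Rightarrow>\<^sub>0 nat" where
  "reduce e = Poly_Mapping.map (\<lambda>k. k mod 2) e"

lemma lookup_reduce: "Poly_Mapping.lookup (reduce e) i = Poly_Mapping.lookup e i mod 2"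
  by (simp add: reduce_def Poly_Mapping.map.rep_eq when_def)

lemma reduce_eq_iff: "reduce e = reduce f \<longleftrightarrow> odd_support e = odd_support f"
proof
  assume "reduce e = reduce f"
  then have "Poly_Mapping.lookup e i mod 2 = Poly_Mapping.lookup f i mod 2" for i
    by (metis lookup_reduce)
  then show "odd_support e = odd_support f" by (auto simp: odd_support_def odd_iff_mod_2_eq_one)
next
  assume "odd_support e = odd_support f"
  then show "reduce e = reduce f"
    by (intro poly_mapping_eqI) (auto simp: lookup_reduce odd_support_def set_eq_iff parity_cases mod2_eq_if)
qed

text \<open>Induction on the degree: dividing by \<open>X\<^sub>i\<^sup>2\<close> changes a monomial by a multiple of
  \<open>X\<^sub>i\<^sup>2 - 1\<close>. Over \<open>\<F>\<^sub>2\<close> the sum of two elements is their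
  difference.\<close>

lemma monomial_reduce:
  "Poly_Mapping.keys e \<subseteq> {1..n} \<Longrightarrow>
    Poly_Mapping.single e c + Poly_Mapping.single (reduce e) c \<in> V_ideal n"
proof (induct "\<Sum>i\<in>{1..n}. Poly_Mapping.lookup e i" arbitrary: e rule: less_induct)
  case (less e)
  show ?case
  proof (cases "\<forall>i. Poly_Mapping.lookup e i < 2")
    case True
    then have "reduce e = e" by (intro poly_mapping_eqI) (simp add: lookup_reduce)
    then show ?thesis by (simp only: mpoly_double V_ideal_closed(3))
  next
    case False
    then obtain i where i: "Poly_Mapping.lookup e i \<ge> 2" by (auto simp: not_less)
    then have "i \<in> Poly_Mapping.keys e" by (simp add: in_keys_iff)
    then have iN: "i \<in> {1..n}" using less.prems by blast
    define f where "f = e - Poly_Mapping.single i 2"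
    have ef: "e = f + Poly_Mapping.single i 2"
      using i by (intro poly_mapping_eqI) (auto simp: f_def lookup_add lookup_minus lookup_single when_def)
    have lf: "Poly_Mapping.lookup f j \<le> Poly_Mapping.lookup e j" for j by (simp add: ef lookup_add)
    then have "Poly_Mapping.keys f \<subseteq> Poly_Mapping.keys e" by (auto simp: in_keys_iff) (meson less_le_trans)
    then have f: "Poly_Mapping.keys f \<subseteq> {1..n}" using less.prems by blast
    have "reduce f = reduce e"
      by (auto simp: reduce_eq_iff ef odd_support_def lookup_add lookup_single when_def)
    moreover have "(\<Sum>i\<in>{1..n}. Poly_Mapping.lookup f i) < (\<Sum>i\<in>{1..n}. Poly_Mapping.lookup e i)"
      using lf iN by (intro sum_strict_mono_ex1) (auto simp: ef lookup_add intro!: bexI[of _ i])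
    ultimately have IH: "Poly_Mapping.single f c + Poly_Mapping.single (reduce e) c \<in> V_ideal n"
      using less.hyps[OF _ f] by simp
    have "(X i)\<^sup>2 - 1 \<in> V_ideal n"
      unfolding V_ideal_def using ring.genideal_self[OF cring.axioms(1)[OF cring_poly_ring] V_gens_in] iN
      by blast
    then have "Poly_Mapping.single f c * ((X i)\<^sup>2 - 1) \<in> V_ideal n"
      using f by (intro V_ideal_closed(2)) (auto simp: poly_ring_carrier)
    moreover have "(X i)\<^sup>2 = Poly_Mapping.single (Poly_Mapping.single i 2) 1"
      by (simp add: X_def power2_eq_square mult_single numeral_2_eq_2 flip: single_add)
    ultimately have "Poly_Mapping.single e c + Poly_Mapping.single f c \<in> V_ideal n"
      by (simp only: mpoly_minus distrib_left mult_single ef mult_1_right)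
    from V_ideal_closed(1)[OF this IH]
    have "Poly_Mapping.single e c + (Poly_Mapping.single f c + Poly_Mapping.single f c) +
        Poly_Mapping.single (reduce e) c \<in> V_ideal n" by (simp only: add.assoc)
    then show ?thesis by (simp only: mpoly_double add_0_right)
  qed
qed

text \<open>Modulo the relations every exponent matters only through its parity, so the quotient has the
  squarefree monomials as a basis.\<close>

lemma V_ideal_iff:
  assumes p: "p \<in> carrier (poly_ring n)"
  shows "p \<in> V_ideal n \<longleftrightarrow> (\<forall>S. pcoef p S = 0)"
proof
  assume z: "\<forall>S. pcoef p S = 0"
  let ?q = "\<Sum>e\<in>Poly_Mapping.keys p. Poly_Mapping.single (reduce e) (Poly_Mapping.lookup p e)"
  have "(\<Sum>e\<in>A. Poly_Mapping.single e (Poly_Mapping.lookup p e) +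
      Poly_Mapping.single (reduce e) (Poly_Mapping.lookup p e)) \<in> V_ideal n"
    if "finite A" "A \<subseteq> Poly_Mapping.keys p" for A
    using that
  proof (induct A rule: finite_induct)
    case (insert e A)
    then have "Poly_Mapping.keys e \<subseteq> {1..n}" using p by (auto simp: poly_ring_carrier)
    then show ?case using insert by (simp add: V_ideal_closed(1) monomial_reduce)
  qed (simp add: V_ideal_closed)
  from this[OF finite_keys subset_refl] have "p + ?q \<in> V_ideal n"
    unfolding sum.distrib using mpoly_sum_monomials[of p] by simp
  moreover have "?q = 0"
  proof (rule poly_mapping_eqI)
    fix f
    have l: "Poly_Mapping.lookup ?q f = (\<Sum>e\<in>Poly_Mapping.keys p. if reduce e = f then Poly_Mapping.lookup p e else 0)"
      by (simp add: lookup_sum lookup_single when_def)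
    show "Poly_Mapping.lookup ?q f = Poly_Mapping.lookup 0 f"
    proof (cases "\<exists>e0. reduce e0 = f")
      case True
      then obtain e0 where e0: "f = reduce e0" by blast
      have "Poly_Mapping.lookup ?q f = pcoef p (odd_support e0)"
        unfolding l unfolding e0 reduce_eq_iff by (rule pcoef_superset[symmetric]) auto
      then show ?thesis using z by simp
    next
      case False
      then show ?thesis unfolding l by (simp add: sum.neutral)
    qed
  qed
  ultimately show "p \<in> V_ideal n" by simp
qed (simp add: V_ideal_pcoef)

lemma V_class_eq_iff:
  assumes "p \<in> carrier (poly_ring n)" "q \<in> carrier (poly_ring n)"
  shows "V_class n p = V_class n q \<longleftrightarrow> (\<forall>S. pcoef p S = pcoef q S)"
proof -
  interpret cring "poly_ring n" by (rule cring_poly_ring)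
  have "\<ominus>\<^bsub>poly_ring n\<^esub> q = q"
    using assms mpoly_minus(1)[of q q] by (intro minus_equality) auto
  then have "p \<ominus>\<^bsub>poly_ring n\<^esub> q = p + q" by (simp add: a_minus_def)
  then have "V_class n p = V_class n q \<longleftrightarrow> p + q \<in> V_ideal n"
    using quotient_eq_iff_same_a_r_cos[OF V_ideal assms] by (simp add: V_class_def)
  also have "\<dots> \<longleftrightarrow> (\<forall>S. pcoef p S = pcoef q S)"
    using V_ideal_iff[OF poly_ring_closed(1)[OF assms]] by (simp only: pcoef_add bit_add_eq_0_iff)
  finally show ?thesis .
qed

lemma V_structure:
  shows "carrier (V n) = V_class n ` carrier (poly_ring n)"
    and "\<lbrakk>p \<in> carrier (poly_ring n); q \<in> carrier (poly_ring n)\<rbrakk> \<Longrightarrow>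
      V_class n p \<oplus>\<^bsub>V n\<^esub> V_class n q = V_class n (p + q)"
    and "\<zero>\<^bsub>V n\<^esub> = V_class n 0" and "abelian_group (V n)"
proof -
  interpret ideal "V_ideal n" "poly_ring n" by (rule V_ideal)
  interpret h: ring_hom_ring "poly_ring n" "V n" "V_class n"
    using rcos_ring_hom_ring unfolding V_def V_class_def .
  show "carrier (V n) = V_class n ` carrier (poly_ring n)"
    by (auto simp: V_def V_class_def FactRing_def A_RCOSETS_def' a_r_coset_def')
  show "p \<in> carrier (poly_ring n) \<Longrightarrow> q \<in> carrier (poly_ring n) \<Longrightarrow>
      V_class n p \<oplus>\<^bsub>V n\<^esub> V_class n q = V_class n (p + q)"
    using h.hom_add[of p q] by simp
  show "\<zero>\<^bsub>V n\<^esub> = V_class n 0" using h.hom_zero by simp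
  show "abelian_group (V n)" by (rule h.S.abelian_group_axioms)
qed

text \<open>Without this, sums of elements of \<open>\<F>\<^sub>2\<close> are rewritten to exclusive disjunctions, on which
  the laws of addition no longer apply.\<close>

declare add_bit_eq_xor [simp del] mult_bit_eq_and [simp del]

text \<open>The set of variables of the monomial that belongs to a word.\<close>

definition wset :: "word \<Rightarrow> nat set" where
  "wset \<sigma> = {i \<in> {1..length \<sigma>}. \<sigma> ! (i - 1) = 1}"

abbreviation words :: "nat \<Rightarrow> word set" where
  "words n \<equiv> {\<sigma>. length \<sigma> = n}"

lemma finite_words: "finite (words n)"
proof (rule finite_subset)
  show "finite {\<sigma>. set \<sigma> \<subseteq> {0, 1 :: bit} \<and> length \<sigma> = n}" by (rule finite_lists_length_eq) simp
  have "u \<in> {0, 1}" for u :: bit by (cases u) simp_all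
  then show "words n \<subseteq> {\<sigma>. set \<sigma> \<subseteq> {0, 1 :: bit} \<and> length \<sigma> = n}" by blast
qed

lemma wset_inject: "length \<sigma> = length \<tau> \<Longrightarrow> wset \<sigma> = wset \<tau> \<longleftrightarrow> \<sigma> = \<tau>"
proof
  assume l: "length \<sigma> = length \<tau>" and w: "wset \<sigma> = wset \<tau>"
  show "\<sigma> = \<tau>"
  proof (rule nth_equalityI[OF l])
    fix i assume "i < length \<sigma>"
    then have "\<sigma> ! i = 1 \<longleftrightarrow> \<tau> ! i = 1"
      using w l unfolding wset_def set_eq_iff by (auto dest!: spec[of _ "Suc i"])
    then show "\<sigma> ! i = \<tau> ! i" by (cases "\<sigma> ! i"; cases "\<tau> ! i") simp_all
  qed
qed simp

lemma wset_surj: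
  assumes "S \<subseteq> {1..n}"
  obtains \<sigma> where "length \<sigma> = n" "wset \<sigma> = S"
proof
  let ?\<sigma> = "map (\<lambda>i. if Suc i \<in> S then 1 else 0 :: bit) [0..<n]"
  show "length ?\<sigma> = n" by simp
  have "?\<sigma> ! (i - 1) = (if i \<in> S then 1 else 0)" if "i \<in> {1..n}" for i using that by auto
  then show "wset ?\<sigma> = S" unfolding wset_def using assms by (auto split: if_splits)
qed

definition sqfree :: "word \<Rightarrow> F2_mpoly" where
  "sqfree \<sigma> = (\<Prod>i = 1..length \<sigma>. if \<sigma> ! (i - 1) = 1 then X i else 1)"

lemma sqfree_in: "length \<sigma> = n \<Longrightarrow> sqfree \<sigma> \<in> carrier (poly_ring n)"
  unfolding sqfree_def by (rule prod_in) (simp add: X_in one_in)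

lemma pcoef_sqfree: "pcoef (sqfree \<sigma>) S = (if S = wset \<sigma> then 1 else 0)"
  unfolding sqfree_def wset_def by (rule pcoef_prod_X) simp

definition pol :: "nat \<Rightarrow> (word \<Rightarrow> bit) \<Rightarrow> F2_mpoly" where
  "pol n f = (\<Sum>\<sigma>\<in>words n. if f \<sigma> = 1 then sqfree \<sigma> else 0)"

lemma pol_in: "pol n f \<in> carrier (poly_ring n)"
  unfolding pol_def by (rule sum_in) (simp add: sqfree_in zero_in)

lemma pcoef_sum: "pcoef (\<Sum>x\<in>A. p x) S = (\<Sum>x\<in>A. pcoef (p x) S)"
  by (induct A rule: infinite_finite_induct) (simp_all add: pcoef_add)

lemma pcoef_pol:
  assumes "\<tau> \<in> words n"
  shows "pcoef (pol n f) (wset \<tau>) = f \<tau>"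
proof -
  have "pcoef (pol n f) (wset \<tau>) = (\<Sum>\<sigma>\<in>words n. if \<sigma> = \<tau> then f \<sigma> else 0)"
    unfolding pol_def pcoef_sum
  proof (rule sum.cong)
    fix \<sigma> assume "\<sigma> \<in> words n"
    then have "wset \<tau> = wset \<sigma> \<longleftrightarrow> \<sigma> = \<tau>" using assms wset_inject[of \<tau> \<sigma>] by auto
    then show "pcoef (if f \<sigma> = 1 then sqfree \<sigma> else 0) (wset \<tau>) = (if \<sigma> = \<tau> then f \<sigma> else 0)"
      by (cases "f \<sigma>") (auto simp: pcoef_sqfree)
  qed simp
  then show ?thesis using finite_words assms by simp
qed

lemma pcoef_outside:
  assumes "p \<in> carrier (poly_ring n)" "\<not> S \<subseteq> {1..n}"
  shows "pcoef p S = 0"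
proof -
  have "odd_support e \<noteq> S" if "e \<in> Poly_Mapping.keys p" for e
  proof -
    have "odd_support e \<subseteq> Poly_Mapping.keys e" by (auto simp: odd_support_def in_keys_iff intro!: odd_pos)
    then show ?thesis using that assms unfolding poly_ring_carrier by blast
  qed
  then show ?thesis unfolding pcoef_def by (intro sum.neutral) auto
qed

text \<open>The element of \<open>V\<^sub>n\<close> with coefficient \<open>f \<sigma>\<close> at the monomial of
  \<open>\<sigma>\<close>.\<close>

definition VF :: "nat \<Rightarrow> (word \<Rightarrow> bit) \<Rightarrow> F2_mpoly set" where
  "VF n f = V_class n (pol n f)"

lemma VF_eqI:
  assumes p: "p \<in> carrier (poly_ring n)" and f: "\<And>\<sigma>. \<sigma> \<in> words n \<Longrightarrow> pcoef p (wset \<sigma>) = f \<sigma>"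
  shows "V_class n p = VF n f"
  unfolding VF_def V_class_eq_iff[OF p pol_in]
proof
  fix S show "pcoef p S = pcoef (pol n f) S"
  proof (cases "S \<subseteq> {1..n}")
    case True
    then obtain \<sigma> where "length \<sigma> = n" "wset \<sigma> = S" by (rule wset_surj)
    then show ?thesis using f[of \<sigma>] pcoef_pol[of \<sigma> n f] by simp
  next
    case False
    then show ?thesis using pcoef_outside[OF p] pcoef_outside[OF pol_in] by simp
  qed
qed

lemma VF_eq_iff: "VF n f = VF n g \<longleftrightarrow> (\<forall>\<sigma>\<in>words n. f \<sigma> = g \<sigma>)"
proof
  assume "VF n f = VF n g"
  then have "pcoef (pol n f) S = pcoef (pol n g) S" for S
    unfolding VF_def V_class_eq_iff[OF pol_in pol_in] by blast
  then show "\<forall>\<sigma>\<in>words n. f \<sigma> = g \<sigma>" using pcoef_pol by metis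
next
  assume "\<forall>\<sigma>\<in>words n. f \<sigma> = g \<sigma>"
  then show "VF n f = VF n g"
    using VF_eqI[OF pol_in, of n f g] pcoef_pol[of _ n f] unfolding VF_def by auto
qed

lemma VF_carrier: "carrier (V n) = range (VF n)"
proof
  show "carrier (V n) \<subseteq> range (VF n)"
    unfolding V_structure(1) using VF_eqI[of _ n "\<lambda>\<sigma>. pcoef _ (wset \<sigma>)"] by auto
  show "range (VF n) \<subseteq> carrier (V n)" unfolding V_structure(1) VF_def using pol_in by auto
qed

lemma VF_add: "VF n f \<oplus>\<^bsub>V n\<^esub> VF n g = VF n (\<lambda>\<sigma>. f \<sigma> + g \<sigma>)"
proof -
  have "VF n f \<oplus>\<^bsub>V n\<^esub> VF n g = V_class n (pol n f + pol n g)"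
    unfolding VF_def by (rule V_structure(2)[OF pol_in pol_in])
  also have "\<dots> = VF n (\<lambda>\<sigma>. f \<sigma> + g \<sigma>)"
    by (rule VF_eqI[OF poly_ring_closed(1)[OF pol_in pol_in]]) (simp only: pcoef_add pcoef_pol)
  finally show ?thesis .
qed

lemma VF_zero: "\<zero>\<^bsub>V n\<^esub> = VF n (\<lambda>_. 0)"
  unfolding V_structure(3) by (rule VF_eqI) (simp_all add: zero_in)

lemma VF_monom:
  assumes "length \<sigma> = n"
  shows "V_monom \<sigma> = VF n (\<lambda>\<tau>. if \<tau> = \<sigma> then 1 else 0)"
proof -
  have "V_class n (sqfree \<sigma>) = VF n (\<lambda>\<tau>. if \<tau> = \<sigma> then 1 else 0)"
  proof (rule VF_eqI[OF sqfree_in[OF assms]])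
    fix \<tau> assume "\<tau> \<in> words n"
    then show "pcoef (sqfree \<sigma>) (wset \<tau>) = (if \<tau> = \<sigma> then 1 else 0)"
      using wset_inject[of \<tau> \<sigma>] assms by (simp add: pcoef_sqfree)
  qed
  then show ?thesis using assms by (simp add: V_monom_def sqfree_def)
qed

text \<open>The coefficients of \<open>(1 - X\<^sub>1)\<^sup>r\<^sup>1 \<cdots> (1 - X\<^sub>n)\<^sup>r\<^sup>n\<close>
  over \<open>\<F>\<^sub>2\<close>.\<close>

fun wv :: "nat \<Rightarrow> word \<Rightarrow> bit" where
  "wv r [] = 1"
| "wv r (u # \<sigma>) = (if u = 1 \<and> even r then 0 else wv (r div 2) \<sigma>)"

lemma wv_eq: "wv r \<sigma> = (if \<forall>i<length \<sigma>. \<sigma> ! i = 1 \<longrightarrow> odd (r div 2 ^ i) then 1 else 0)"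
proof (induct \<sigma> arbitrary: r)
  case (Cons u \<sigma>)
  have "(\<forall>i<length (u # \<sigma>). (u # \<sigma>) ! i = 1 \<longrightarrow> odd (r div 2 ^ i)) \<longleftrightarrow>
      (u = 1 \<longrightarrow> odd r) \<and> (\<forall>i<length \<sigma>. \<sigma> ! i = 1 \<longrightarrow> odd (r div 2 div 2 ^ i))"
    by (simp add: All_less_Suc2 div_mult2_eq)
  then show ?case using Cons[of "r div 2"] by auto
qed simp

lemma v_VF: "v n r = VF n (wv r)"
proof -
  let ?p = "\<Prod>i = 1..n. (1 - X i) ^ (r div 2 ^ (i - 1) mod 2)"
  have "V_class n ?p = VF n (wv r)"
  proof (rule VF_eqI)
    show "?p \<in> carrier (poly_ring n)"
      unfolding mpoly_minus by (intro prod_in power_in poly_ring_closed(1) one_in X_in)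
    fix \<sigma> assume \<sigma>: "\<sigma> \<in> words n"
    have "r div 2 ^ (i - 1) mod 2 \<in> {0, 1}" for i by auto
    then have "pcoef ?p (wset \<sigma>) = (if wset \<sigma> \<subseteq> {i \<in> {1..n}. r div 2 ^ (i - 1) mod 2 = 1} then 1 else 0)"
      by (rule pcoef_prod_binomials) simp
    moreover have "wset \<sigma> \<subseteq> {i \<in> {1..n}. r div 2 ^ (i - 1) mod 2 = 1} \<longleftrightarrow>
        (\<forall>i<length \<sigma>. \<sigma> ! i = 1 \<longrightarrow> odd (r div 2 ^ i))" (is "?L \<longleftrightarrow> ?R")
    proof
      assume ?L
      show ?R
      proof (intro allI impI)
        fix i assume "i < length \<sigma>" "\<sigma> ! i = 1"
        then have "Suc i \<in> wset \<sigma>" by (simp add: wset_def)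
        then show "odd (r div 2 ^ i)" using \<open>?L\<close> by (auto simp: odd_iff_mod_2_eq_one)
      qed
    next
      assume ?R
      show ?L
      proof
        fix i assume "i \<in> wset \<sigma>"
        then show "i \<in> {i \<in> {1..n}. r div 2 ^ (i - 1) mod 2 = 1}"
          using \<open>?R\<close>[rule_format, of "i - 1"] \<sigma> by (auto simp: wset_def odd_iff_mod_2_eq_one)
      qed
    qed
    ultimately show "pcoef ?p (wset \<sigma>) = wv r \<sigma>" unfolding wv_eq by simp
  qed
  then show ?thesis by (simp add: v_def)
qed

text \<open>The subspace \<open>V\<^sub>n\<^sup>r\<close> by recursion on the first letter: splitting off
  \<open>X\<^sub>1\<close>, the space \<open>V\<^sub>n\<^sub>+\<^sub>1\<^sup>2\<^sup>s\<close> is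
  \<open>V\<^sub>n\<^sup>s \<oplus> V\<^sub>n\<^sup>s\<close>, and
  \<open>V\<^sub>n\<^sub>+\<^sub>1\<^sup>2\<^sup>s\<^sup>+\<^sup>1\<close> consists of the pairs in it whose sum lies in
  \<open>V\<^sub>n\<^sup>s\<^sup>+\<^sup>1\<close>.\<close>

fun inS :: "nat \<Rightarrow> nat \<Rightarrow> (word \<Rightarrow> bit) \<Rightarrow> bool" where
  "inS 0 r f \<longleftrightarrow> r = 0 \<or> f [] = 0"
| "inS (Suc n) r f \<longleftrightarrow> inS n (r div 2) (\<lambda>\<sigma>. f (0 # \<sigma>)) \<and> inS n (r div 2) (\<lambda>\<sigma>. f (1 # \<sigma>)) \<and>
    (odd r \<longrightarrow> inS n (Suc (r div 2)) (\<lambda>\<sigma>. f (0 # \<sigma>) + f (1 # \<sigma>)))"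

lemma inS_cong: "(\<And>\<sigma>. length \<sigma> = n \<Longrightarrow> f \<sigma> = g \<sigma>) \<Longrightarrow> inS n r f \<longleftrightarrow> inS n r g"
proof (induct n arbitrary: r f g)
  case (Suc n)
  have "inS n k (\<lambda>\<sigma>. f (0 # \<sigma>)) \<longleftrightarrow> inS n k (\<lambda>\<sigma>. g (0 # \<sigma>))"
    "inS n k (\<lambda>\<sigma>. f (1 # \<sigma>)) \<longleftrightarrow> inS n k (\<lambda>\<sigma>. g (1 # \<sigma>))"
    "inS n k (\<lambda>\<sigma>. f (0 # \<sigma>) + f (1 # \<sigma>)) \<longleftrightarrow> inS n k (\<lambda>\<sigma>. g (0 # \<sigma>) + g (1 # \<sigma>))" for k
    by (rule Suc(1); simp add: Suc(2))+
  then show ?case by simp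
qed simp

lemma inS_0: "inS n r (\<lambda>_. 0)"
  by (induct n arbitrary: r) simp_all

lemma inS_all: "inS n 0 f"
  by (induct n arbitrary: f) simp_all

lemma inS_add: "inS n r f \<Longrightarrow> inS n r g \<Longrightarrow> inS n r (\<lambda>\<sigma>. f \<sigma> + g \<sigma>)"
proof (induct n arbitrary: r f g)
  case (Suc n)
  have 1: "inS n (r div 2) (\<lambda>\<sigma>. f (0 # \<sigma>) + g (0 # \<sigma>))" "inS n (r div 2) (\<lambda>\<sigma>. f (1 # \<sigma>) + g (1 # \<sigma>))"
    using Suc by simp_all
  have 2: "inS n (Suc (r div 2)) (\<lambda>\<sigma>. (f (0 # \<sigma>) + f (1 # \<sigma>)) + (g (0 # \<sigma>) + g (1 # \<sigma>)))" if "odd r"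
    using Suc that by simp
  have 3: "(a + b) + (c + d) = (a + c) + (b + d)" for a b c d :: bit by (simp only: ac_simps)
  show ?case
    unfolding inS.simps using 1 2 unfolding 3[of "f (0 # _)" "f (1 # _)"] by blast
qed auto

lemma inS_decreasing: "inS n (Suc r) f \<Longrightarrow> inS n r f"
proof (induct n arbitrary: r f)
  case (Suc n)
  show ?case
  proof (cases "even r")
    case True
    then have "Suc r div 2 = r div 2" by simp
    then show ?thesis using Suc.prems True by simp
  next
    case False
    then have e: "Suc r div 2 = Suc (r div 2)" by (auto elim: oddE)
    then have f: "inS n (Suc (r div 2)) (\<lambda>\<sigma>. f (0 # \<sigma>))" "inS n (Suc (r div 2)) (\<lambda>\<sigma>. f (1 # \<sigma>))"
      using Suc.prems by auto
    then show ?thesis using Suc.hyps[OF f(1)] Suc.hyps[OF f(2)] inS_add[OF f] False by simp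
  qed
qed auto

lemma inS_antimono: "r \<le> s \<Longrightarrow> inS n s f \<Longrightarrow> inS n r f"
  by (induct s rule: dec_induct) (auto intro: inS_decreasing)

lemma inS_top: "2 ^ n \<le> r \<Longrightarrow> inS n r f \<longleftrightarrow> (\<forall>\<sigma>\<in>words n. f \<sigma> = 0)"
proof (induct n arbitrary: r f)
  case 0
  then show ?case by auto
next
  case (Suc n)
  then have r: "2 ^ n \<le> r div 2" "2 ^ n \<le> Suc (r div 2)" by auto
  have "(\<forall>\<sigma>\<in>words (Suc n). f \<sigma> = 0) \<longleftrightarrow> (\<forall>\<sigma>\<in>words n. f (0 # \<sigma>) = 0) \<and> (\<forall>\<sigma>\<in>words n. f (1 # \<sigma>) = 0)"
  proof (intro iffI conjI ballI)
    fix \<sigma> assume a: "(\<forall>\<sigma>\<in>words n. f (0 # \<sigma>) = 0) \<and> (\<forall>\<sigma>\<in>words n. f (1 # \<sigma>) = 0)" and "\<sigma> \<in> words (Suc n)"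
    then obtain u \<tau> where e: "\<sigma> = u # \<tau>" "\<tau> \<in> words n" by (cases \<sigma>) auto
    then show "f \<sigma> = 0" using a by (cases u) auto
  qed auto
  then show ?case using Suc(1)[OF r(1)] Suc(1)[OF r(2)] by auto
qed

lemma inS_wv: "r < 2 ^ n \<Longrightarrow> inS n r (wv r)"
proof (induct n arbitrary: r)
  case (Suc n)
  then have IH: "inS n (r div 2) (wv (r div 2))" by auto
  show ?case
  proof (cases "even r")
    case True
    then have "(\<lambda>\<sigma>. wv r (0 # \<sigma>)) = wv (r div 2)" "(\<lambda>\<sigma>. wv r (1 # \<sigma>)) = (\<lambda>_. 0)" by auto
    then show ?thesis using IH inS_0 True by simp
  next
    case False
    then have "(\<lambda>\<sigma>. wv r (0 # \<sigma>)) = wv (r div 2)" "(\<lambda>\<sigma>. wv r (1 # \<sigma>)) = wv (r div 2)" by auto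
    then show ?thesis using IH inS_0 False by simp
  qed
qed simp

text \<open>Each subspace has codimension at most 1 in the preceding one.\<close>

lemma inS_step:
  "r < 2 ^ n \<Longrightarrow> inS n r f \<Longrightarrow> inS n (Suc r) f \<or> inS n (Suc r) (\<lambda>\<sigma>. f \<sigma> + wv r \<sigma>)"
proof (induct n arbitrary: r f)
  case (Suc n)
  let ?s = "r div 2"
  let ?f0 = "\<lambda>\<sigma>. f (0 # \<sigma>)" and ?f1 = "\<lambda>\<sigma>. f (1 # \<sigma>)"
  have s: "?s < 2 ^ n" using Suc.prems by auto
  have f: "inS n ?s ?f0" "inS n ?s ?f1" using Suc.prems by simp_all
  have w: "inS n ?s (wv ?s)" using s by (rule inS_wv)
  show ?case
  proof (cases "even r")
    case True
    have e: "Suc r div 2 = ?s" "odd (Suc r)" using True by simp_all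
    have g: "inS n ?s (\<lambda>\<sigma>. f (0 # \<sigma>) + wv ?s \<sigma>)" using inS_add[OF f(1) w] .
    have c: "(a + b) + c = (a + c) + b" for a b c :: bit by (simp only: ac_simps)
    show ?thesis
      using Suc.hyps[OF s inS_add[OF f]]
    proof
      assume "inS n (Suc ?s) (\<lambda>\<sigma>. f (0 # \<sigma>) + f (1 # \<sigma>))"
      then show ?thesis using f e by simp
    next
      assume "inS n (Suc ?s) (\<lambda>\<sigma>. f (0 # \<sigma>) + f (1 # \<sigma>) + wv ?s \<sigma>)"
      then have "inS n (Suc ?s) (\<lambda>\<sigma>. f (0 # \<sigma>) + wv ?s \<sigma> + f (1 # \<sigma>))"
        unfolding c[of "f (0 # _)" "f (1 # _)"] .
      then show ?thesis using f g e True by simp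
    qed
  next
    case False
    have e: "Suc r div 2 = Suc ?s" "even (Suc r)" using False by (auto elim: oddE)
    have d: "inS n (Suc ?s) (\<lambda>\<sigma>. f (0 # \<sigma>) + f (1 # \<sigma>))" using Suc.prems False by simp
    have c1: "a + (a + b) = b" "(a + c) + (a + b) = b + c" for a b c :: bit
      by (cases a; cases b; cases c; simp)+
    show ?thesis
      using Suc.hyps[OF s f(1)]
    proof
      assume a: "inS n (Suc ?s) ?f0"
      from inS_add[OF a d] have "inS n (Suc ?s) ?f1" by (simp only: c1)
      then show ?thesis using a e by simp
    next
      assume a: "inS n (Suc ?s) (\<lambda>\<sigma>. f (0 # \<sigma>) + wv ?s \<sigma>)"
      from inS_add[OF a d] have "inS n (Suc ?s) (\<lambda>\<sigma>. f (1 # \<sigma>) + wv ?s \<sigma>)" by (simp only: c1)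
      then show ?thesis using a e False by simp
    qed
  qed
qed auto

text \<open>If \<open>f\<close> lies in the space of index \<open>r\<close>, then \<open>f\<close> or
  \<open>f + v\<^sub>n\<^sup>r\<close> lies in the one of index \<open>r + 1\<close>, which is generated by the later
  vectors; at \<open>r = 2\<^sup>n\<close> nothing is left.\<close>

lemma VF_in_V_sub: "VF n f \<in> V_sub n r \<longleftrightarrow> inS n r f"
proof
  interpret abelian_group "V n" by (rule V_structure(4))
  have gens: "v n ` {r..<2 ^ n} \<subseteq> carrier (add_monoid (V n))" for r
    using VF_carrier v_VF by auto
  {
    let ?S = "{VF n f | f. inS n r f}"
    have "subgroup ?S (add_monoid (V n))"
    proof (rule add.subgroupI)
      show "?S \<subseteq> carrier (V n)" using VF_carrier by auto
      show "?S \<noteq> {}" using inS_0 by blast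
    next
      fix u assume "u \<in> ?S"
      then obtain f where f: "u = VF n f" "inS n r f" by blast
      have "\<ominus>\<^bsub>V n\<^esub> u = u"
        using VF_carrier f by (intro minus_equality) (auto simp: VF_add VF_zero)
      then show "\<ominus>\<^bsub>V n\<^esub> u \<in> ?S" using f by auto
    next
      fix u w assume "u \<in> ?S" "w \<in> ?S"
      then obtain f g where "u = VF n f" "inS n r f" "w = VF n g" "inS n r g" by blast
      then show "u \<oplus>\<^bsub>V n\<^esub> w \<in> ?S" using inS_add VF_add by blast
    qed
    moreover have "v n ` {r..<2 ^ n} \<subseteq> ?S"
      using v_VF inS_antimono[OF _ inS_wv] by auto
    ultimately have "V_sub n r \<subseteq> ?S"
      unfolding V_sub_def by (rule add.generate_subgroup_incl[rotated])
    moreover assume "VF n f \<in> V_sub n r"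
    ultimately obtain g where "VF n f = VF n g" "inS n r g" by blast
    then show "inS n r f" using inS_cong[of n f g r] unfolding VF_eq_iff by simp
  }
  have mono: "V_sub n (Suc r) \<subseteq> V_sub n r" for r
    unfolding V_sub_def by (rule add.mono_generate) auto
  show "inS n r f \<Longrightarrow> VF n f \<in> V_sub n r"
  proof (induct "2 ^ n - r" arbitrary: r f)
    case 0
    then have "VF n f = \<zero>\<^bsub>V n\<^esub>" using inS_top[of n r f] by (simp add: VF_zero VF_eq_iff)
    then show ?case unfolding V_sub_def using generate.one[of "add_monoid (V n)"] by simp
  next
    case (Suc k)
    then have r: "r < 2 ^ n" "k = 2 ^ n - Suc r" by auto
    show ?case
      using inS_step[OF r(1) Suc.prems]
    proof
      assume "inS n (Suc r) f"
      then show ?thesis using Suc.hyps(1)[OF r(2)] mono by blast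
    next
      assume "inS n (Suc r) (\<lambda>\<sigma>. f \<sigma> + wv r \<sigma>)"
      then have 1: "VF n (\<lambda>\<sigma>. f \<sigma> + wv r \<sigma>) \<in> V_sub n r" using Suc.hyps(1)[OF r(2)] mono by blast
      have 2: "VF n (wv r) \<in> V_sub n r"
        unfolding V_sub_def using r(1) v_VF by (intro generate.incl) auto
      have "VF n (\<lambda>\<sigma>. f \<sigma> + wv r \<sigma>) \<oplus>\<^bsub>V n\<^esub> VF n (wv r) \<in> V_sub n r"
        using generate.eng[of _ "add_monoid (V n)"] 1 2 unfolding V_sub_def by force
      moreover have "(a + b) + b = a" for a b :: bit by (cases a; cases b) simp_all
      ultimately show ?thesis by (simp only: VF_add)
    qed
  qed
qed

section \<open>Coordinates on the layers\<close>

fun sec :: "word \<Rightarrow> (word \<Rightarrow> word) \<Rightarrow> word \<Rightarrow> word" where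
  "sec [] g = g"
| "sec (u # \<sigma>) g = sec \<sigma> (if u = 0 then lsec g else rsec g)"

lemma sec_append: "sec (\<sigma> @ \<tau>) g = sec \<tau> (sec \<sigma> g)"
  by (induct \<sigma> arbitrary: g) simp_all

lemma sec_id [simp]: "sec \<sigma> id = id"
proof (induct \<sigma>)
  case (Cons u \<sigma>)
  have "lsec id = id" "rsec id = id" using sec_pair[of id id] by simp_all
  then show ?case using Cons by (metis sec.simps(2))
qed simp

lemma branch_0: "branch 0 q = q []"
  by (auto simp: branch_def)

lemma branch_Suc: "branch (Suc m) q = pair (branch m (\<lambda>\<sigma>. q (0 # \<sigma>))) (branch m (\<lambda>\<sigma>. q (1 # \<sigma>)))"
  by (rule word_ext) (simp_all add: branch_def)

lemma branch_id: "branch m (\<lambda>_. id) = id"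
  by (auto simp: branch_def)

lemma level_power_0: "level_power 0 Q = Q"
proof
  show "Q \<subseteq> level_power 0 Q"
  proof
    fix g assume "g \<in> Q"
    then show "g \<in> level_power 0 Q"
      unfolding level_power_def branch_0 by (intro CollectI exI[of _ "\<lambda>_. g"]) simp
  qed
qed (auto simp: level_power_def branch_0)

lemma level_power_Suc: "level_power (Suc m) Q = prs (level_power m Q) (level_power m Q)"
proof
  show "level_power (Suc m) Q \<subseteq> prs (level_power m Q) (level_power m Q)"
  proof
    fix p assume "p \<in> level_power (Suc m) Q"
    then obtain q where q: "p = branch (Suc m) q" "\<And>\<sigma>. length \<sigma> = Suc m \<Longrightarrow> q \<sigma> \<in> Q"
      unfolding level_power_def by blast
    have "branch m (\<lambda>\<sigma>. q (u # \<sigma>)) \<in> level_power m Q" for u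
      unfolding level_power_def using q(2) by auto
    then show "p \<in> prs (level_power m Q) (level_power m Q)"
      unfolding q(1) branch_Suc prs_def by blast
  qed
  show "prs (level_power m Q) (level_power m Q) \<subseteq> level_power (Suc m) Q"
  proof
    fix p assume "p \<in> prs (level_power m Q) (level_power m Q)"
    then obtain q0 q1 where p: "p = pair (branch m q0) (branch m q1)"
      and q: "\<And>\<sigma>. length \<sigma> = m \<Longrightarrow> q0 \<sigma> \<in> Q" "\<And>\<sigma>. length \<sigma> = m \<Longrightarrow> q1 \<sigma> \<in> Q"
      unfolding prs_def level_power_def by blast
    define q where "q = (\<lambda>\<sigma>. if hd \<sigma> = 0 then q0 (tl \<sigma>) else q1 (tl \<sigma>))"
    have "p = branch (Suc m) q" unfolding branch_Suc p q_def by simp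
    moreover have "q \<sigma> \<in> Q" if "length \<sigma> = Suc m" for \<sigma>
      using that q unfolding q_def by simp
    ultimately show "p \<in> level_power (Suc m) Q" unfolding level_power_def by blast
  qed
qed

lemma tT_subset_tK: "tT \<subseteq> tK"
  using tN1_incl(2) tN1_subset_tK by blast

lemma prs_mono: "A \<subseteq> B \<Longrightarrow> prs A A \<subseteq> prs B B"
  unfolding prs_def by blast

lemma level_power_subset: "Q \<subseteq> tK \<Longrightarrow> level_power m Q \<subseteq> tK"
proof (induct m)
  case (Suc m)
  then show ?case
    unfolding level_power_Suc using prs_mono[of "level_power m Q" tK] prs_tK_subset by blast
qed (simp add: level_power_0)

lemma prs_set_mult:
  assumes "A \<subseteq> tK" "B \<subseteq> tK"
  shows "prs A A <#>\<^bsub>tG\<^esub> prs B B = prs (A <#>\<^bsub>tG\<^esub> B) (A <#>\<^bsub>tG\<^esub> B)"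
proof -
  have mult: "pair g h \<odot> pair k l = pair (g \<odot> k) (h \<odot> l)"
    if "g \<in> A" "h \<in> A" "k \<in> B" "l \<in> B" for g h k l
    using that assms pair_tK by (intro pair_mult) blast+
  show ?thesis
  proof (intro subset_antisym subsetI)
    fix p assume "p \<in> prs A A <#>\<^bsub>tG\<^esub> prs B B"
    then obtain g h k l where "p = pair g h \<odot> pair k l" "g \<in> A" "h \<in> A" "k \<in> B" "l \<in> B"
      unfolding set_mult_def prs_def by blast
    then show "p \<in> prs (A <#>\<^bsub>tG\<^esub> B) (A <#>\<^bsub>tG\<^esub> B)"
      using mult unfolding prs_def by (auto intro: set_mult_memI)
  next
    fix p assume "p \<in> prs (A <#>\<^bsub>tG\<^esub> B) (A <#>\<^bsub>tG\<^esub> B)"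
    then obtain g h k l where p: "p = pair (g \<odot> k) (h \<odot> l)" "g \<in> A" "h \<in> A" "k \<in> B" "l \<in> B"
      unfolding set_mult_def prs_def by blast
    then have "p = pair g h \<odot> pair k l" using mult by simp
    moreover have "pair g h \<in> prs A A" "pair k l \<in> prs B B" unfolding prs_def using p by auto
    ultimately show "p \<in> prs A A <#>\<^bsub>tG\<^esub> prs B B" by (simp add: set_mult_memI)
  qed
qed

lemma tN_1: "tN 1 = tN1"
  using level_power_Suc[of 0 tK] by (simp add: tN_def tN1_def level_power_0)

lemma tN_Suc:
  assumes "m \<ge> 1"
  shows "tN (Suc m) = prs (tN m) (tN m)"
proof -
  obtain k where m: "m = Suc k" using assms by (cases m) auto
  have "tN (Suc m) = prs (level_power m tK) (level_power m tK) <#>\<^bsub>tG\<^esub>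
      prs (level_power k tT) (level_power k tT)"
    by (simp add: tN_def level_power_Suc m)
  also have "\<dots> = prs (tN m) (tN m)"
    using prs_set_mult[OF level_power_subset[of tK m] level_power_subset[OF tT_subset_tK, of k]]
    by (simp add: tN_def m)
  finally show ?thesis .
qed

lemma two_power_ge: "m \<ge> 1 \<Longrightarrow> (2 :: nat) ^ m + 1 + r \<ge> 3"
  using power_increasing[of 1 m "2 :: nat"] by simp

lemma LC_tN: "m \<ge> 1 \<Longrightarrow> LC (2 ^ m + 1) = tN m"
proof (induct m rule: dec_induct)
  case base
  then show ?case using LC3 tN_1 by simp
next
  case (step m)
  have e: "2 ^ Suc m + 1 = 2 * (2 ^ m + 1) - (1 :: nat)" by simp
  have "(2 :: nat) ^ m + 1 \<ge> 3" using two_power_ge[of m 0] step by simp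
  from LC_odd[OF this] show ?case unfolding e step.hyps(3) tN_Suc[OF step.hyps(1)] .
qed

lemma tN_normal: "m \<ge> 1 \<Longrightarrow> tN m \<lhd> tG"
  using LC_tN tG.lower_central_normal by metis

lemma tN_subset_tK: "m \<ge> 1 \<Longrightarrow> tN m \<subseteq> tK"
  using LC_subset_tK[of "2 ^ m + 1"] two_power_ge[of m 0] LC_tN[of m] by simp

text \<open>On \<open>N\<^sub>m\<close> and at words of length \<open>m\<close> this is the coordinate
  \<open>\<alpha>\<close> for \<open>k = 0\<close> and \<open>\<beta>\<close> for \<open>k = 1\<close>: the parities 0
  and 1 of the left section are dual to \<open>x\<close> and \<open>y\<close> and vanish on \<open>z\<close>, the section of
  \<open>x\<^sup>2\<close>.\<close>

definition coord :: "nat \<Rightarrow> (word \<Rightarrow> word) \<Rightarrow> word \<Rightarrow> bit" where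
  "coord k g \<sigma> = lpar k (sec \<sigma> g)"

text \<open>The coordinate \<open>\<gamma>\<close>: the left section of \<open>x\<^sup>2\<close> is \<open>z\<close> up to
  inversion, on which the left parity 2 is 1, while that parity vanishes on \<open>K\<close>.\<close>

definition coordT :: "(word \<Rightarrow> word) \<Rightarrow> word \<Rightarrow> bit" where
  "coordT g \<tau> = lpar 2 (lsec (sec \<tau> g))"

lemma coord_pair [simp]:
  "coord k (pair g h) (0 # \<sigma>) = coord k g \<sigma>" "coord k (pair g h) (1 # \<sigma>) = coord k h \<sigma>"
  "coordT (pair g h) (0 # \<sigma>) = coordT g \<sigma>" "coordT (pair g h) (1 # \<sigma>) = coordT h \<sigma>"
  by (simp_all add: coord_def coordT_def)

lemma tN_pair:
  assumes "m \<ge> 1" "p \<in> tN (Suc m)"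
  obtains g h where "p = pair g h" "g \<in> tN m" "h \<in> tN m" "pair g h \<in> GG"
proof -
  obtain g h where "p = pair g h" "g \<in> tN m" "h \<in> tN m"
    using assms tN_Suc unfolding prs_def by auto
  then show ?thesis using that pair_tK tN_subset_tK[OF assms(1)] by blast
qed

lemma coord_mult:
  assumes "m \<ge> 1"
  shows "g \<in> tN m \<Longrightarrow> h \<in> tN m \<Longrightarrow> \<sigma> \<in> words m \<Longrightarrow> coord k (g \<odot> h) \<sigma> = coord k g \<sigma> + coord k h \<sigma>"
  using assms
proof (induct m arbitrary: g h \<sigma> rule: dec_induct)
  case base
  then obtain u where "\<sigma> = [u]" by (cases \<sigma>) simp_all
  moreover have "g \<in> tN1" "h \<in> tN1" using base tN_1 by auto
  from tN1_section_mult[OF this, of k] have "coord k (g \<odot> h) [0] = coord k g [0] + coord k h [0]"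
    "coord k (g \<odot> h) [1] = coord k g [1] + coord k h [1]" by (simp_all add: coord_def)
  ultimately show ?case by (cases u) simp_all
next
  case (step m)
  obtain u \<tau> where \<sigma>: "\<sigma> = u # \<tau>" "\<tau> \<in> words m" using step.prems by (cases \<sigma>) auto
  obtain g0 g1 where g: "g = pair g0 g1" "g0 \<in> tN m" "g1 \<in> tN m" "pair g0 g1 \<in> GG"
    by (rule tN_pair[OF step.hyps(1) step.prems(1)])
  obtain h0 h1 where h: "h = pair h0 h1" "h0 \<in> tN m" "h1 \<in> tN m" "pair h0 h1 \<in> GG"
    by (rule tN_pair[OF step.hyps(1) step.prems(2)])
  show ?case
    using step.hyps(3) \<sigma> g h by (cases u) (simp_all add: pair_mult)
qed

lemma coordT_mult:
  assumes "m \<ge> 1"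
  shows "g \<in> tN m \<Longrightarrow> h \<in> tN m \<Longrightarrow> \<tau> \<in> words (m - 1) \<Longrightarrow> coordT (g \<odot> h) \<tau> = coordT g \<tau> + coordT h \<tau>"
  using assms
proof (induct m arbitrary: g h \<tau> rule: dec_induct)
  case base
  then have "g \<in> tN1" "h \<in> tN1" "\<tau> = []" using tN_1 by auto
  then show ?case using tN1_section_mult(1)[of g h 2] by (simp add: coordT_def)
next
  case (step m)
  obtain u \<rho> where \<tau>: "\<tau> = u # \<rho>" "\<rho> \<in> words (m - 1)" using step.prems step.hyps(1) by (cases \<tau>) auto
  obtain g0 g1 where g: "g = pair g0 g1" "g0 \<in> tN m" "g1 \<in> tN m" "pair g0 g1 \<in> GG"
    by (rule tN_pair[OF step.hyps(1) step.prems(1)])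
  obtain h0 h1 where h: "h = pair h0 h1" "h0 \<in> tN m" "h1 \<in> tN m" "pair h0 h1 \<in> GG"
    by (rule tN_pair[OF step.hyps(1) step.prems(2)])
  show ?case
    using step.hyps(3) \<tau> g h by (cases u) (simp_all add: pair_mult)
qed

text \<open>The recursion of the lower central series on pairs is the recursion of the spaces
  \<open>V\<^sub>n\<^sup>r\<close> on the first letter.\<close>

lemma LC_coordinates:
  assumes "m \<ge> 1"
  shows "g \<in> tN m \<Longrightarrow> r \<le> 2 ^ m \<Longrightarrow> g \<in> LC (2 ^ m + 1 + r) \<longleftrightarrow>
    inS m r (coord 0 g) \<and> inS m r (coord 1 g) \<and> inS (m - 1) r (coordT g)"
  using assms
proof (induct m arbitrary: g r rule: dec_induct)
  case base
  then have g: "g \<in> tN1" using tN_1 by simp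
  then obtain s t where st: "g = pair s t" "s \<in> LC 2" "t \<in> LC 2" using tN1_pair by metis
  have S: "inS 1 r f \<longleftrightarrow> inS 0 (r div 2) (\<lambda>\<sigma>. f (0 # \<sigma>)) \<and> inS 0 (r div 2) (\<lambda>\<sigma>. f (1 # \<sigma>)) \<and>
    (odd r \<longrightarrow> inS 0 (Suc (r div 2)) (\<lambda>\<sigma>. f (0 # \<sigma>) + f (1 # \<sigma>)))" for f r
    using inS.simps(2)[of 0 r f] by simp
  have c: "coord k g [0] = lpar k s" "coord k g [1] = lpar k t" "coordT g [] = lpar 2 s" for k
    by (simp_all add: st coord_def coordT_def)
  have "r = 0 \<or> r = 1 \<or> r = 2" using base(2) by auto
  then show ?case
  proof (elim disjE)
    assume r: "r = 0"
    then show ?thesis using g LC3 inS_all[of 1] by simp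
  next
    assume r: "r = 1"
    have "g \<in> LC 4 \<longleftrightarrow> lpar 2 s = 0 \<and> lpar 0 s = lpar 0 t \<and> lpar 1 s = lpar 1 t"
      using LC4 diag_iff_parities[of s t] g st by simp
    then show ?thesis unfolding S using r c bit_add_eq_0_iff by auto
  next
    assume r: "r = 2"
    have "g \<in> LC 5 \<longleftrightarrow> s \<in> tN1 \<and> t \<in> tN1" unfolding LC5 prs_def st(1) by auto
    also have "\<dots> \<longleftrightarrow> lpar 2 s = 0 \<and> (lpar 0 s = 0 \<and> lpar 0 t = 0) \<and> (lpar 1 s = 0 \<and> lpar 1 t = 0)"
    proof
      assume "lpar 2 s = 0 \<and> (lpar 0 s = 0 \<and> lpar 0 t = 0) \<and> (lpar 1 s = 0 \<and> lpar 1 t = 0)"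
      moreover from this have "t \<in> tK" using tN1_kernel[of s t] g st by simp
      ultimately show "s \<in> tN1 \<and> t \<in> tN1" using lpar_kernel st lpar_tK by blast
    qed (auto simp: lpar_tN1)
    finally have "g \<in> LC 5 \<longleftrightarrow> lpar 2 s = 0 \<and> (lpar 0 s = 0 \<and> lpar 0 t = 0) \<and> (lpar 1 s = 0 \<and> lpar 1 t = 0)" .
    then show ?thesis unfolding S using r c by auto
  qed
next
  case (step m)
  define n s where "n = 2 ^ m + 1 + r div 2" and "s = r div 2"
  have n3: "n \<ge> 3" unfolding n_def using two_power_ge step.hyps(1) by blast
  obtain g0 g1 where g: "g = pair g0 g1" "g0 \<in> tN m" "g1 \<in> tN m" "pair g0 g1 \<in> GG"
    by (rule tN_pair[OF step.hyps(1) step.prems(1)])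
  obtain k where m: "m = Suc k" using step.hyps(1) by (cases m) auto
  have s: "s \<le> 2 ^ m" using step.prems unfolding s_def by simp
  have S: "inS (Suc m) r (coord k g) \<longleftrightarrow> inS m s (coord k g0) \<and> inS m s (coord k g1) \<and>
      (odd r \<longrightarrow> inS m (Suc s) (coord k (g0 \<odot> g1)))" for k
  proof -
    have "inS m (Suc s) (coord k (g0 \<odot> g1)) \<longleftrightarrow> inS m (Suc s) (\<lambda>\<sigma>. coord k g0 \<sigma> + coord k g1 \<sigma>)"
      by (rule inS_cong) (simp add: coord_mult[OF step.hyps(1)] g)
    then show ?thesis using g(1) s_def by simp
  qed
  have T: "inS m r (coordT g) \<longleftrightarrow> inS (m - 1) s (coordT g0) \<and> inS (m - 1) s (coordT g1) \<and>
      (odd r \<longrightarrow> inS (m - 1) (Suc s) (coordT (g0 \<odot> g1)))"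
  proof -
    have "inS (m - 1) (Suc s) (coordT (g0 \<odot> g1)) \<longleftrightarrow> inS (m - 1) (Suc s) (\<lambda>\<sigma>. coordT g0 \<sigma> + coordT g1 \<sigma>)"
      by (rule inS_cong) (simp add: coordT_mult[OF step.hyps(1)] g)
    then show ?thesis using g(1) s_def by (simp add: m)
  qed
  have IH: "h \<in> LC n \<longleftrightarrow> inS m s (coord 0 h) \<and> inS m s (coord 1 h) \<and> inS (m - 1) s (coordT h)"
    if "h \<in> tN m" for h
    using step.hyps(3)[OF that s] unfolding n_def s_def by simp
  show ?case
  proof (cases "even r")
    case True
    then have "2 ^ Suc m + 1 + r = 2 * n - 1" unfolding n_def by (auto elim: evenE)
    then have "g \<in> LC (2 ^ Suc m + 1 + r) \<longleftrightarrow> g0 \<in> LC n \<and> g1 \<in> LC n"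
      using LC_odd[OF n3] g(1) by (simp add: prs_def)
    then show ?thesis using S T IH g True by auto
  next
    case False
    then have e: "2 ^ Suc m + 1 + r = 2 * n" unfolding n_def by (auto elim: oddE)
    have s1: "Suc s \<le> 2 ^ m" using False step.prems unfolding s_def by (auto elim!: oddE)
    have mem: "g0 \<odot> g1 \<in> tN m" using g tG.normal_mult[OF tN_normal[OF step.hyps(1)]] by blast
    have IH': "g0 \<odot> g1 \<in> LC (Suc n) \<longleftrightarrow> inS m (Suc s) (coord 0 (g0 \<odot> g1)) \<and>
        inS m (Suc s) (coord 1 (g0 \<odot> g1)) \<and> inS (m - 1) (Suc s) (coordT (g0 \<odot> g1))"
      using step.hyps(3)[OF mem s1] unfolding n_def s_def by simp
    have "g \<in> LC (2 ^ Suc m + 1 + r) \<longleftrightarrow> g0 \<in> LC n \<and> g1 \<in> LC n \<and> g0 \<odot> g1 \<in> LC (Suc n)"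
      unfolding e LC_even[OF n3] diag_def g(1) by auto
    then show ?thesis using S T IH[OF g(2)] IH[OF g(3)] IH' False by auto
  qed
qed

text \<open>By the description of \<open>\<gamma>\<^sub>n\<close> for \<open>n = 2\<^sup>m + 1 + 2\<^sup>m\<close>,
  where the spaces of functions have become zero.\<close>

lemma tN_kernel:
  assumes m: "m \<ge> 1" and g: "g \<in> tN m"
  shows "g \<in> tN (Suc m) \<longleftrightarrow> (\<forall>\<sigma>\<in>words m. coord 0 g \<sigma> = 0) \<and> (\<forall>\<sigma>\<in>words m. coord 1 g \<sigma> = 0) \<and>
    (\<forall>\<tau>\<in>words (m - 1). coordT g \<tau> = 0)"
proof -
  have "tN (Suc m) = LC (2 ^ m + 1 + 2 ^ m)"
    using LC_tN[of "Suc m"] by (simp add: mult_2)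
  moreover have "(2 :: nat) ^ (m - 1) \<le> 2 ^ m" by (intro power_increasing) auto
  ultimately show ?thesis
    using LC_coordinates[OF m g, of "2 ^ m"] inS_top by simp
qed

lemma coord_surj:
  assumes "m \<ge> 1"
  shows "\<exists>g \<in> tN m. (\<forall>\<sigma>\<in>words m. coord 0 g \<sigma> = \<alpha> \<sigma>) \<and> (\<forall>\<sigma>\<in>words m. coord 1 g \<sigma> = \<beta> \<sigma>) \<and>
    (\<forall>\<tau>\<in>words (m - 1). coordT g \<tau> = \<gamma> \<tau>)"
  using assms
proof (induct m arbitrary: \<alpha> \<beta> \<gamma> rule: dec_induct)
  case base
  note N = tN1_normal and K = tK_normal
  define k where "k u = bpow x_elt (\<alpha> [u]) \<odot> bpow y_elt (\<beta> [u])" for u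
  have kK: "k u \<in> tK" for u
    unfolding k_def using bpow_mem[OF K] xy_in_tK tG.normal_mult[OF K] by blast
  have bst: "bpow g e \<in> level_stabilizer" if "g \<in> tK" for g e
    using bpow_mem[OF K that] tK_stabilizer by blast
  have kp: "lpar j (k u) = lpar j x_elt * \<alpha> [u] + lpar j y_elt * \<beta> [u]" for j u
    unfolding k_def lpar_mult[OF bst[OF xy_in_tK(1)] bst[OF xy_in_tK(2)]] lpar_bpow ..
  let ?p = "pair (k 0) (k 1)" and ?t = "bpow x2_elt (\<gamma> [])"
  have p: "?p \<in> tN1" using kK tN1_incl(1) unfolding prs_def by blast
  have t: "?t \<in> tN1" using bpow_mem[OF N pair_id_tN1(5)] .
  have tp: "lpar j (lsec ?t) = lpar j z_elt * \<gamma> []" "lpar j (rsec ?t) = lpar j z_elt * \<gamma> []" for j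
  proof -
    have "lsec id = id" "rsec id = id" using sec_pair[of id id] by simp_all
    then show "lpar j (lsec ?t) = lpar j z_elt * \<gamma> []" "lpar j (rsec ?t) = lpar j z_elt * \<gamma> []"
      by (cases "\<gamma> []"; simp add: bpow_def x2_pair elt_inverses)+
  qed
  have l: "lpar j (lsec (?p \<odot> ?t)) = lpar j (k 0) + lpar j z_elt * \<gamma> []"
    "lpar j (rsec (?p \<odot> ?t)) = lpar j (k 1) + lpar j z_elt * \<gamma> []" for j
    unfolding tN1_section_mult[OF p t] tp sec_pair by simp_all
  have w: "(\<forall>\<sigma>\<in>words 1. P \<sigma>) \<longleftrightarrow> P [0] \<and> P [1]" for P
  proof (intro iffI conjI ballI)
    fix \<sigma> assume a: "P [0] \<and> P [1]" and "\<sigma> \<in> words 1"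
    then obtain u where "\<sigma> = [u]" by (cases \<sigma>) auto
    then show "P \<sigma>" using a by (cases u) auto
  qed auto
  have "?p \<odot> ?t \<in> tN 1" using tG.normal_mult[OF N p t] tN_1 by simp
  moreover have "coord 0 (?p \<odot> ?t) [0] = \<alpha> [0]" "coord 0 (?p \<odot> ?t) [1] = \<alpha> [1]"
    "coord 1 (?p \<odot> ?t) [0] = \<beta> [0]" "coord 1 (?p \<odot> ?t) [1] = \<beta> [1]" "coordT (?p \<odot> ?t) [] = \<gamma> []"
    using lpar_elts by (simp_all add: coord_def coordT_def l kp)
  ultimately show ?case unfolding w by (intro bexI[of _ "?p \<odot> ?t"]) simp_all
next
  case (step m)
  obtain k where m: "m = Suc k" using step.hyps(1) by (cases m) auto
  have ex: "\<exists>g \<in> tN m. (\<forall>\<sigma>\<in>words m. coord 0 g \<sigma> = \<alpha> (u # \<sigma>)) \<and> (\<forall>\<sigma>\<in>words m. coord 1 g \<sigma> = \<beta> (u # \<sigma>)) \<and>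
    (\<forall>\<tau>\<in>words (m - 1). coordT g \<tau> = \<gamma> (u # \<tau>))" for u
    using step.hyps(3)[of "\<lambda>\<sigma>. \<alpha> (u # \<sigma>)" "\<lambda>\<sigma>. \<beta> (u # \<sigma>)" "\<lambda>\<sigma>. \<gamma> (u # \<sigma>)"] .
  obtain g0 where g0: "g0 \<in> tN m" "\<forall>\<sigma>\<in>words m. coord 0 g0 \<sigma> = \<alpha> (0 # \<sigma>)"
    "\<forall>\<sigma>\<in>words m. coord 1 g0 \<sigma> = \<beta> (0 # \<sigma>)" "\<forall>\<tau>\<in>words (m - 1). coordT g0 \<tau> = \<gamma> (0 # \<tau>)"
    using ex[of 0] by blast
  obtain g1 where g1: "g1 \<in> tN m" "\<forall>\<sigma>\<in>words m. coord 0 g1 \<sigma> = \<alpha> (1 # \<sigma>)"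
    "\<forall>\<sigma>\<in>words m. coord 1 g1 \<sigma> = \<beta> (1 # \<sigma>)" "\<forall>\<tau>\<in>words (m - 1). coordT g1 \<tau> = \<gamma> (1 # \<tau>)"
    using ex[of 1] by blast
  have w: "(\<forall>\<sigma>\<in>words (Suc n). P \<sigma>) \<longleftrightarrow> (\<forall>\<sigma>\<in>words n. P (0 # \<sigma>)) \<and> (\<forall>\<sigma>\<in>words n. P (1 # \<sigma>))" for P n
  proof (intro iffI conjI ballI)
    fix \<sigma> assume a: "(\<forall>\<sigma>\<in>words n. P (0 # \<sigma>)) \<and> (\<forall>\<sigma>\<in>words n. P (1 # \<sigma>))" and "\<sigma> \<in> words (Suc n)"
    then obtain u \<tau> where "\<sigma> = u # \<tau>" "\<tau> \<in> words n" by (cases \<sigma>) auto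
    then show "P \<sigma>" using a by (cases u) auto
  qed auto
  have "pair g0 g1 \<in> tN (Suc m)" unfolding tN_Suc[OF step.hyps(1)] prs_def using g0 g1 by blast
  moreover have "Suc m - 1 = Suc (m - 1)" using m by simp
  then have "\<forall>\<tau>\<in>words (Suc m - 1). coordT (pair g0 g1) \<tau> = \<gamma> \<tau>"
    using g0(4) g1(4) by (simp only: w coord_pair)
  moreover have "\<forall>\<sigma>\<in>words (Suc m). coord 0 (pair g0 g1) \<sigma> = \<alpha> \<sigma>"
    "\<forall>\<sigma>\<in>words (Suc m). coord 1 (pair g0 g1) \<sigma> = \<beta> \<sigma>"
    using g0 g1 by (simp_all only: w coord_pair)
  ultimately show ?case by blast
qed

lemma at_vertex_Nil: "at_vertex [] g = g"
  by (simp add: at_vertex_def branch_0)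

lemma at_vertex_Cons:
  "at_vertex (0 # \<sigma>) g = pair (at_vertex \<sigma> g) id" "at_vertex (1 # \<sigma>) g = pair id (at_vertex \<sigma> g)"
proof -
  have "(\<lambda>\<tau>. ((\<lambda>_. id)(u # \<sigma> := g)) (u # \<tau>)) = (\<lambda>_. id)(\<sigma> := g)" for u :: bit by auto
  moreover have "(\<lambda>\<tau>. ((\<lambda>_. id)(0 # \<sigma> := g)) (1 # \<tau>)) = (\<lambda>_. id)"
    "(\<lambda>\<tau>. ((\<lambda>_. id)(1 # \<sigma> := g)) (0 # \<tau>)) = (\<lambda>_. id)" by auto
  ultimately show "at_vertex (0 # \<sigma>) g = pair (at_vertex \<sigma> g) id"
    "at_vertex (1 # \<sigma>) g = pair id (at_vertex \<sigma> g)"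
    by (simp_all only: at_vertex_def list.size add_Suc_right add_0_right branch_Suc branch_id
        list.size One_nat_def plus_1_eq_Suc)
qed

lemma sec_at_vertex: "length \<tau> = length \<sigma> \<Longrightarrow> sec \<tau> (at_vertex \<sigma> g) = (if \<tau> = \<sigma> then g else id)"
proof (induct \<sigma> arbitrary: \<tau>)
  case (Cons u \<sigma>)
  then obtain w \<rho> where "\<tau> = w # \<rho>" "length \<rho> = length \<sigma>" by (cases \<tau>) auto
  then show ?case using Cons(1)[of \<rho>] by (cases u; cases w) (auto simp: at_vertex_Cons)
qed (simp add: at_vertex_Nil)

lemma coord_at_vertex:
  "length \<tau> = length \<sigma> \<Longrightarrow> coord k (at_vertex \<sigma> g) \<tau> = (if \<tau> = \<sigma> then lpar k g else 0)"
  by (simp add: coord_def sec_at_vertex)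

lemma coordT_at_vertex_tK:
  assumes "length \<sigma> = Suc (length \<tau>)" "lpar 2 g = 0"
  shows "coordT (at_vertex \<sigma> g) \<tau> = 0"
proof -
  have "coordT (at_vertex \<sigma> g) \<tau> = lpar 2 (sec (\<tau> @ [0]) (at_vertex \<sigma> g))"
    by (simp add: coordT_def sec_append)
  then show ?thesis using assms sec_at_vertex[of "\<tau> @ [0]" \<sigma> g] by simp
qed

lemma coordT_at_vertex:
  "length \<tau> = length \<sigma> \<Longrightarrow> coordT (at_vertex \<sigma> g) \<tau> = (if \<tau> = \<sigma> then lpar 2 (lsec g) else 0)"
proof -
  have "lsec id = id" using sec_pair(1)[of id id] by simp
  then show "length \<tau> = length \<sigma> \<Longrightarrow> ?thesis" by (simp add: coordT_def sec_at_vertex)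
qed

lemma coord_at_vertex_x2:
  assumes "length \<sigma> = Suc (length \<tau>)" "k < 2"
  shows "coord k (at_vertex \<tau> x2_elt) \<sigma> = 0"
proof -
  obtain \<rho> u where \<sigma>: "\<sigma> = \<rho> @ [u]" "length \<rho> = length \<tau>"
    using assms(1) by (cases \<sigma> rule: rev_cases) auto
  have "k = 0 \<or> k = 1" using assms(2) by auto
  moreover have "lsec id = id" "rsec id = id" using sec_pair[of id id] by simp_all
  moreover have "lsec x2_elt = z_elt" "rsec x2_elt = z_elt" by (simp_all add: x2_pair elt_inverses)
  ultimately show ?thesis
    using \<sigma> lpar_elts by (auto simp: coord_def sec_append sec_at_vertex)
qed

lemma at_vertex_tN:
  assumes "m \<ge> 1"
  shows "g \<in> tK \<Longrightarrow> \<sigma> \<in> words m \<Longrightarrow> at_vertex \<sigma> g \<in> tN m"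
    and "\<tau> \<in> words (m - 1) \<Longrightarrow> at_vertex \<tau> x2_elt \<in> tN m"
proof -
  have id: "id \<in> tN m" if "m \<ge> 1" for m
    using tG.normal_one[OF tN_normal[OF that]] by (simp add: tG_one_id)
  have idK: "id \<in> tK" using tG.normal_one[OF tK_normal] by (simp add: tG_one_id)
  show "g \<in> tK \<Longrightarrow> \<sigma> \<in> words m \<Longrightarrow> at_vertex \<sigma> g \<in> tN m"
    using assms
  proof (induct m arbitrary: \<sigma> rule: dec_induct)
    case base
    then obtain u where "\<sigma> = [u]" by (cases \<sigma>) auto
    moreover have "pair g id \<in> tN1" "pair id g \<in> tN1"
      using base idK tN1_incl(1) unfolding prs_def by auto
    ultimately show ?case unfolding tN_1 by (cases u) (simp_all add: at_vertex_Cons at_vertex_Nil)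
  next
    case (step m)
    then obtain u \<rho> where e: "\<sigma> = u # \<rho>" "\<rho> \<in> words m" by (cases \<sigma>) auto
    then have "at_vertex \<rho> g \<in> tN m" using step by blast
    then show ?case unfolding tN_Suc[OF step.hyps(1)] prs_def e
      using id[OF step.hyps(1)] by (cases u) (auto simp: at_vertex_Cons)
  qed
  show "\<tau> \<in> words (m - 1) \<Longrightarrow> at_vertex \<tau> x2_elt \<in> tN m"
    using assms
  proof (induct m arbitrary: \<tau> rule: dec_induct)
    case base
    then show ?case using pair_id_tN1(5) by (simp add: tN_1[unfolded One_nat_def] at_vertex_Nil)
  next
    case (step m)
    then obtain u \<rho> where e: "\<tau> = u # \<rho>" "\<rho> \<in> words (m - 1)" by (cases \<tau>) auto
    then have "at_vertex \<rho> x2_elt \<in> tN m" using step by blast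
    then show ?case unfolding tN_Suc[OF step.hyps(1)] prs_def e
      using id[OF step.hyps(1)] by (cases u) (auto simp: at_vertex_Cons)
  qed
qed

text \<open>The elements on which the coordinates of the layer are prescribed.\<close>

definition layer_gens :: "nat \<Rightarrow> (word \<Rightarrow> word) set" where
  "layer_gens m = {at_vertex \<sigma> g | \<sigma> g. \<sigma> \<in> words m \<and> g \<in> {x_elt, y_elt}} \<union>
    {at_vertex \<tau> x2_elt | \<tau>. \<tau> \<in> words (m - 1)}"

lemma tK_generate: "tK \<subseteq> generate tG (tN1 \<union> {x_elt, y_elt})"
  unfolding tK_def
proof (rule tG.normal_closure_le_generate[OF _ tN1_normal])
  show "{x_elt, y_elt} \<subseteq> GG" by simp
  fix s g assume "s \<in> {x_elt, y_elt}" "g \<in> GG"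
  then show "comm s g \<in> tN1" using tG.commut_in_commg[of s tK g] xy_in_tK commg_tK by auto
qed

lemma factor_subgroup:
  assumes H: "subgroup H tG"
  shows "subgroup {g \<in> tK. pair g id \<in> H} tG" "subgroup {g \<in> tK. pair id g \<in> H} tG"
proof -
  note K = tG.normalD[OF tK_normal]
  have idK: "id \<in> tK" using K(7) by (simp add: tG_one_id)
  have factor: "subgroup {g \<in> tK. f g \<in> H} tG"
    if f: "f id = id" "\<And>g h. g \<in> tK \<Longrightarrow> h \<in> tK \<Longrightarrow> f (g \<odot> h) = f g \<odot> f h"
      "\<And>g. g \<in> tK \<Longrightarrow> f (\<iota> g) = \<iota> (f g)" for f
  proof (rule tG.subgroupI)
    show "{g \<in> tK. f g \<in> H} \<subseteq> GG" using K(2) by blast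
    have "id \<in> {g \<in> tK. f g \<in> H}"
      using idK f(1) subgroup.one_closed[OF H] by (simp add: tG_one_id)
    then show "{g \<in> tK. f g \<in> H} \<noteq> {}" by blast
  qed (use K(5,6) f(2,3) subgroup.m_closed[OF H] subgroup.m_inv_closed[OF H] in auto)
  show "subgroup {g \<in> tK. pair g id \<in> H} tG" "subgroup {g \<in> tK. pair id g \<in> H} tG"
    using idK pair_tK by (rule_tac factor; simp add: pair_mult pair_inv)+
qed

lemma prs_subset_subgroup:
  assumes H: "subgroup H tG" and A: "A \<subseteq> tK"
    and l: "\<And>g. g \<in> A \<Longrightarrow> pair g id \<in> H" and r: "\<And>g. g \<in> A \<Longrightarrow> pair id g \<in> H"
  shows "prs A A \<subseteq> H"
proof
  fix p assume "p \<in> prs A A"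
  then obtain g h where p: "p = pair g h" "g \<in> A" "h \<in> A" unfolding prs_def by blast
  have idK: "id \<in> tK" using tG.normal_one[OF tK_normal] by (simp add: tG_one_id)
  have "pair g id \<odot> pair id h = p"
    using p A idK pair_tK tG.normal_mem[OF tK_normal] by (subst pair_mult) auto
  then show "p \<in> H" using subgroup.m_closed[OF H l[OF p(2)] r[OF p(3)]] by simp
qed

text \<open>By induction on the layer: the elements \<open>g\<close> for which \<open>(g, 1)\<close>, respectively
  \<open>(1, g)\<close>, lies in \<open>H\<close> form a subgroup to which the preceding layer applies.\<close>

lemma tN_generated:
  assumes "m \<ge> 1"
  shows "subgroup H tG \<Longrightarrow> tN (Suc m) \<subseteq> H \<Longrightarrow> layer_gens m \<subseteq> H \<Longrightarrow> tN m \<subseteq> H"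
  using assms
proof (induct m arbitrary: H rule: dec_induct)
  case base
  note H = base(1)
  have idN: "id \<in> tN1" by (rule pair_id_tN1(6))
  have t2: "tN (Suc 1) = prs tN1 tN1" using tN_Suc[of 1] tN_1 by (simp only: order_refl)
  have N: "pair g id \<in> H" "pair id g \<in> H" if "g \<in> tN1" for g
  proof -
    have "pair g id \<in> tN (Suc 1)" "pair id g \<in> tN (Suc 1)" unfolding t2 prs_def using that idN by blast+
    then show "pair g id \<in> H" "pair id g \<in> H" using base(2) by blast+
  qed
  have g: "pair g id \<in> H" "pair id g \<in> H" if "g \<in> {x_elt, y_elt}" for g
  proof -
    have "[u] \<in> words 1" for u :: bit by simp
    then have "at_vertex [u] g \<in> H" for u using base(3) that unfolding layer_gens_def by blast
    from this[of 0] this[of 1] show "pair g id \<in> H" "pair id g \<in> H"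
      by (simp_all add: at_vertex_Cons at_vertex_Nil)
  qed
  have gs: "tN1 \<union> {x_elt, y_elt} \<subseteq> {g \<in> tK. pair g id \<in> H}" "tN1 \<union> {x_elt, y_elt} \<subseteq> {g \<in> tK. pair id g \<in> H}"
    using N g tN1_subset_tK xy_in_tK by blast+
  have "tK \<subseteq> {g \<in> tK. pair g id \<in> H}" "tK \<subseteq> {g \<in> tK. pair id g \<in> H}"
    using order_trans[OF tK_generate tG.generate_subgroup_incl[OF gs(1) factor_subgroup(1)[OF H]]]
      order_trans[OF tK_generate tG.generate_subgroup_incl[OF gs(2) factor_subgroup(2)[OF H]]] .
  then have "prs tK tK \<subseteq> H" by (intro prs_subset_subgroup[OF H order_refl]) blast+
  moreover have "x2_elt \<in> H"
    using base(3) at_vertex_Nil[of x2_elt] unfolding layer_gens_def by auto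
  ultimately have "generate tG (prs tK tK \<union> {x2_elt}) \<subseteq> H"
    by (intro tG.generate_subgroup_incl[OF _ H]) simp
  then show ?case using tN1_generate tN_1 by simp
next
  case (step m)
  note H = step.prems(1) and m = step.hyps(1)
  have K: "tN m \<subseteq> tK" "tN (Suc m) \<subseteq> tK" using tN_subset_tK m by auto
  have id: "id \<in> tN (Suc m)" using tG.normal_one[OF tN_normal[of "Suc m"]] by (simp add: tG_one_id)
  have t2: "tN (Suc (Suc m)) = prs (tN (Suc m)) (tN (Suc m))" by (rule tN_Suc) simp
  have N: "pair g id \<in> H" "pair id g \<in> H" if "g \<in> tN (Suc m)" for g
  proof -
    have "pair g id \<in> tN (Suc (Suc m))" "pair id g \<in> tN (Suc (Suc m))"
      unfolding t2 prs_def using that id by blast+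
    then show "pair g id \<in> H" "pair id g \<in> H" using step.prems(2) by blast+
  qed
  have g: "pair g id \<in> H \<and> pair id g \<in> H \<and> g \<in> tK" if gm: "g \<in> layer_gens m" for g
  proof -
    have *: "at_vertex (u # \<sigma>) k \<in> H" if "\<sigma> \<in> words m" "k \<in> {x_elt, y_elt}" for u \<sigma> k
    proof -
      have "u # \<sigma> \<in> words (Suc m)" using that by simp
      then show ?thesis using step.prems(3) that(2) unfolding layer_gens_def by blast
    qed
    have **: "at_vertex (u # \<sigma>) x2_elt \<in> H" if "\<sigma> \<in> words (m - 1)" for u \<sigma>
    proof -
      have "u # \<sigma> \<in> words (Suc m - 1)" using that m by auto
      then show ?thesis using step.prems(3) unfolding layer_gens_def by blast
    qed
    from gm consider \<sigma> k where "g = at_vertex \<sigma> k" "\<sigma> \<in> words m" "k \<in> {x_elt, y_elt}"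
      | \<tau> where "g = at_vertex \<tau> x2_elt" "\<tau> \<in> words (m - 1)"
      unfolding layer_gens_def by blast
    then show ?thesis
    proof cases
      case 1
      then have "g \<in> tK" using at_vertex_tN(1)[OF m, of k \<sigma>] K xy_in_tK by blast
      then show ?thesis using *[OF 1(2,3), of 0] *[OF 1(2,3), of 1] 1(1) by (simp add: at_vertex_Cons)
    next
      case 2
      then have "g \<in> tK" using at_vertex_tN(2)[OF m, of \<tau>] K by blast
      then show ?thesis using **[OF 2(2), of 0] **[OF 2(2), of 1] 2(1) by (simp add: at_vertex_Cons)
    qed
  qed
  have "tN m \<subseteq> {g \<in> tK. pair g id \<in> H}" "tN m \<subseteq> {g \<in> tK. pair id g \<in> H}"
    using step.hyps(3)[OF factor_subgroup(1)[OF H]] step.hyps(3)[OF factor_subgroup(2)[OF H]] N g K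
    by blast+
  then show ?case
    unfolding tN_Suc[OF m] using K by (intro prs_subset_subgroup[OF H]) blast+
qed

definition coord_target :: "nat \<Rightarrow> (F2_mpoly set \<times> F2_mpoly set \<times> F2_mpoly set) monoid" where
  "coord_target m = add_monoid (V m) \<times>\<times> (add_monoid (V m) \<times>\<times> add_monoid (V (m - 1)))"

definition coord_vec :: "nat \<Rightarrow> (word \<Rightarrow> word) \<Rightarrow> F2_mpoly set \<times> F2_mpoly set \<times> F2_mpoly set" where
  "coord_vec m g = (VF m (coord 0 g), VF m (coord 1 g), VF (m - 1) (coordT g))"

lemma group_coord_target: "group (coord_target m)"
  unfolding coord_target_def
  by (intro DirProd_group abelian_group.a_group V_structure(4))

lemma tN_quot_group:
  assumes "m \<ge> 1"
  shows "group (tG\<lparr>carrier := tN m\<rparr>)" "tN (m + 1) \<lhd> tG\<lparr>carrier := tN m\<rparr>" "tN (m + 1) \<subseteq> tN m"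
proof -
  note S = tG.normal_sub[OF tN_normal[OF assms]]
  have "(2 :: nat) ^ m + 1 \<le> 2 ^ Suc m + 1" by simp
  from tG.lower_central_antimono[OF this] show sub: "tN (m + 1) \<subseteq> tN m"
    using LC_tN[OF assms] LC_tN[of "Suc m"] by simp
  show "group (tG\<lparr>carrier := tN m\<rparr>)" using tG.subgroup_imp_group[OF S] .
  show "tN (m + 1) \<lhd> tG\<lparr>carrier := tN m\<rparr>"
    by (rule tG.normal_restrict_supergroup[OF S tN_normal sub]) simp
qed

lemma coord_vec_hom:
  assumes "m \<ge> 1"
  shows "coord_vec m \<in> hom (tG\<lparr>carrier := tN m\<rparr>) (coord_target m)"
proof (rule homI)
  fix g assume "g \<in> carrier (tG\<lparr>carrier := tN m\<rparr>)"
  show "coord_vec m g \<in> carrier (coord_target m)"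
    by (simp add: coord_vec_def coord_target_def DirProd_def VF_carrier)
next
  fix g h assume gh: "g \<in> carrier (tG\<lparr>carrier := tN m\<rparr>)" "h \<in> carrier (tG\<lparr>carrier := tN m\<rparr>)"
  then have "VF m (coord k (g \<odot> h)) = VF m (coord k g) \<oplus>\<^bsub>V m\<^esub> VF m (coord k h)" for k
    unfolding VF_add VF_eq_iff using coord_mult[OF assms, of g h] by simp
  moreover have "VF (m - 1) (coordT (g \<odot> h)) = VF (m - 1) (coordT g) \<oplus>\<^bsub>V (m - 1)\<^esub> VF (m - 1) (coordT h)"
    unfolding VF_add VF_eq_iff using coordT_mult[OF assms, of g h] gh by simp
  ultimately show "coord_vec m (g \<otimes>\<^bsub>tG\<lparr>carrier := tN m\<rparr>\<^esub> h) =
      coord_vec m g \<otimes>\<^bsub>coord_target m\<^esub> coord_vec m h"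
    by (simp add: coord_vec_def coord_target_def DirProd_def)
qed

lemma coord_vec_kernel:
  assumes "m \<ge> 1"
  shows "kernel (tG\<lparr>carrier := tN m\<rparr>) (coord_target m) (coord_vec m) = tN (m + 1)"
proof -
  have "\<one>\<^bsub>coord_target m\<^esub> = (VF m (\<lambda>_. 0), VF m (\<lambda>_. 0), VF (m - 1) (\<lambda>_. 0))"
    by (simp add: coord_target_def DirProd_def VF_zero)
  then have "coord_vec m g = \<one>\<^bsub>coord_target m\<^esub> \<longleftrightarrow> g \<in> tN (Suc m)" if "g \<in> tN m" for g
    unfolding tN_kernel[OF assms that] coord_vec_def by (simp add: VF_eq_iff)
  then show ?thesis unfolding kernel_def using tN_quot_group(3)[OF assms] by auto
qed

lemma coord_vec_surj:
  assumes "m \<ge> 1"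
  shows "coord_vec m ` tN m = carrier (coord_target m)"
proof
  show "coord_vec m ` tN m \<subseteq> carrier (coord_target m)"
    using hom_carrier[OF coord_vec_hom[OF assms]] by simp
  show "carrier (coord_target m) \<subseteq> coord_vec m ` tN m"
  proof
    fix t assume "t \<in> carrier (coord_target m)"
    then obtain \<alpha> \<beta> \<gamma> where t: "t = (VF m \<alpha>, VF m \<beta>, VF (m - 1) \<gamma>)"
      unfolding coord_target_def DirProd_def by (auto simp: VF_carrier)
    obtain g where g: "g \<in> tN m" "\<forall>\<sigma>\<in>words m. coord 0 g \<sigma> = \<alpha> \<sigma>" "\<forall>\<sigma>\<in>words m. coord 1 g \<sigma> = \<beta> \<sigma>"
      "\<forall>\<tau>\<in>words (m - 1). coordT g \<tau> = \<gamma> \<tau>"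
      using coord_surj[OF assms, of \<alpha> \<beta> \<gamma>] by blast
    have "t = coord_vec m g" unfolding t coord_vec_def using g by (simp add: VF_eq_iff)
    then show "t \<in> coord_vec m ` tN m" using g(1) by blast
  qed
qed

lemma coord_vec_gens:
  assumes "m \<ge> 1"
  shows "\<sigma> \<in> words m \<Longrightarrow> coord_vec m (at_vertex \<sigma> x_elt) = (V_monom \<sigma>, \<zero>\<^bsub>V m\<^esub>, \<zero>\<^bsub>V (m - 1)\<^esub>)"
    and "\<sigma> \<in> words m \<Longrightarrow> coord_vec m (at_vertex \<sigma> y_elt) = (\<zero>\<^bsub>V m\<^esub>, V_monom \<sigma>, \<zero>\<^bsub>V (m - 1)\<^esub>)"
    and "\<tau> \<in> words (m - 1) \<Longrightarrow> coord_vec m (at_vertex \<tau> x2_elt) = (\<zero>\<^bsub>V m\<^esub>, \<zero>\<^bsub>V m\<^esub>, V_monom \<tau>)"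
proof -
  have l: "Suc (m - 1) = m" using assms by simp
  have x2: "lpar 2 (lsec x2_elt) = 1" by (simp add: x2_pair elt_inverses lpar_elts)
  have T: "coordT (at_vertex \<sigma> g) \<tau> = 0"
    if "\<sigma> \<in> words m" "lpar 2 g = 0" "\<tau> \<in> words (m - 1)" for \<sigma> \<tau> g
    using that assms by (intro coordT_at_vertex_tK) auto
  show "\<sigma> \<in> words m \<Longrightarrow> coord_vec m (at_vertex \<sigma> x_elt) = (V_monom \<sigma>, \<zero>\<^bsub>V m\<^esub>, \<zero>\<^bsub>V (m - 1)\<^esub>)"
    using T[of \<sigma> x_elt] lpar_elts
    by (simp add: coord_vec_def VF_monom VF_zero VF_eq_iff coord_at_vertex)
  show "\<sigma> \<in> words m \<Longrightarrow> coord_vec m (at_vertex \<sigma> y_elt) = (\<zero>\<^bsub>V m\<^esub>, V_monom \<sigma>, \<zero>\<^bsub>V (m - 1)\<^esub>)"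
    using T[of \<sigma> y_elt] lpar_elts
    by (simp add: coord_vec_def VF_monom VF_zero VF_eq_iff coord_at_vertex)
  assume \<tau>: "\<tau> \<in> words (m - 1)"
  have "coord k (at_vertex \<tau> x2_elt) \<sigma> = 0" if "\<sigma> \<in> words m" "k < 2" for \<sigma> k
    using that \<tau> assms by (intro coord_at_vertex_x2) auto
  then show "coord_vec m (at_vertex \<tau> x2_elt) = (\<zero>\<^bsub>V m\<^esub>, \<zero>\<^bsub>V m\<^esub>, V_monom \<tau>)"
    using \<tau> x2 by (simp add: coord_vec_def VF_monom VF_zero VF_eq_iff coordT_at_vertex)
qed

text \<open>The explicit coordinates are a surjective homomorphism with kernel
  \<open>N\<^sub>m\<^sub>+\<^sub>1\<close>.\<close>

lemma is_coord_iso_exists: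
  assumes m: "m \<ge> 1"
  shows "\<exists>\<phi>. is_coord_iso m \<phi>"
proof -
  let ?G = "tG\<lparr>carrier := tN m\<rparr>"
  interpret h: group_hom ?G "coord_target m" "coord_vec m"
    using tN_quot_group(1)[OF m] group_coord_target coord_vec_hom[OF m]
    by (intro group_hom.intro group_hom_axioms.intro)
  let ?\<phi> = "\<lambda>X. the_elem (coord_vec m ` X)"
  have iso: "?\<phi> \<in> iso (tN_quot m) (coord_target m)"
    using h.FactGroup_iso_set coord_vec_surj[OF m] unfolding coord_vec_kernel[OF m] tN_quot_def by simp
  have val: "?\<phi> (tN_class m g) = coord_vec m g" if g: "g \<in> tN m" for g
  proof -
    have const: "coord_vec m u = coord_vec m g" if u: "u \<in> tN_class m g" for u
    proof -
      obtain n where n: "n \<in> tN (m + 1)" "u = n \<odot> g" using u unfolding tN_class_def r_coset_def by blast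
      have "n \<in> tN m" using n tN_quot_group(3)[OF m] by blast
      then have "coord_vec m u = coord_vec m n \<otimes>\<^bsub>coord_target m\<^esub> coord_vec m g"
        using h.hom_mult[of n g] g n by simp
      moreover have "coord_vec m n = \<one>\<^bsub>coord_target m\<^esub>"
        using coord_vec_kernel[OF m] n unfolding kernel_def by blast
      ultimately show ?thesis using h.hom_closed[of g] g by simp
    qed
    have mem: "g \<in> tN_class m g"
      unfolding tN_class_def using tG.rcos_self[OF _ tG.normal_sub[OF tN_normal]]
        tG.normal_mem[OF tN_normal[OF m] g] by simp
    have "coord_vec m ` tN_class m g = (\<lambda>_. coord_vec m g) ` tN_class m g"
      by (rule image_cong[OF refl const])
    also have "\<dots> = {coord_vec m g}" using mem by blast
    finally show ?thesis by simp
  qed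
  have "is_coord_iso m ?\<phi>"
    unfolding is_coord_iso_def
    using iso val coord_vec_gens[OF m] at_vertex_tN[OF m] xy_in_tK
    unfolding coord_target_def by simp
  then show ?thesis by blast
qed

text \<open>Two homomorphisms that agree on \<open>N\<^sub>m\<^sub>+\<^sub>1\<close> and on the generators of the layer agree
  on \<open>N\<^sub>m\<close>. Hence the chosen isomorphism is given by the explicit coordinates.\<close>

lemma is_coord_iso_unique:
  assumes m: "m \<ge> 1" and \<phi>: "is_coord_iso m \<phi>" and g: "g \<in> tN m"
  shows "\<phi> (tN_class m g) = coord_vec m g"
proof -
  let ?G = "tG\<lparr>carrier := tN m\<rparr>"
  note N = tG.normalD[OF tN_normal[OF m]]
  interpret h: group_hom ?G "coord_target m" "coord_vec m"
    using tN_quot_group(1)[OF m] group_coord_target coord_vec_hom[OF m]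
    by (intro group_hom.intro group_hom_axioms.intro)
  have q: "tN_class m = r_coset ?G (tN (m + 1))"
    by (auto simp: tN_class_def r_coset_def fun_eq_iff)
  have "tN_class m \<in> hom ?G (tN_quot m)"
    unfolding q tN_quot_def using normal.r_coset_hom_Mod[OF tN_quot_group(2)[OF m]] .
  moreover have \<phi>h: "\<phi> \<in> hom (tN_quot m) (coord_target m)"
    using \<phi> unfolding is_coord_iso_def iso_def coord_target_def by blast
  ultimately have "\<phi> \<circ> tN_class m \<in> hom ?G (coord_target m)"
    by (rule hom_compose)
  then interpret p: group_hom ?G "coord_target m" "\<phi> \<circ> tN_class m"
    using tN_quot_group(1)[OF m] group_coord_target
    by (intro group_hom.intro group_hom_axioms.intro)
  let ?H = "{u \<in> tN m. \<phi> (tN_class m u) = coord_vec m u}"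
  have iG: "inv\<^bsub>?G\<^esub> u = \<iota> u" if "u \<in> tN m" for u
    using tG.m_inv_consistent[OF N(1) that] .
  have "subgroup ?H tG"
  proof (rule tG.subgroupI)
    show "?H \<subseteq> GG" using N(2) by blast
    have "\<one>\<^bsub>tG\<^esub> \<in> ?H" using N(7) p.hom_one h.hom_one by simp
    then show "?H \<noteq> {}" by blast
  next
    fix u assume u: "u \<in> ?H"
    then show "\<iota> u \<in> ?H" using N(6) p.hom_inv[of u] h.hom_inv[of u] iG[of u] by simp
  next
    fix u w assume "u \<in> ?H" "w \<in> ?H"
    then show "u \<odot> w \<in> ?H" using N(5) p.hom_mult[of u w] h.hom_mult[of u w] by simp
  qed
  moreover have "tN (Suc m) \<subseteq> ?H"
  proof
    fix u assume u: "u \<in> tN (Suc m)"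
    then have um: "u \<in> tN m" using tN_quot_group(3)[OF m] by auto
    have "tN_class m u = tN (m + 1)"
      unfolding tN_class_def using tG.coset_join2[OF _ tG.normal_sub[OF tN_normal]] u um N(8) by simp
    moreover have "tN_class m \<one>\<^bsub>tG\<^esub> = tN (m + 1)"
      unfolding tN_class_def using tG.coset_join2[OF _ tG.normal_sub[OF tN_normal]]
        tG.normal_one[OF tN_normal] by simp
    ultimately have "\<phi> (tN_class m u) = \<one>\<^bsub>coord_target m\<^esub>" using p.hom_one by simp
    moreover have "coord_vec m u = \<one>\<^bsub>coord_target m\<^esub>"
      using coord_vec_kernel[OF m] u unfolding kernel_def by auto
    ultimately show "u \<in> ?H" using um by simp
  qed
  moreover have "layer_gens m \<subseteq> ?H"
    using \<phi> coord_vec_gens[OF m] at_vertex_tN[OF m] xy_in_tK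
    unfolding layer_gens_def is_coord_iso_def by auto
  ultimately have "tN m \<subseteq> ?H" by (rule tN_generated[OF m])
  then show ?thesis using g by blast
qed

lemma coord_preimage_LC:
  assumes m: "m \<ge> 1" and r: "r \<le> 2 ^ m"
  shows "LC (2 ^ m + 1 + r) = coord_preimage m (V_sub m r) (V_sub m r) (V_sub (m - 1) r)"
proof -
  have "is_coord_iso m (coord_iso m)"
    unfolding coord_iso_def using is_coord_iso_exists[OF m] by (rule someI_ex)
  then have "coord_iso m (tN_class m g) = coord_vec m g" if "g \<in> tN m" for g
    using is_coord_iso_unique[OF m] that by blast
  then have "coord_preimage m (V_sub m r) (V_sub m r) (V_sub (m - 1) r) =
      {g \<in> tN m. inS m r (coord 0 g) \<and> inS m r (coord 1 g) \<and> inS (m - 1) r (coordT g)}"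
    unfolding coord_preimage_def by (auto simp: coord_vec_def VF_in_V_sub)
  also have "\<dots> = {g \<in> tN m. g \<in> LC (2 ^ m + 1 + r)}"
    using LC_coordinates[OF m _ r] by blast
  also have "\<dots> = LC (2 ^ m + 1 + r)"
    using tG.lower_central_antimono[of "2 ^ m + 1" "2 ^ m + 1 + r"] LC_tN[OF m] by auto
  finally show ?thesis by simp
qed

theorem theorem7p4:
  shows
    "(\<forall>m\<ge>1. lower_central tG (2 ^ m + 1) = tN m) \<and>
     (\<forall>m\<ge>1. \<forall>r\<le>2 ^ m. lower_central tG (2 ^ m + 1 + r) =
        coord_preimage m (V_sub m r) (V_sub m r) (V_sub (m - 1) r)) \<and>
     (let rk = (\<lambda>n. F2_rank (tG\<lparr>carrier := lower_central tG n\<rparr> Mod lower_central tG (n + 1)))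
      in rk 1 = 4 \<and> rk 2 = 3 \<and>
         (\<forall>m\<ge>1. \<forall>r<2 ^ (m - 1). rk (2 ^ m + 1 + r) = 3) \<and>
         (\<forall>m\<ge>1. \<forall>r. 2 ^ (m - 1) \<le> r \<and> r < 2 ^ m \<longrightarrow> rk (2 ^ m + 1 + r) = 2))"
proof -
  define rk where "rk = (\<lambda>n. F2_rank (tG\<lparr>carrier := LC n\<rparr> Mod LC (n + 1)))"
  have rk: "rk n = k" if "n \<ge> 1" "LC_index n = 2 ^ k" for n k
    unfolding rk_def using LC_rank[OF that] .
  have "rk (2 ^ m + 1 + r) = 3" if "m \<ge> 1" "r < 2 ^ (m - 1)" for m r :: nat
  proof (rule rk)
    have "(2 :: nat) ^ (m - 1) \<le> 2 ^ m" by (intro power_increasing) auto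
    then have "r < 2 ^ m" using that(2) by linarith
    then show "LC_index (2 ^ m + 1 + r) = 2 ^ 3" using LC_index_layers[of m r] that by simp
  qed simp
  moreover have "rk (2 ^ m + 1 + r) = 2" if "m \<ge> 1" "2 ^ (m - 1) \<le> r" "r < 2 ^ m" for m r :: nat
    using LC_index_layers[of m r] that by (intro rk) simp_all
  moreover have "rk 1 = 4" "rk 2 = 3"
    using rk[OF _ LC_index_1] rk[OF _ LC_index_2] by (simp_all only: order_refl one_le_numeral)
  ultimately have "rk 1 = 4 \<and> rk 2 = 3 \<and> (\<forall>m\<ge>1. \<forall>r<2 ^ (m - 1). rk (2 ^ m + 1 + r) = 3) \<and>
      (\<forall>m\<ge>1. \<forall>r. 2 ^ (m - 1) \<le> r \<and> r < 2 ^ m \<longrightarrow> rk (2 ^ m + 1 + r) = 2)"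
    by blast
  moreover have "\<forall>m\<ge>1. LC (2 ^ m + 1) = tN m"
    by (intro allI impI LC_tN)
  moreover have "\<forall>m\<ge>1. \<forall>r\<le>2 ^ m. LC (2 ^ m + 1 + r) =
      coord_preimage m (V_sub m r) (V_sub m r) (V_sub (m - 1) r)"
    by (intro allI impI coord_preimage_LC)
  ultimately show ?thesis
    unfolding Let_def rk_def by (intro conjI) (erule conjE | assumption)+
qed

end
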